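(* Let $\mu$ be a measure on the Borel subsets of $(0,\infty)$ such that $$0<\int_0^\infty\frac{\lambda}{\lambda^2+1}\,d\mu(\lambda)<\infty,$$ and let $N$ be a nonnegative integer. With $q_\mu$ and $g_\mu(N;x)$ as defined in the context, the inequality $$g_\mu(N;x)\le q_\mu(x)$$ holds for all $x$ in $\mathbb{R}/\mathbb{Z}$. If $\widetilde g(x)$ is a real trigonometric polynomial of degree at most $N$ that satisfies $\widetilde g(x)\le q_\mu(x)$ for all $x$ in $\mathbb{R}/\mathbb{Z}$, then $$\int_{\mathbb{R}/\mathbb{Z}}\widetilde g(x)\,dx\le\int_{\mathbb{R}/\mathbb{Z}}g_\mu(N;x)\,dx.$$ Moreover, there is equality in this last inequality if and only if $\widetilde g(x)=g_\mu(N;x)$.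
   Context: Write $e(x)=e^{2\pi i x}$, and $\operatorname{sgn}(x)=1,0,-1$ according as $x>0$, $x=0$, $x<0$. Integrals over $\mathbb{R}/\mathbb{Z}$ are with respect to Haar measure of total mass $1$. A real trigonometric polynomial of degree at most $N$ is a real valued function of the form $\sum_{n=-N}^N c_ne(nx)$. For $\lambda>0$ and $x\in\mathbb{R}/\mathbb{Z}$ let $$p(\lambda,x)=-\tfrac2\lambda+\sum_{m=-\infty}^\infty e^{-\lambda|x+m|}.$$ Define $q_\mu:\mathbb{R}/\mathbb{Z}\to\mathbb{R}\cup\{\infty\}$ by $$q_\mu(x)=\int_0^\infty p(\lambda,x)\,d\mu(\lambda),$$ where $\lambda\mapsto p(\lambda,x)$ is $\mu$-integrable for $x\notin\mathbb{Z}$, and $q_\mu(0)=\int_0^\infty\{\coth(\frac\lambda2)-\frac2\lambda\}\,d\mu(\lambda)$ may equal $\infty$. For $\lambda>0$ define the entire function (with removable singularities removed) $$L(\lambda,z)=\left(\frac{\cos\pi z}{\pi}\right)^2\left\{\sum_{k\in\mathbb{Z}}\frac{e^{-\lambda|k+\frac12|}}{(z-k-\frac12)^2}-\lambda\sum_{l\in\mathbb{Z}}\frac{\operatorname{sgn}(l+\frac12)e^{-\lambda|l+\frac12|}}{z-l-\frac12}\right\},$$ which is integrable on $\mathbb{R}$, and let $\widehat L(\lambda,t)=\int_{-\infty}^\infty L(\lambda,x)e(-tx)\,dx$. Define $$g_\mu(N;x)=\sum_{n=-N}^N\widehat g_\mu(N;n)e(nx),$$ where $$\widehat g_\mu(N;0)=-\int_0^\infty\left\{\tfrac2\lambda-\tfrac1{N+1}\operatorname{csch}\left(\tfrac{\lambda}{2N+2}\right)\right\}d\mu(\lambda),\qquad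 \widehat g_\mu(N;n)=\tfrac1{N+1}\int_0^\infty\widehat L\left(\tfrac{\lambda}{N+1},\tfrac{n}{N+1}\right)d\mu(\lambda)\quad(n\ne0).$$ *)

theory Defs
  imports "HOL-Complex_Analysis.Complex_Analysis"
begin

text \<open>
  Functions on the circle group (reals modulo integers) are represented by their 1-periodic lifts
  to the real line, so "for all x in the circle" becomes "for all real x", and integration against
  the Haar measure of total mass 1 becomes Lebesgue integration over the fundamental domain
  \<open>{0..<1}\<close>.
\<close>

definition unit_exp :: "real \<Rightarrow> complex" where
  "unit_exp x = exp (2 * of_real pi * \<i> * of_real x)"

definition coth :: "real \<Rightarrow> real" where
  "coth x = cosh x / sinh x"

definition csch :: "real \<Rightarrow> real" where
  "csch x = 1 / sinh x"

definition real_trig_poly :: "nat \<Rightarrow> (real \<Rightarrow> real) \<Rightarrow> bool" where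
  "real_trig_poly N f \<longleftrightarrow>
     (\<exists>c :: int \<Rightarrow> complex. \<forall>x :: real.
        complex_of_real (f x) = (\<Sum>n = - int N..int N. c n * unit_exp (of_int n * x)))"

definition p_fun :: "real \<Rightarrow> real \<Rightarrow> real" where
  "p_fun l x = - (2 / l) + (\<Sum>\<^sub>\<infinity>m\<in>(UNIV :: int set). exp (- l * \<bar>x + of_int m\<bar>))"

text \<open>
  At integers the integrand is positive on the positive half-line, so the nonnegative integral
  (with value possibly \<open>\<infinity>\<close>) is the right one; at other points the integral is finite.
\<close>

definition q_mu :: "real measure \<Rightarrow> real \<Rightarrow> ereal" where
  "q_mu \<mu> x =
     (if x \<in> \<int> then enn2ereal (\<integral>\<^sup>+ l. ennreal (coth (l / 2) - 2 / l) \<partial>\<mu>)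
      else ereal (LINT l|\<mu>. p_fun l x))"

definition L_raw :: "real \<Rightarrow> complex \<Rightarrow> complex" where
  "L_raw l z = (cos (of_real pi * z) / of_real pi)\<^sup>2 *
     ((\<Sum>\<^sub>\<infinity>k\<in>(UNIV :: int set).
         of_real (exp (- l * \<bar>of_int k + 1/2\<bar>)) / (z - of_int k - 1/2)\<^sup>2)
      - of_real l * (\<Sum>\<^sub>\<infinity>k\<in>(UNIV :: int set).
         of_real (sgn (of_int k + 1/2) * exp (- l * \<bar>of_int k + 1/2\<bar>)) / (z - of_int k - 1/2)))"

text \<open>
  \<open>L_raw l\<close> has removable singularities at the half-integers, where division by zero
  makes the displayed formula meaningless.
\<close>

definition L_fun :: "real \<Rightarrow> complex \<Rightarrow> complex" where
  "L_fun l = remove_sings (L_raw l)"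

definition L_hat :: "real \<Rightarrow> real \<Rightarrow> complex" where
  "L_hat l t = (LINT x|lborel. L_fun l (of_real x) * unit_exp (- t * x))"

definition g_hat :: "real measure \<Rightarrow> nat \<Rightarrow> int \<Rightarrow> complex" where
  "g_hat \<mu> N n =
     (if n = 0
      then of_real (- (LINT l|\<mu>. 2 / l - 1 / (real N + 1) * csch (l / (2 * real N + 2))))
      else 1 / (of_nat N + 1) * (LINT l|\<mu>. L_hat (l / (real N + 1)) (of_int n / (real N + 1))))"

definition g_mu :: "real measure \<Rightarrow> nat \<Rightarrow> real \<Rightarrow> complex" where
  "g_mu \<mu> N x = (\<Sum>n = - int N..int N. g_hat \<mu> N n * unit_exp (of_int n * x))"

end

theory Submission
  imports Defs "HOL-Probability.Characteristic_Functions" "HOL-Probability.Sinc_Integral"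
begin

text \<open>
  For one parameter \<open>l\<close> write \<open>K\<close> for the periodic exponential and \<open>G\<close> for its candidate minorant. The
  Fourier coefficients of \<open>G\<close> come from termwise Fourier inversion of the series defining \<open>L\<close>; pairing
  the frequencies \<open>n\<close> and \<open>n - (N + 1)\<close> shows that \<open>G\<close> agrees with \<open>K\<close> to second order at the \<open>N + 1\<close>
  points \<open>(j + 1/2) / (N + 1)\<close>. Since \<open>K'' = l\<^sup>2 K\<close>, a further zero of \<open>K - G\<close> would by
  Rolle's theorem, applied to the factors of \<open>D\<^sup>2 - l\<^sup>2\<close>, give the trigonometric polynomial \<open>l\<^sup>2 G - G''\<close> of
  degree \<open>N\<close> at least \<open>2 N + 1\<close> zeros. Hence \<open>K - G\<close> has constant sign, and the sign is read off from
  its mean. Integrating in \<open>l\<close> yields the minorant; it is extremal because the mean of a trigonometric polynomial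
  of degree \<open>N\<close> is its average over these points, and in the equality case the difference of the two
  minorants has double zeros there.
\<close>

section \<open>Zeros of trigonometric polynomials\<close>

text \<open>The zero count is tight. A further zero gives \<open>F = K - G\<close> at least
  \<open>N + 2\<close> zeros, hence \<open>N + 1\<close> points with \<open>F' = l F\<close> away
  from them. The nodes, where \<open>F = F' = 0\<close>, raise this to \<open>2 N + 2\<close> zeros
  of \<open>F' - l F\<close>, and the second use of Rolle leaves exactly \<open>2 N + 1\<close>, one
  more than a nonzero trigonometric polynomial of degree \<open>N\<close> can have in a period. The
  operator is dictated by \<open>K\<close>, which it annihilates. The sign from the mean is the
  inequality \<open>sinh x > x\<close>. Two obstacles shape the rest. Near \<open>l = 0\<close> both
  \<open>K\<close> and \<open>G\<close> grow like \<open>2 / l\<close>, while the hypothesis on the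
  measure controls only functions of size \<open>min l (1 / l)\<close>; hence every bound is stated
  after subtracting \<open>2 / l\<close>, and uniformity in \<open>l\<close> has to be tracked. In
  the equality case no derivative of \<open>q_mu\<close> is at hand; it is replaced by a quadratic
  upper bound for \<open>q_mu\<close> at each node, obtained from Taylor's formula under the
  integral, which is enough to force equal derivatives.\<close>

lemma rolle_zeros:
  fixes f f' :: "real \<Rightarrow> real"
  assumes "finite S" "S \<noteq> {}" "S \<subseteq> {a<..<b}"
    and der: "\<And>x. (f has_real_derivative f' x) (at x)"
    and zero: "\<And>x. x \<in> S \<Longrightarrow> f x = 0"
  shows "\<exists>R. finite R \<and> Suc (card R) = card S \<and> R \<inter> S = {} \<and> R \<subseteq> {a<..<b} \<and>
           (\<forall>x\<in>R. f' x = c * f x)"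
proof -
  \<comment> \<open>The points of \<open>S\<close> are added in increasing order. Keeping
    \<open>R\<close> inside the open span of \<open>S\<close> guarantees that the point gained
    beyond the old maximum is new.\<close>
  have "\<exists>R. finite R \<and> Suc (card R) = card S \<and> R \<inter> S = {} \<and> R \<subseteq> {Min S<..<Max S} \<and>
           (\<forall>x\<in>R. f' x = c * f x)"
    using \<open>finite S\<close> \<open>S \<noteq> {}\<close> zero
  proof (induction rule: finite_linorder_max_induct)
    case empty
    then show ?case by simp
  next
    case (insert m S)
    show ?case
    proof (cases "S = {}")
      case True
      then show ?thesis by (intro exI[of _ "{}"]) auto
    next
      case False
      with insert obtain R where R: "finite R" "Suc (card R) = card S" "R \<inter> S = {}"
        "R \<subseteq> {Min S<..<Max S}" "\<forall>x\<in>R. f' x = c * f x"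
        by auto
      \<comment> \<open>Integrating factor: the derivative of \<open>g\<close> is a nonvanishing
        multiple of \<open>f' - c f\<close>, so the ordinary Rolle theorem can be applied to
        \<open>g\<close>.\<close>
      define g where "g x = exp (- c * x) * f x" for x
      have gder: "(g has_real_derivative exp (- c * x) * (f' x - c * f x)) (at x)" for x
        unfolding g_def using der[of x] by (auto intro!: derivative_eq_intros simp: algebra_simps)
      have Max: "Max S < m" "Max S \<in> S" using insert False by auto
      have g0: "g (Max S) = g m" using insert.prems Max by (simp add: g_def)
      have "\<exists>z. Max S < z \<and> z < m \<and> (\<lambda>v. exp (- c * z) * (f' z - c * f z) * v) = (\<lambda>v. 0)"
      proof (rule Rolle_deriv[OF Max(1) g0])
        show "continuous_on {Max S..m} g"
          using gder by (intro continuous_at_imp_continuous_on) (blast intro: DERIV_isCont)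
        show "(g has_derivative (*) (exp (- c * x) * (f' x - c * f x))) (at x)" for x
          using gder[of x] by (simp add: has_field_derivative_def)
      qed
      then obtain z where z: "Max S < z" "z < m" "exp (- c * z) * (f' z - c * f z) = 0"
        by (metis mult_cancel_left1 mult.right_neutral)
      have zS: "z \<notin> S" using Max(2) z(1) \<open>finite S\<close> by (meson Max_ge leD)
      have zR: "z \<notin> R" using R(4) z(1) by auto
      have mR: "m \<notin> R" using R(4) Max by auto
      have eqs: "Min (insert m S) = Min S" "Max (insert m S) = m"
        using \<open>finite S\<close> False Max(1) by (auto simp: min_def max_def) 
          (meson False Max.coboundedI Max_in Min_in dual_order.trans leD linorder_not_le)+
      have mM: "Min S \<le> Max S" using \<open>finite S\<close> False by simp
      show ?thesis
      proof (intro exI[of _ "insert z R"] conjI)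
        show "insert z R \<inter> insert m S = {}" using zS mR z R(3) by auto
        show "insert z R \<subseteq> {Min (insert m S)<..<Max (insert m S)}"
          unfolding eqs using R(4) z mM Max by auto
        show "Suc (card (insert z R)) = card (insert m S)"
          using R zR insert by auto
      qed (use R z in auto)
    qed
  qed
  moreover have "{Min S<..<Max S} \<subseteq> {a<..<b}"
    using assms(1-3) Min_in[of S] Max_in[of S] by fastforce
  ultimately show ?thesis by blast
qed

lemma unit_exp_add: "unit_exp (x + y) = unit_exp x * unit_exp y"
  by (simp add: unit_exp_def exp_add algebra_simps)

lemma unit_exp_0 [simp]: "unit_exp 0 = 1"
  by (simp add: unit_exp_def)

lemma unit_exp_of_nat_mult: "unit_exp (of_nat n * x) = unit_exp x ^ n"
  by (simp add: unit_exp_def exp_of_nat_mult [symmetric] algebra_simps)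

lemma unit_exp_conv: "unit_exp x = cis (2 * pi * x)"
  by (simp add: unit_exp_def cis_conv_exp algebra_simps)

lemma unit_exp_of_int [simp]: "unit_exp (of_int n) = 1"
  by (simp add: unit_exp_conv cis_multiple_2pi)

lemma norm_unit_exp [simp]: "norm (unit_exp x) = 1"
  by (simp add: unit_exp_conv)

lemma inj_on_unit_exp: "inj_on unit_exp {0<..<1}"
proof (rule inj_onI)
  fix x y assume xy: "x \<in> {0<..<1::real}" "y \<in> {0<..<1}" "unit_exp x = unit_exp y"
  then obtain n :: int where
    n: "2 * of_real pi * \<i> * of_real x = 2 * of_real pi * \<i> * complex_of_real y + of_int (2 * n) * pi * \<i>"
    unfolding unit_exp_def exp_eq by auto
  then have "2 * pi * (x - y) = 2 * pi * of_int n"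
    by (auto simp: complex_eq_iff algebra_simps)
  then have "x - y = of_int n" by simp
  moreover from this xy have "n = 0" by auto
  ultimately show "x = y" by simp
qed

text \<open>Multiplication by \<open>unit_exp (N x)\<close> turns the sum into a polynomial of
  degree at most \<open>2 N\<close> in \<open>unit_exp x\<close>, and points of the open unit
  interval yield distinct roots. A conclusion about coefficients allows factors to be cancelled
  frequency by frequency later.\<close>

lemma trig_poly_coeffs_zero:
  fixes c :: "int \<Rightarrow> complex"
  assumes "finite S" "S \<subseteq> {0<..<1}" "card S \<ge> 2 * N + 1"
    and zero: "\<And>x. x \<in> S \<Longrightarrow> (\<Sum>n = - int N..int N. c n * unit_exp (of_int n * x)) = 0"
    and n: "\<bar>n\<bar> \<le> int N"
  shows "c n = 0"
proof -
  define p where "p = (\<Sum>k\<le>2*N. monom (c (int k - int N)) k)"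
  have coeff: "coeff p k = (if k \<le> 2 * N then c (int k - int N) else 0)" for k
    by (simp add: p_def coeff_sum)
  have poly_p: "poly p (unit_exp x) = unit_exp (real N * x) *
      (\<Sum>n = - int N..int N. c n * unit_exp (of_int n * x))" for x
  proof -
    have "(\<Sum>n = - int N..int N. c n * unit_exp (of_int n * x)) =
        (\<Sum>k\<le>2*N. c (int k - int N) * unit_exp (of_int (int k - int N) * x))"
      by (rule sum.reindex_bij_witness[of _ "\<lambda>k. int k - int N" "\<lambda>n. nat (n + int N)"]) auto
    moreover have "unit_exp (real N * x) * (c (int k - int N) * unit_exp (of_int (int k - int N) * x))
       = c (int k - int N) * unit_exp x ^ k" for k
    proof -
      have "unit_exp (real N * x) * unit_exp (of_int (int k - int N) * x) = unit_exp (real k * x)"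
        by (simp add: algebra_simps flip: unit_exp_add)
      then show ?thesis by (simp add: unit_exp_of_nat_mult)
    qed
    ultimately show ?thesis
      by (simp only: p_def poly_sum poly_monom sum_distrib_left)
  qed
  have "p = 0"
  proof (rule ccontr)
    assume p: "p \<noteq> 0"
    have "degree p \<le> 2 * N" by (rule degree_le) (simp add: coeff)
    moreover have "card (unit_exp ` S) \<le> card {z. poly p z = 0}"
      using p by (intro card_mono poly_roots_finite) (auto simp: poly_p zero)
    moreover have "card (unit_exp ` S) = card S"
      by (rule card_image) (rule inj_on_subset[OF inj_on_unit_exp assms(2)])
    moreover have "card {z. poly p z = 0} \<le> degree p"
      using p by (intro card_poly_roots_bound)
    ultimately show False using assms(3) by linarith
  qed
  moreover have "nat (n + int N) \<le> 2 * N" "int (nat (n + int N)) - int N = n" using n by auto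
  ultimately show ?thesis using coeff[of "nat (n + int N)"] by simp
qed

lemma trig_poly_has_deriv:
  "((\<lambda>x. \<Sum>n = - int N..int N. c n * unit_exp (of_int n * x)) has_vector_derivative
    (\<Sum>n = - int N..int N. (2 * of_real pi * \<i> * of_int n * c n) * unit_exp (of_int n * x))) (at x)"
proof -
  have "((\<lambda>x. unit_exp (of_int n * x)) has_vector_derivative
     (2 * of_real pi * \<i> * of_int n) * unit_exp (of_int n * x)) (at x)" for n
    unfolding unit_exp_def
    by (auto intro!: derivative_eq_intros has_vector_derivative_real_field simp: field_simps)
  then show ?thesis
    by (auto intro!: derivative_eq_intros sum.cong)
qed

lemma real_trig_poly_deriv:
  assumes f: "\<And>x. complex_of_real (f x) = (\<Sum>n = - int N..int N. c n * unit_exp (of_int n * x))"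
  shows "\<exists>f'. (\<forall>x. (f has_real_derivative f' x) (at x)) \<and>
    (\<forall>x. complex_of_real (f' x) =
       (\<Sum>n = - int N..int N. (2 * of_real pi * \<i> * of_int n * c n) * unit_exp (of_int n * x)))"
proof -
  define d where "d x = (\<Sum>n = - int N..int N. (2 * of_real pi * \<i> * of_int n * c n) * unit_exp (of_int n * x))" for x
  have "((\<lambda>x. complex_of_real (f x)) has_vector_derivative d x) (at x)" for x
    unfolding f d_def by (rule trig_poly_has_deriv)
  then have 1: "((\<lambda>x. Re (complex_of_real (f x))) has_vector_derivative Re (d x)) (at x)"
    and 2: "((\<lambda>x. Im (complex_of_real (f x))) has_vector_derivative Im (d x)) (at x)" for x
    by (rule bounded_linear.has_vector_derivative[OF bounded_linear_Re],
        rule bounded_linear.has_vector_derivative[OF bounded_linear_Im])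
  \<comment> \<open>The coefficients are not assumed conjugate-symmetric; the derivative is real
    because the vanishing imaginary part can be differentiated too.\<close>
  have "Im (d x) = 0" for x
    using 2[of x] by (simp add: has_real_derivative_iff_has_vector_derivative[symmetric])
       (metis DERIV_const DERIV_unique)
  moreover have "(f has_real_derivative Re (d x)) (at x)" for x
    using 1[of x] by (simp add: has_real_derivative_iff_has_vector_derivative[symmetric])
  ultimately show ?thesis
    by (intro exI[of _ "\<lambda>x. Re (d x)"]) (auto simp: d_def[symmetric] complex_eq_iff)
qed

section \<open>Interpolation of the exponential kernel\<close>

lemma cos_int_sum:
  fixes r :: int
  assumes "M > 0"
  shows "(\<Sum>n<M. cos (2 * pi * real n * of_int r / real M)) = (if int M dvd r then real M else 0)"
proof -
  define z where "z = cis (2 * pi * of_int r / real M)"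
  have zn: "z ^ n = cis (2 * pi * real n * of_int r / real M)" for n
    unfolding z_def Complex.DeMoivre by (rule arg_cong[of _ _ cis]) simp
  have zM: "z ^ M = 1" using assms cis_multiple_2pi[of "of_int r"] by (simp add: zn algebra_simps)
  have z1: "z = 1 \<longleftrightarrow> int M dvd r"
  proof
    assume "z = 1"
    then have "exp (\<i> * of_real (2 * pi * of_int r / real M)) = 1"
      by (simp add: z_def cis_conv_exp)
    then obtain m :: int where "2 * pi * of_int r / real M = of_int (2 * m) * pi"
      unfolding exp_eq_1 by auto
    then have "of_int r = real M * of_int m" using assms by (simp add: field_simps)
    then have "of_int r = (of_int (int M * m) :: real)" by simp
    then have "r = int M * m" by linarith
    then show "int M dvd r" by simp
  next
    assume "int M dvd r"
    then obtain m where "r = int M * m" by auto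
    then show "z = 1" using assms cis_multiple_2pi[of "of_int m"] by (simp add: z_def algebra_simps)
  qed
  have "(\<Sum>n<M. z ^ n) = (if int M dvd r then of_nat M else 0)"
  proof (cases "z = 1")
    case True
    then have "(\<Sum>n<M. z ^ n) = of_nat M" by simp
    with True z1 show ?thesis by simp
  next
    case False
    with z1 zM show ?thesis by (simp add: geometric_sum)
  qed
  then have "Re (\<Sum>n<M. z ^ n) = (if int M dvd r then real M else 0)" by simp
  then show ?thesis by (simp add: zn)
qed

definition dvd_weight :: "nat \<Rightarrow> int \<Rightarrow> real" where "dvd_weight M r = (if int M dvd r then real M else 0)"

lemma cos_int_sum1:
  "(\<Sum>n=1..N. cos (2 * pi * real n * of_int r / real (Suc N))) = dvd_weight (Suc N) r - 1"
proof -
  have "{..<Suc N} = insert 0 {1..N}" by auto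
  then show ?thesis using cos_int_sum[of "Suc N" r] by (simp add: dvd_weight_def)
qed

lemma sum_reflect:
  fixes f g :: "nat \<Rightarrow> real"
  assumes "\<And>n. n \<in> {1..N} \<Longrightarrow> f (Suc N - n) = g n"
  shows "sum f {1..N} = sum g {1..N}"
proof -
  have "sum g {1..N} = sum (\<lambda>n. f (Suc N - n)) {1..N}" using assms by simp
  also have "\<dots> = sum f {1..N}"
    by (rule sum.reindex_bij_witness[of _ "\<lambda>n. Suc N - n" "\<lambda>n. Suc N - n"]) auto
  finally show ?thesis by simp
qed

text \<open>At integer \<open>r\<close> the frequencies \<open>n\<close> and
  \<open>n - (N + 1)\<close> have the same value at \<open>r / (N + 1)\<close>; cosine is even and
  sine is odd.\<close>

lemma cos_sin_reflect:
  fixes r :: int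
  assumes "n \<in> {1..N}"
  shows "cos (2 * pi * real (Suc N - n) * of_int r / real (Suc N)) = cos (2 * pi * real n * of_int r / real (Suc N))"
    and "sin (2 * pi * real (Suc N - n) * of_int r / real (Suc N)) = - sin (2 * pi * real n * of_int r / real (Suc N))"
proof -
  have *: "2 * pi * real (Suc N - n) * of_int r / real (Suc N) =
     2 * pi * of_int r - 2 * pi * real n * of_int r / real (Suc N)"
    using assms by (simp add: of_nat_diff field_simps)
  show "cos (2 * pi * real (Suc N - n) * of_int r / real (Suc N)) = cos (2 * pi * real n * of_int r / real (Suc N))"
    and "sin (2 * pi * real (Suc N - n) * of_int r / real (Suc N)) = - sin (2 * pi * real n * of_int r / real (Suc N))"
    unfolding * by (simp_all add: cos_diff sin_diff)
qed

lemma sum_sin_zero: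
  fixes r :: int
  shows "(\<Sum>n=1..N. sin (2 * pi * real n * of_int r / real (Suc N))) = 0"
proof -
  have "(\<Sum>n=1..N. sin (2 * pi * real n * of_int r / real (Suc N))) =
      (\<Sum>n=1..N. - sin (2 * pi * real n * of_int r / real (Suc N)))"
    by (rule sum_reflect) (rule cos_sin_reflect)
  then show ?thesis by (simp add: sum_negf)
qed

text \<open>The weight is symmetric under \<open>n -> N + 1 - n\<close> while the sine is
  antisymmetric.\<close>

lemma sum_weight_sin_zero:
  fixes r :: int
  shows "(\<Sum>n=1..N. real n * (1 - real n / real (Suc N)) * sin (2 * pi * real n * of_int r / real (Suc N))) = 0"
proof -
  have "(\<Sum>n=1..N. real n * (1 - real n / real (Suc N)) * sin (2 * pi * real n * of_int r / real (Suc N))) =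
      (\<Sum>n=1..N. - (real n * (1 - real n / real (Suc N)) * sin (2 * pi * real n * of_int r / real (Suc N))))"
  proof (rule sum_reflect)
    fix n assume n: "n \<in> {1..N}"
    show "real (Suc N - n) * (1 - real (Suc N - n) / real (Suc N)) * sin (2 * pi * real (Suc N - n) * of_int r / real (Suc N)) =
     - (real n * (1 - real n / real (Suc N)) * sin (2 * pi * real n * of_int r / real (Suc N)))"
      unfolding cos_sin_reflect[OF n] using n by (simp add: of_nat_diff field_simps)
  qed
  then show ?thesis by (simp add: sum_negf)
qed

text \<open>Reflection turns the sum S into \<open>(N + 1) C - S\<close>, where C is the unweighted
  cosine sum; hence S is half of \<open>(N + 1) C\<close>.\<close>

lemma sum_n_cos:
  fixes r :: int
  shows "(\<Sum>n=1..N. real n * cos (2 * pi * real n * of_int r / real (Suc N))) =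
    real (Suc N) / 2 * (dvd_weight (Suc N) r - 1)"
proof -
  have "(\<Sum>n=1..N. real n * cos (2 * pi * real n * of_int r / real (Suc N))) =
      (\<Sum>n=1..N. real (Suc N) * cos (2 * pi * real n * of_int r / real (Suc N)) -
         real n * cos (2 * pi * real n * of_int r / real (Suc N)))"
  proof (rule sum_reflect)
    fix n assume n: "n \<in> {1..N}"
    show "real (Suc N - n) * cos (2 * pi * real (Suc N - n) * of_int r / real (Suc N)) =
        real (Suc N) * cos (2 * pi * real n * of_int r / real (Suc N)) -
         real n * cos (2 * pi * real n * of_int r / real (Suc N))"
      unfolding cos_sin_reflect[OF n] using n by (simp add: of_nat_diff field_simps)
  qed
  also have "\<dots> = real (Suc N) * (\<Sum>n=1..N. cos (2 * pi * real n * of_int r / real (Suc N))) - 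
    (\<Sum>n=1..N. real n * cos (2 * pi * real n * of_int r / real (Suc N)))"
    by (simp only: sum_subtractf sum_distrib_left)
  finally show ?thesis unfolding cos_int_sum1 by simp
qed

lemma sum_weight_cos:
  fixes r :: int
  shows "(\<Sum>n=1..N. (1 - real n / real (Suc N)) * cos (2 * pi * real n * of_int r / real (Suc N))) =
    (dvd_weight (Suc N) r - 1) / 2"
proof -
  have "(\<Sum>n=1..N. (1 - real n / real (Suc N)) * cos (2 * pi * real n * of_int r / real (Suc N))) =
     (\<Sum>n=1..N. cos (2 * pi * real n * of_int r / real (Suc N))) -
     (\<Sum>n=1..N. real n * cos (2 * pi * real n * of_int r / real (Suc N))) / real (Suc N)"
    by (simp only: sum_subtractf sum_divide_distrib left_diff_distrib mult_1_left times_divide_eq_left)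
  also have "\<dots> = dvd_weight (Suc N) r - 1 - (real (Suc N) / 2 * (dvd_weight (Suc N) r - 1)) / real (Suc N)"
    unfolding cos_int_sum1 sum_n_cos ..
  also have "\<dots> = (dvd_weight (Suc N) r - 1) / 2"
    by (simp del: of_nat_Suc add: field_simps)
  finally show ?thesis .
qed

text \<open>The Fourier transform, on the band \<bar>t\<bar> < 1, of the part of \<open>L\<close>
  with poles at \<open>k + 1/2\<close> and \<open>- (k + 1/2)\<close>. The triangle comes from the
  double poles. The sine comes from the simple poles; its \<bar>t\<bar> encodes a factor
  \<open>sgn t\<close>.\<close>

definition L_coef :: "real \<Rightarrow> real \<Rightarrow> nat \<Rightarrow> real" where
  "L_coef \<nu> t k = exp (- \<nu> * (real k + 1/2)) *
     ((1 - \<bar>t\<bar>) * (2 * cos (2 * pi * t * (real k + 1/2))) +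
      \<nu> / pi * sin (2 * pi * \<bar>t\<bar> * (real k + 1/2)))"

text \<open>The product formulas combine the half-integers \<open>k + 1/2\<close> and
  \<open>j + 1/2\<close> into the integer frequencies \<open>k + j + 1\<close> and
  \<open>k - j\<close>, which is what makes reflection available. The sine part of
  \<open>L_coef\<close> drops out, and the two terms \<open>- 1\<close> caused by the absent
  \<open>n = 0\<close> are compensated by \<open>L_coef \<nu> 0 k\<close>.\<close>

lemma L_coef_cos_sum:
  fixes N j k :: nat and \<nu> :: real
  defines "M \<equiv> Suc N" and "\<xi> \<equiv> (real j + 1/2) / real (Suc N)"
  shows "L_coef \<nu> 0 k + 2 * (\<Sum>n=1..N. L_coef \<nu> (real n / real M) k * cos (2 * pi * real n * \<xi>)) =
     exp (- \<nu> * (real k + 1/2)) * (dvd_weight M (int k + int j + 1) + dvd_weight M (int k - int j))"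
proof -
  define r1 r2 where "r1 = int k + int j + 1" and "r2 = int k - int j"
  define e where "e = exp (- \<nu> * (real k + 1/2))"
  let ?w = "\<lambda>n. 1 - real n / real M"
  let ?a = "\<lambda>n r. 2 * pi * real n * of_int r / real M"
  have M0: "real M > 0" by (simp add: M_def)
  have xi: "\<xi> = (real j + 1/2) / real M" by (simp add: \<xi>_def M_def)
  have "L_coef \<nu> (real n / real M) k * cos (2 * pi * real n * \<xi>) =
     e * (?w n * cos (?a n r1) + ?w n * cos (?a n r2) + \<nu> / (2 * pi) * (sin (?a n r1) + sin (?a n r2)))" for n
  proof -
    define x y where "x = 2 * pi * (real n / real M) * (real k + 1/2)" and "y = 2 * pi * real n * \<xi>"
    have a: "?a n r1 = x + y" "?a n r2 = x - y"
      unfolding x_def y_def r1_def r2_def xi using M0 by (simp_all add: field_simps)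
    have L: "L_coef \<nu> (real n / real M) k = e * ((1 - real n / real M) * (2 * cos x) + \<nu> / pi * sin x)"
      unfolding L_coef_def e_def x_def by simp
    show ?thesis unfolding a cos_add cos_diff sin_add sin_diff L y_def[symmetric]
      by (simp add: algebra_simps)
  qed
  then have "(\<Sum>n=1..N. L_coef \<nu> (real n / real M) k * cos (2 * pi * real n * \<xi>)) =
     e * ((\<Sum>n=1..N. ?w n * cos (?a n r1)) + (\<Sum>n=1..N. ?w n * cos (?a n r2))
       + \<nu> / (2 * pi) * ((\<Sum>n=1..N. sin (?a n r1)) + (\<Sum>n=1..N. sin (?a n r2))))"
    by (simp only: sum.distrib sum_distrib_left[symmetric])
  also have "\<dots> = e * ((dvd_weight M r1 - 1) / 2 + (dvd_weight M r2 - 1) / 2)"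
    unfolding M_def sum_weight_cos sum_sin_zero by simp
  finally show ?thesis
    by (simp add: L_coef_def e_def r1_def r2_def field_simps)
qed

text \<open>For the derivative the roles are exchanged: the triangle part cancels under reflection
  and the part carrying \<nu> survives. So the triangle fixes the values at the nodes and the sine
  part fixes the slopes.\<close>

lemma L_coef_sin_sum:
  fixes N j k :: nat and \<nu> :: real
  defines "M \<equiv> Suc N" and "\<xi> \<equiv> (real j + 1/2) / real (Suc N)"
  shows "2 * (\<Sum>n=1..N. L_coef \<nu> (real n / real M) k * (- (2 * pi * real n) * sin (2 * pi * real n * \<xi>))) =
     \<nu> * real M * exp (- \<nu> * (real k + 1/2)) * (dvd_weight M (int k + int j + 1) - dvd_weight M (int k - int j))"
proof -
  define r1 r2 where "r1 = int k + int j + 1" and "r2 = int k - int j"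
  define e where "e = exp (- \<nu> * (real k + 1/2))"
  let ?w = "\<lambda>n. real n * (1 - real n / real M)"
  let ?a = "\<lambda>n r. 2 * pi * real n * of_int r / real M"
  have M0: "real M > 0" by (simp add: M_def)
  have xi: "\<xi> = (real j + 1/2) / real M" by (simp add: \<xi>_def M_def)
  have "L_coef \<nu> (real n / real M) k * (- (2 * pi * real n) * sin (2 * pi * real n * \<xi>)) =
     e * (- 2 * pi * (?w n * sin (?a n r1)) + 2 * pi * (?w n * sin (?a n r2))
        + \<nu> * (real n * cos (?a n r1)) - \<nu> * (real n * cos (?a n r2)))" for n
  proof -
    define x y where "x = 2 * pi * (real n / real M) * (real k + 1/2)" and "y = 2 * pi * real n * \<xi>"
    have a: "?a n r1 = x + y" "?a n r2 = x - y"
      unfolding x_def y_def r1_def r2_def xi using M0 by (simp_all add: field_simps)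
    have L: "L_coef \<nu> (real n / real M) k = e * ((1 - real n / real M) * (2 * cos x) + \<nu> / pi * sin x)"
      unfolding L_coef_def e_def x_def by simp
    show ?thesis unfolding a cos_add cos_diff sin_add sin_diff L y_def[symmetric]
      by (simp add: algebra_simps)
  qed
  then have "(\<Sum>n=1..N. L_coef \<nu> (real n / real M) k * (- (2 * pi * real n) * sin (2 * pi * real n * \<xi>))) =
     e * (- 2 * pi * (\<Sum>n=1..N. ?w n * sin (?a n r1)) + 2 * pi * (\<Sum>n=1..N. ?w n * sin (?a n r2))
       + \<nu> * (\<Sum>n=1..N. real n * cos (?a n r1)) - \<nu> * (\<Sum>n=1..N. real n * cos (?a n r2)))"
    by (simp only: sum.distrib sum_subtractf sum_distrib_left[symmetric])
  also have "\<dots> = e * (\<nu> * (real M / 2 * (dvd_weight M r1 - 1)) - \<nu> * (real M / 2 * (dvd_weight M r2 - 1)))"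
    unfolding M_def sum_weight_sin_zero sum_n_cos by simp
  finally show ?thesis
    by (simp add: e_def r1_def r2_def field_simps)
qed

text \<open>The weight selects the residue class \<open>k = m * M + j\<close>, which leaves a
  geometric series in \<open>m\<close>. The sequence \<open>r\<close> is kept general because both
  \<open>k - j\<close> and \<open>k + j + 1\<close> will be inserted.\<close>

lemma exp_residue_sums:
  assumes "j < M" "\<nu> > 0" "\<And>k. int M dvd r k \<longleftrightarrow> k mod M = j"
  shows "(\<lambda>k. exp (- \<nu> * (real k + 1/2)) * dvd_weight M (r k)) sums
     (real M * exp (- \<nu> * (real j + 1/2)) / (1 - exp (- \<nu> * real M)))"
proof -
  have M: "M > 0" using assms(1) by auto
  let ?g = "\<lambda>m. m * M + j"
  have "(\<lambda>m. exp (- \<nu> * real M) ^ m) sums (1 / (1 - exp (- \<nu> * real M)))"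
    using M assms(2) by (intro geometric_sums) simp
  then have "(\<lambda>m. real M * exp (- \<nu> * (real j + 1/2)) * exp (- \<nu> * real M) ^ m) sums
      (real M * exp (- \<nu> * (real j + 1/2)) * (1 / (1 - exp (- \<nu> * real M))))"
    by (rule sums_mult)
  moreover have "real M * exp (- \<nu> * (real j + 1/2)) * exp (- \<nu> * real M) ^ m =
     exp (- \<nu> * (real (?g m) + 1/2)) * dvd_weight M (r (?g m))" for m
    using assms(1,3) by (simp add: dvd_weight_def algebra_simps flip: exp_of_nat_mult exp_add)
  ultimately have "(\<lambda>m. exp (- \<nu> * (real (?g m) + 1/2)) * dvd_weight M (r (?g m))) sums
      (real M * exp (- \<nu> * (real j + 1/2)) / (1 - exp (- \<nu> * real M)))" by simp
  moreover have "strict_mono ?g" using M by (simp add: strict_mono_def)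
  moreover have "exp (- \<nu> * (real n + 1/2)) * dvd_weight M (r n) = 0" if n: "n \<notin> range ?g" for n
  proof -
    have "n mod M \<noteq> j"
    proof
      assume "n mod M = j"
      then have "n = ?g (n div M)" using div_mult_mod_eq[of n M] by simp
      then have "n \<in> range ?g" by (rule range_eqI)
      with n show False by simp
    qed
    then show ?thesis by (simp add: dvd_weight_def assms(3))
  qed
  ultimately show ?thesis
    using sums_mono_reindex[of ?g "\<lambda>k. exp (- \<nu> * (real k + 1/2)) * dvd_weight M (r k)"] by blast
qed

definition L_series :: "real \<Rightarrow> real \<Rightarrow> real" where
  "L_series \<nu> t = (\<Sum>k. L_coef \<nu> t k)"

lemma summable_exp_half: "\<nu> > 0 \<Longrightarrow> summable (\<lambda>k. exp (- \<nu> * (real k + 1/2)))"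
proof -
  assume "\<nu> > 0"
  then have "summable (\<lambda>k. exp (- \<nu> / 2) * exp (- \<nu>) ^ k)"
    by (intro summable_mult summable_geometric) simp
  moreover have "exp (- \<nu> / 2) * exp (- \<nu>) ^ k = exp (- \<nu> * (real k + 1/2))" for k
    by (simp add: algebra_simps flip: exp_of_nat_mult exp_add)
  ultimately show ?thesis by (simp only:)
qed

lemma abs_L_coef_le:
  assumes "\<nu> > 0" "\<bar>t\<bar> \<le> 1"
  shows "\<bar>L_coef \<nu> t k\<bar> \<le> (2 + \<nu>) * exp (- \<nu> * (real k + 1/2))"
proof -
  let ?x = "2 * pi * t * (real k + 1/2)" and ?y = "2 * pi * \<bar>t\<bar> * (real k + 1/2)"
  have 1: "\<bar>(1 - \<bar>t\<bar>) * (2 * cos ?x)\<bar> \<le> 1 * (2 * 1)"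
    unfolding abs_mult using assms by (intro mult_mono) auto
  have "\<nu> / pi \<le> \<nu> / 1" using assms pi_gt3 by (intro divide_left_mono) auto
  then have 2: "\<bar>\<nu> / pi * sin ?y\<bar> \<le> \<nu> * 1"
    unfolding abs_mult using assms by (intro mult_mono) auto
  show ?thesis unfolding L_coef_def abs_mult
    using abs_triangle_ineq[of "(1 - \<bar>t\<bar>) * (2 * cos ?x)" "\<nu> / pi * sin ?y"] 1 2
    by (simp add: mult.commute)
qed

lemma L_coef_sums:
  assumes "\<nu> > 0" "\<bar>t\<bar> \<le> 1"
  shows "L_coef \<nu> t sums L_series \<nu> t"
proof -
  have "summable (\<lambda>k. (2 + \<nu>) * exp (- \<nu> * (real k + 1/2)))"
    by (rule summable_mult[OF summable_exp_half[OF assms(1)]])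
  then have "summable (L_coef \<nu> t)"
    by (rule summable_comparison_test') (use abs_L_coef_le[OF assms] in \<open>simp only: real_norm_def\<close>)
  then show ?thesis
    unfolding L_series_def by (rule summable_sums)
qed

text \<open>Up to the constant \<open>2 / l\<close>, this is the polynomial \<open>g_mu\<close> for
  a unit mass at \<open>l\<close>, with the frequencies \<open>n\<close> and \<open>- n\<close>
  merged by evenness. Without that constant the function to compare with is the plain periodized
  exponential, which satisfies \<open>K'' = l^2 K\<close>.\<close>

definition G_fun :: "nat \<Rightarrow> real \<Rightarrow> real \<Rightarrow> real" where
  "G_fun N l x = (L_series (l / real (Suc N)) 0 + 2 * (\<Sum>n=1..N.
     L_series (l / real (Suc N)) (real n / real (Suc N)) * cos (2 * pi * real n * x))) / real (Suc N)"

definition G_deriv :: "nat \<Rightarrow> real \<Rightarrow> real \<Rightarrow> real" where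
  "G_deriv N l x = 2 * (\<Sum>n=1..N. L_series (l / real (Suc N)) (real n / real (Suc N)) *
      (- (2 * pi * real n) * sin (2 * pi * real n * x))) / real (Suc N)"

definition G_deriv2 :: "nat \<Rightarrow> real \<Rightarrow> real \<Rightarrow> real" where
  "G_deriv2 N l x = 2 * (\<Sum>n=1..N. L_series (l / real (Suc N)) (real n / real (Suc N)) *
      (- (2 * pi * real n)\<^sup>2 * cos (2 * pi * real n * x))) / real (Suc N)"

lemma G_fun_deriv: "(G_fun N l has_real_derivative G_deriv N l x) (at x)"
proof -
  have "((\<lambda>x. a * cos (b * x)) has_real_derivative a * (- b * sin (b * x))) (at x)" for a b
    by (auto intro!: derivative_eq_intros)
  from DERIV_add[OF DERIV_const DERIV_cmult[OF DERIV_sum[OF this]], THEN DERIV_cdivide]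
  show ?thesis unfolding G_fun_def G_deriv_def by (simp only: add_0)
qed

lemma G_deriv_deriv: "(G_deriv N l has_real_derivative G_deriv2 N l x) (at x)"
proof -
  have "((\<lambda>x. a * (- b * sin (b * x))) has_real_derivative a * (- b\<^sup>2 * cos (b * x))) (at x)" for a b
    by (auto intro!: derivative_eq_intros simp: power2_eq_square)
  from DERIV_cmult[OF DERIV_sum[OF this], THEN DERIV_cdivide]
  show ?thesis unfolding G_deriv_def G_deriv2_def .
qed

text \<open>The periodized exponential in closed form on the unit interval. It is smooth on the
  whole line and not periodic; the periodized function itself has corners at the integers.\<close>

definition K_fun :: "real \<Rightarrow> real \<Rightarrow> real" where
  "K_fun l x = cosh (l * (x - 1/2)) / sinh (l / 2)"

definition K_deriv :: "real \<Rightarrow> real \<Rightarrow> real" where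
  "K_deriv l x = l * sinh (l * (x - 1/2)) / sinh (l / 2)"

lemma K_fun_deriv: "(K_fun l has_real_derivative K_deriv l x) (at x)"
proof -
  have "((\<lambda>x. cosh (l * (x - 1/2))) has_real_derivative l * sinh (l * (x - 1/2))) (at x)"
    by (auto intro!: derivative_eq_intros)
  then show ?thesis unfolding K_fun_def K_deriv_def by (rule DERIV_cdivide)
qed

lemma K_deriv_deriv: "(K_deriv l has_real_derivative l\<^sup>2 * K_fun l x) (at x)"
proof -
  have "((\<lambda>x. l * sinh (l * (x - 1/2))) has_real_derivative l\<^sup>2 * cosh (l * (x - 1/2))) (at x)"
    by (auto intro!: derivative_eq_intros simp: power2_eq_square)
  from DERIV_cdivide[OF this] show ?thesis unfolding K_fun_def K_deriv_def by (simp only: times_divide_eq_right)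
qed

lemma K_exp:
  assumes "l > 0"
  shows "K_fun l x = (exp (- l * x) + exp (- l * (1 - x))) / (1 - exp (- l))"
    and "K_deriv l x = l * (exp (- l * (1 - x)) - exp (- l * x)) / (1 - exp (- l))"
proof -
  have s: "sinh (l / 2) = exp (l / 2) * (1 - exp (- l)) / 2"
    by (simp add: sinh_field_def algebra_simps flip: exp_add)
  have c: "exp (l * (x - 1/2)) = exp (l / 2) * exp (- l * (1 - x))"
    "exp (- (l * (x - 1/2))) = exp (l / 2) * exp (- l * x)"
    by (simp_all add: algebra_simps flip: exp_add)
  have "1 - exp (- l) \<noteq> 0" using assms by simp
  then show "K_fun l x = (exp (- l * x) + exp (- l * (1 - x))) / (1 - exp (- l))"
    and "K_deriv l x = l * (exp (- l * (1 - x)) - exp (- l * x)) / (1 - exp (- l))"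
    unfolding K_fun_def K_deriv_def s cosh_field_def[of "l * (x - 1/2)"] sinh_field_def[of "l * (x - 1/2)"] c
    by (simp_all add: divide_simps) (simp_all add: algebra_simps)
qed

text \<open>The second series is the first one at the mirrored node \<open>1 - \<xi>\<close>, of
  index \<open>N - j\<close>, because \<open>- (j + 1)\<close> and \<open>N - j\<close> agree modulo
  \<open>N + 1\<close>. The two values are the two exponentials in \<open>K_exp\<close>, once added
  for the value and once subtracted for the slope.\<close>

lemma node_sums:
  fixes N j :: nat and l :: real
  assumes "l > 0" "j \<le> N"
  defines "M \<equiv> Suc N" and "\<xi> \<equiv> (real j + 1/2) / real (Suc N)" and "\<nu> \<equiv> l / real (Suc N)"
  shows "(\<lambda>k. exp (- \<nu> * (real k + 1/2)) * dvd_weight M (int k - int j)) sums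
          (real M * exp (- l * \<xi>) / (1 - exp (- l)))"
    and "(\<lambda>k. exp (- \<nu> * (real k + 1/2)) * dvd_weight M (int k + int j + 1)) sums
          (real M * exp (- l * (1 - \<xi>)) / (1 - exp (- l)))"
proof -
  have M: "M > 0" by (simp add: M_def)
  have \<nu>: "\<nu> > 0" using assms by simp
  have \<nu>M: "\<nu> * real M = l" by (simp add: \<nu>_def M_def)
  have "(\<lambda>k. exp (- \<nu> * (real k + 1/2)) * dvd_weight M (int k - int j)) sums
          (real M * exp (- \<nu> * (real j + 1/2)) / (1 - exp (- \<nu> * real M)))"
  proof (rule exp_residue_sums)
    show "j < M" "\<nu> > 0" using assms \<nu> by auto
    show "int M dvd int k - int j \<longleftrightarrow> k mod M = j" for k
      using \<open>j < M\<close> by (metis mod_eq_dvd_iff mod_less of_nat_eq_iff of_nat_mod)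
  qed
  moreover have "- \<nu> * (real j + 1/2) = - l * \<xi>"
    by (simp add: \<nu>_def \<xi>_def)
  ultimately show "(\<lambda>k. exp (- \<nu> * (real k + 1/2)) * dvd_weight M (int k - int j)) sums
          (real M * exp (- l * \<xi>) / (1 - exp (- l)))"
    using \<nu>M by simp
  have "(\<lambda>k. exp (- \<nu> * (real k + 1/2)) * dvd_weight M (int k + int j + 1)) sums
          (real M * exp (- \<nu> * (real (N - j) + 1/2)) / (1 - exp (- \<nu> * real M)))"
  proof (rule exp_residue_sums)
    show "N - j < M" "\<nu> > 0" using assms \<nu> by auto
    have "int k + int j + 1 = int k - int (N - j) + int M" for k using assms by (simp add: of_nat_diff)
    then have "int M dvd int k + int j + 1 \<longleftrightarrow> int M dvd int k - int (N - j)" for k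
      by (metis dvd_add_triv_right_iff)
    then show "int M dvd int k + int j + 1 \<longleftrightarrow> k mod M = N - j" for k
      using \<open>N - j < M\<close> by (metis mod_eq_dvd_iff mod_less of_nat_eq_iff of_nat_mod)
  qed
  moreover have "- \<nu> * (real (N - j) + 1/2) = - l * (1 - \<xi>)"
    using assms(2) by (simp add: \<nu>_def \<xi>_def of_nat_diff field_simps)
  ultimately show "(\<lambda>k. exp (- \<nu> * (real k + 1/2)) * dvd_weight M (int k + int j + 1)) sums
          (real M * exp (- l * (1 - \<xi>)) / (1 - exp (- l)))"
    using \<nu>M by simp
qed

lemma G_fun_node:
  assumes "l > 0" "j \<le> N" 
  shows "G_fun N l ((real j + 1/2) / real (Suc N)) = K_fun l ((real j + 1/2) / real (Suc N))"
proof -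
  define M \<xi> \<nu> where "M = Suc N" and "\<xi> = (real j + 1/2) / real (Suc N)" and "\<nu> = l / real (Suc N)"
  have \<nu>: "\<nu> > 0" using assms by (simp add: \<nu>_def)
  have L: "L_coef \<nu> (real n / real M) sums L_series \<nu> (real n / real M)" if "n \<le> N" for n
    by (rule L_coef_sums[OF \<nu>]) (use that in \<open>auto simp: M_def\<close>)
  have "(\<lambda>k. L_coef \<nu> 0 k + 2 * (\<Sum>n=1..N. L_coef \<nu> (real n / real M) k * cos (2 * pi * real n * \<xi>)))
      sums (L_series \<nu> 0 + 2 * (\<Sum>n=1..N. L_series \<nu> (real n / real M) * cos (2 * pi * real n * \<xi>)))"
    by (intro sums_add sums_mult sums_sum sums_mult2 L L_coef_sums[OF \<nu>]) auto
  moreover have "(\<lambda>k. L_coef \<nu> 0 k + 2 * (\<Sum>n=1..N. L_coef \<nu> (real n / real M) k * cos (2 * pi * real n * \<xi>)))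
      sums (real M * exp (- l * (1 - \<xi>)) / (1 - exp (- l)) + real M * exp (- l * \<xi>) / (1 - exp (- l)))"
    unfolding M_def \<xi>_def L_coef_cos_sum distrib_left[where a = "exp x" for x]
    using sums_add[OF node_sums(2)[OF assms] node_sums(1)[OF assms]] by (simp only: \<nu>_def)
  ultimately have "L_series \<nu> 0 + 2 * (\<Sum>n=1..N. L_series \<nu> (real n / real M) * cos (2 * pi * real n * \<xi>))
     = real M * exp (- l * (1 - \<xi>)) / (1 - exp (- l)) + real M * exp (- l * \<xi>) / (1 - exp (- l))"
    by (rule sums_unique2)
  also have "\<dots> = real M * K_fun l \<xi>"
    unfolding K_exp[OF assms(1)] by (simp add: add_divide_distrib distrib_left)
  finally show ?thesis
    by (simp add: G_fun_def M_def \<xi>_def \<nu>_def del: of_nat_Suc)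
qed

lemma G_deriv_node:
  assumes "l > 0" "j \<le> N" 
  shows "G_deriv N l ((real j + 1/2) / real (Suc N)) = K_deriv l ((real j + 1/2) / real (Suc N))"
proof -
  define M \<xi> \<nu> where "M = Suc N" and "\<xi> = (real j + 1/2) / real (Suc N)" and "\<nu> = l / real (Suc N)"
  have \<nu>: "\<nu> > 0" using assms by (simp add: \<nu>_def)
  have L: "L_coef \<nu> (real n / real M) sums L_series \<nu> (real n / real M)" if "n \<le> N" for n
    by (rule L_coef_sums[OF \<nu>]) (use that in \<open>auto simp: M_def\<close>)
  let ?S = "real M * exp (- l * (1 - \<xi>)) / (1 - exp (- l)) - real M * exp (- l * \<xi>) / (1 - exp (- l))"
  have "(\<lambda>k. 2 * (\<Sum>n=1..N. L_coef \<nu> (real n / real M) k * (- (2 * pi * real n) * sin (2 * pi * real n * \<xi>))))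
      sums (2 * (\<Sum>n=1..N. L_series \<nu> (real n / real M) * (- (2 * pi * real n) * sin (2 * pi * real n * \<xi>))))"
    by (intro sums_mult sums_sum sums_mult2 L) auto
  moreover have "(\<lambda>k. \<nu> * real M * (exp (- \<nu> * (real k + 1/2)) * dvd_weight M (int k + int j + 1) - 
       exp (- \<nu> * (real k + 1/2)) * dvd_weight M (int k - int j))) sums (\<nu> * real M * ?S)"
    unfolding M_def \<xi>_def \<nu>_def
    by (intro sums_mult sums_diff node_sums assms)
  then have "(\<lambda>k. 2 * (\<Sum>n=1..N. L_coef \<nu> (real n / real M) k * (- (2 * pi * real n) * sin (2 * pi * real n * \<xi>))))
      sums (\<nu> * real M * ?S)"
    unfolding M_def \<xi>_def L_coef_sin_sum by (simp only: right_diff_distrib mult.assoc)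
  ultimately have "2 * (\<Sum>n=1..N. L_series \<nu> (real n / real M) * (- (2 * pi * real n) * sin (2 * pi * real n * \<xi>)))
     = \<nu> * real M * ?S"
    by (rule sums_unique2)
  also have "\<dots> = real M * K_deriv l \<xi>"
    unfolding K_exp[OF assms(1)] by (simp add: diff_divide_distrib right_diff_distrib \<nu>_def M_def mult_ac del: of_nat_Suc)
  finally show ?thesis
    by (simp add: G_deriv_def M_def \<xi>_def \<nu>_def del: of_nat_Suc)
qed

section \<open>Trigonometric polynomials with explicit coefficients, and the quadrature rule\<close>

definition trig_coeffs :: "nat \<Rightarrow> (int \<Rightarrow> complex) \<Rightarrow> (real \<Rightarrow> real) \<Rightarrow> bool" where
  "trig_coeffs N c f \<longleftrightarrow>
     (\<forall>x. complex_of_real (f x) = (\<Sum>n = - int N..int N. c n * unit_exp (of_int n * x)))"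

lemma real_trig_poly_iff: "real_trig_poly N f \<longleftrightarrow> (\<exists>c. trig_coeffs N c f)"
  by (simp add: real_trig_poly_def trig_coeffs_def)

lemma trig_coeffs_deriv:
  assumes "trig_coeffs N c f" and der: "\<And>x. (f has_real_derivative f' x) (at x)"
  shows "trig_coeffs N (\<lambda>n. 2 * of_real pi * \<i> * of_int n * c n) f'"
proof -
  from real_trig_poly_deriv[where f = f and N = N and c = c] assms(1) obtain g where
    g: "\<And>x. (f has_real_derivative g x) (at x)"
    "\<And>x. complex_of_real (g x) =
       (\<Sum>n = - int N..int N. (2 * of_real pi * \<i> * of_int n * c n) * unit_exp (of_int n * x))"
    unfolding trig_coeffs_def by blast
  have "g = f'" using DERIV_unique[OF g(1) der] by blast
  with g(2) show ?thesis unfolding trig_coeffs_def by blast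
qed

lemma trig_coeffs_diff:
  "trig_coeffs N c f \<Longrightarrow> trig_coeffs N d g \<Longrightarrow> trig_coeffs N (\<lambda>n. c n - d n) (\<lambda>x. f x - g x)"
  unfolding trig_coeffs_def of_real_diff left_diff_distrib sum_subtractf by (simp only: simp_thms)

lemma trig_coeffs_cmult:
  "trig_coeffs N c f \<Longrightarrow> trig_coeffs N (\<lambda>n. of_real a * c n) (\<lambda>x. a * f x)"
  unfolding trig_coeffs_def of_real_mult mult.assoc sum_distrib_left[symmetric] by (simp only: simp_thms)

lemma trig_coeffs_zero:
  assumes "trig_coeffs N c f" "finite S" "S \<subseteq> {0<..<1}" "card S \<ge> 2 * N + 1"
    and "\<And>x. x \<in> S \<Longrightarrow> f x = 0" "\<bar>n\<bar> \<le> int N"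
  shows "c n = 0"
proof (rule trig_poly_coeffs_zero[OF assms(2-4) _ assms(6)])
  fix x assume "x \<in> S"
  then have "complex_of_real (f x) = 0" using assms(5) by simp
  then show "(\<Sum>n = - int N..int N. c n * unit_exp (of_int n * x)) = 0"
    using assms(1) unfolding trig_coeffs_def by metis
qed

lemma sum_cos_conv_unit_exp:
  "(\<Sum>n = - int N..int N. complex_of_real (a (nat \<bar>n\<bar>)) * unit_exp (of_int n * x)) =
     of_real (a 0 + 2 * (\<Sum>n=1..N. a n * cos (2 * pi * real n * x)))"
proof -
  have split: "{- int N..int N} = {0} \<union> ((\<lambda>n. int n) ` {1..N} \<union> (\<lambda>n. - int n) ` {1..N})"
  proof (intro equalityI subsetI)
    fix n assume n: "n \<in> {- int N..int N}"
    consider "n = 0" | "n > 0" | "n < 0" by linarith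
    then show "n \<in> {0} \<union> ((\<lambda>n. int n) ` {1..N} \<union> (\<lambda>n. - int n) ` {1..N})"
    proof cases
      case 2
      then have "n = int (nat n)" "nat n \<in> {1..N}" using n by auto
      then show ?thesis by blast
    next
      case 3
      then have "n = - int (nat (- n))" "nat (- n) \<in> {1..N}" using n by auto
      then show ?thesis by blast
    qed simp
  qed auto
  let ?f = "\<lambda>n. complex_of_real (a (nat \<bar>n\<bar>)) * unit_exp (of_int n * x)"
  have "sum ?f {- int N..int N} = sum ?f {0} + (sum ?f ((\<lambda>n. int n) ` {1..N}) + sum ?f ((\<lambda>n. - int n) ` {1..N}))"
    unfolding split by (subst sum.union_disjoint; (subst sum.union_disjoint)?) auto
  also have "sum ?f ((\<lambda>n. int n) ` {1..N}) = (\<Sum>n=1..N. of_real (a n) * unit_exp (of_nat n * x))"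
    by (subst sum.reindex) (auto simp: inj_on_def)
  also have "sum ?f ((\<lambda>n. - int n) ` {1..N}) = (\<Sum>n=1..N. of_real (a n) * unit_exp (- (of_nat n * x)))"
    by (subst sum.reindex) (auto simp: inj_on_def)
  also have "(\<Sum>n=1..N. of_real (a n) * unit_exp (of_nat n * x)) + (\<Sum>n=1..N. of_real (a n) * unit_exp (- (of_nat n * x)))
     = (\<Sum>n=1..N. of_real (2 * (a n * cos (2 * pi * real n * x))))"
    unfolding sum.distrib[symmetric]
    by (intro sum.cong) (auto simp: unit_exp_conv complex_eq_iff mult.assoc)
  finally show ?thesis by (simp add: sum_distrib_left)
qed

lemma trig_coeffs_G_fun:
  "trig_coeffs N (\<lambda>n. of_real (L_series (l / real (Suc N)) (real (nat \<bar>n\<bar>) / real (Suc N)) / real (Suc N))) (G_fun N l)"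
proof -
  let ?a = "\<lambda>n. L_series (l / real (Suc N)) (real n / real (Suc N)) / real (Suc N)"
  have "G_fun N l x = ?a 0 + 2 * (\<Sum>n=1..N. ?a n * cos (2 * pi * real n * x))" for x
    by (simp add: G_fun_def add_divide_distrib del: of_nat_Suc flip: sum_divide_distrib)
  then show ?thesis
    unfolding trig_coeffs_def using sum_cos_conv_unit_exp[where a = ?a and N = N] by simp
qed

definition nodes :: "nat \<Rightarrow> real set" where
  "nodes N = (\<lambda>j. (real j + 1/2) / real (Suc N)) ` {..N}"

lemma nodes: "finite (nodes N)" "card (nodes N) = Suc N" "nodes N \<subseteq> {0<..<1}" "nodes N \<noteq> {}"
proof -
  have "inj_on (\<lambda>j. (real j + 1/2) / real (Suc N)) {..N}"
    by (auto simp: inj_on_def simp del: of_nat_Suc)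
  then show "card (nodes N) = Suc N" by (simp add: nodes_def card_image)
  show "nodes N \<subseteq> {0<..<1}" by (auto simp: nodes_def field_simps)
qed (auto simp: nodes_def)

text \<open>For \<bar>n\<bar> \<le> N and nonzero \<open>n\<close>,
  \<open>unit_exp (n / (N + 1))\<close> is a root of unity of order dividing \<open>N + 1\<close>
  and different from 1, so its geometric sum vanishes. The half-step in the nodes only contributes a
  constant factor.\<close>

lemma trig_coeffs_sum_nodes:
  assumes "trig_coeffs N c f"
  shows "(\<Sum>x\<in>nodes N. f x) = real (Suc N) * Re (c 0)"
proof -
  let ?M = "Suc N"
  have inj: "inj_on (\<lambda>j. (real j + 1/2) / real ?M) {..N}"
    by (auto simp: inj_on_def simp del: of_nat_Suc)
  have S: "(\<Sum>x\<in>nodes N. unit_exp (of_int n * x)) = (if n = 0 then of_nat ?M else 0)"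
    if n: "\<bar>n\<bar> \<le> int N" for n
  proof (cases "n = 0")
    case True
    then show ?thesis by (simp add: nodes)
  next
    case False
    let ?z = "unit_exp (of_int n / real ?M)"
    have "(\<Sum>x\<in>nodes N. unit_exp (of_int n * x)) = (\<Sum>j<?M. unit_exp (of_int n * ((real j + 1/2) / real ?M)))"
      unfolding nodes_def using inj by (subst sum.reindex) (auto simp: lessThan_Suc_atMost)
    also have "\<dots> = (\<Sum>j<?M. unit_exp (of_int n / (2 * real ?M)) * ?z ^ j)"
      by (intro sum.cong) (simp_all add: unit_exp_of_nat_mult[symmetric] unit_exp_add[symmetric] add_divide_distrib algebra_simps del: of_nat_Suc)
    also have "\<dots> = unit_exp (of_int n / (2 * real ?M)) * (\<Sum>j<?M. ?z ^ j)"
      by (simp only: sum_distrib_left)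
    also have "(\<Sum>j<?M. ?z ^ j) = 0"
    proof -
      have "?z ^ ?M = unit_exp (of_int n)"
        by (subst unit_exp_of_nat_mult[symmetric]) (simp del: of_nat_Suc unit_exp_of_int)
      then have zM: "?z ^ ?M = 1" by simp
      have "?z \<noteq> 1"
      proof
        assume "?z = 1"
        then obtain m :: int where "2 * pi * (of_int n / real ?M) = of_int (2 * m) * pi"
          unfolding unit_exp_def exp_eq_1 by auto
        then have "2 * pi * d = 2 * pi * of_int m" if "d = of_int n / real ?M" for d
          using that by simp
        then have "of_int n / real ?M = of_int m" by (metis mult_left_cancel mult_eq_0_iff pi_neq_zero zero_neq_numeral)
        then have "of_int n = real ?M * of_int m" by (simp add: field_simps)
        then have "of_int n = (of_int (int ?M * m) :: real)" by simp
        then have "n = int ?M * m" by (simp only: of_int_eq_iff)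
        then have "\<bar>n\<bar> = int ?M * \<bar>m\<bar>" "m \<noteq> 0" using False by (auto simp: abs_mult)
        then have "\<bar>n\<bar> \<ge> int ?M * 1" by (metis mult_left_mono of_nat_0_le_iff zero_less_abs_iff int_one_le_iff_zero_less)
        with n show False by simp
      qed
      then show ?thesis using zM by (simp add: geometric_sum del: power_Suc sum.lessThan_Suc)
    qed
    finally show ?thesis using False by simp
  qed
  have "complex_of_real (\<Sum>x\<in>nodes N. f x) = (\<Sum>x\<in>nodes N. \<Sum>n = - int N..int N. c n * unit_exp (of_int n * x))"
    using assms by (simp add: trig_coeffs_def)
  also have "\<dots> = (\<Sum>n = - int N..int N. c n * (\<Sum>x\<in>nodes N. unit_exp (of_int n * x)))"
    by (subst sum.swap) (simp add: sum_distrib_left)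
  also have "\<dots> = (\<Sum>n = - int N..int N. if n = 0 then c n * of_nat ?M else 0)"
    by (intro sum.cong) (auto simp: S nodes(2))
  also have "\<dots> = c 0 * of_nat ?M" by simp
  finally have "Re (complex_of_real (\<Sum>x\<in>nodes N. f x)) = Re (c 0 * of_nat ?M)" by simp
  then show ?thesis by simp
qed

lemma trig_coeffs_LINT:
  assumes "trig_coeffs N c f"
  shows "set_integrable lborel {0..<1} f" "(LINT x:{0..<1}|lborel. f x) = Re (c 0)"
proof -
  have e: "has_bochner_integral lborel (\<lambda>x. indicator {0..<1} x *\<^sub>R unit_exp (of_int n * x)) (if n = 0 then 1 else 0)"
    for n :: int
  proof -
    have "has_bochner_integral lborel (\<lambda>x. indicator {0..1} x *\<^sub>R unit_exp (of_int n * x)) (if n = 0 then 1 else 0)"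
    proof (cases "n = 0")
      case True
      have "has_bochner_integral lborel (\<lambda>x. indicator {0..1::real} x *\<^sub>R (1::complex)) (of_real 1 - of_real 0)"
        by (rule has_bochner_integral_FTC_Icc) (auto intro!: derivative_eq_intros simp: has_vector_derivative_def scaleR_conv_of_real fun_eq_iff)
      then show ?thesis using True by simp
    next
      case False
      have "has_bochner_integral lborel (\<lambda>x. indicator {0..1} x *\<^sub>R unit_exp (of_int n * x))
         (unit_exp (of_int n * 1) / (2 * of_real pi * \<i> * of_int n) - unit_exp (of_int n * 0) / (2 * of_real pi * \<i> * of_int n))"
      proof (rule has_bochner_integral_FTC_Icc)
        have "((\<lambda>x. unit_exp (of_int n * x)) has_vector_derivative
           (2 * of_real pi * \<i> * of_int n) * unit_exp (of_int n * x)) (at x within {0..1})" for x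
          unfolding unit_exp_def
          by (auto intro!: derivative_eq_intros has_vector_derivative_real_field simp: field_simps)
        from has_vector_derivative_divide[OF this, of "2 * of_real pi * \<i> * of_int n"]
        show "((\<lambda>x. unit_exp (of_int n * x) / (2 * of_real pi * \<i> * of_int n)) has_vector_derivative
           unit_exp (of_int n * x)) (at x within {0..1})" for x
          using False by simp
        show "continuous_on {0..1} (\<lambda>x. unit_exp (of_int n * x))"
          unfolding unit_exp_def by (intro continuous_intros)
      qed simp
      then show ?thesis using False by simp
    qed
    moreover have "AE x in lborel. indicator {0..1::real} x *\<^sub>R unit_exp (of_int n * x) =
        indicator {0..<1} x *\<^sub>R unit_exp (of_int n * x)"
      using AE_lborel_singleton[of 1] by eventually_elim (auto simp: indicator_def)
    ultimately show ?thesis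
      by (subst has_bochner_integral_cong_AE[symmetric]) (auto simp: unit_exp_def)
  qed
  have "has_bochner_integral lborel (\<lambda>x. \<Sum>n = - int N..int N. c n * (indicator {0..<1} x *\<^sub>R unit_exp (of_int n * x)))
     (\<Sum>n = - int N..int N. c n * (if n = 0 then 1 else 0))"
    by (intro has_bochner_integral_sum has_bochner_integral_mult_right e)
  also have "(\<lambda>x. \<Sum>n = - int N..int N. c n * (indicator {0..<1} x *\<^sub>R unit_exp (of_int n * x))) =
     (\<lambda>x. of_real (indicator {0..<1} x *\<^sub>R f x))"
    using assms by (simp add: trig_coeffs_def fun_eq_iff scaleR_conv_of_real sum_distrib_left mult_ac)
  also have "(\<Sum>n = - int N..int N. c n * (if n = 0 then 1 else 0)) = c 0"
    by (simp add: if_distrib cong: if_cong)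
  finally have "has_bochner_integral lborel (\<lambda>x. complex_of_real (indicator {0..<1} x *\<^sub>R f x)) (c 0)" .
  from has_bochner_integral_bounded_linear[OF bounded_linear_Re this]
  have "has_bochner_integral lborel (\<lambda>x. indicator {0..<1} x *\<^sub>R f x) (Re (c 0))" by simp
  then show "set_integrable lborel {0..<1} f" "(LINT x:{0..<1}|lborel. f x) = Re (c 0)"
    unfolding set_integrable_def set_lebesgue_integral_def
    by (auto simp: has_bochner_integral_iff)
qed

section \<open>One-sided approximation\<close>

text \<open>With \<open>E = exp (- a + i b)\<close>, twice the sum of the odd powers of
  \<open>E\<close> is \<open>1 / sinh (a - i b)\<close>. The cosine terms of \<open>L_coef\<close>
  are the real part of this series and the sine terms its imaginary part.\<close>

lemma L_series_closed:
  assumes "\<nu> > 0" "\<bar>t\<bar> \<le> 1"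
  defines "a \<equiv> \<nu> / 2"
  shows "L_series \<nu> t = ((1 - \<bar>t\<bar>) * sinh a * cos (pi * t) + a / pi * cosh a * sin (pi * \<bar>t\<bar>)) /
     ((sinh a)\<^sup>2 + (sin (pi * t))\<^sup>2)"
proof -
  define b where "b = pi * \<bar>t\<bar>"
  define E where "E = of_real (exp (- a)) * cis b"
  define D where "D = (sinh a)\<^sup>2 + (sin b)\<^sup>2"
  have a: "a > 0" using assms by simp
  have nE: "norm E < 1" using a by (simp add: E_def norm_mult)
  have E0: "E \<noteq> 0" by (simp add: E_def)
  have D0: "D > 0" using a by (simp add: D_def add_pos_nonneg)
  \<comment> \<open>\<open>D\<close> is the squared modulus of \<open>sinh (a - i b)\<close>, which
    occurs below as half of \<open>inverse E - E\<close>.\<close>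
  have D': "(sinh a * cos b)\<^sup>2 + (cosh a * sin b)\<^sup>2 = D"
    using sin_cos_squared_add[of b] hyperbolic_pythagoras[of a] unfolding D_def power_mult_distrib by algebra
  have inverse_E: "inverse E = of_real (exp a) * cis (- b)"
    by (simp add: E_def exp_minus flip: cis_inverse)
  have "inverse E - E = 2 * Complex (sinh a * cos b) (- cosh a * sin b)"
    unfolding inverse_E by (simp add: E_def complex_eq_iff sinh_field_def cosh_field_def algebra_simps)
  moreover have "1 - E\<^sup>2 = E * (inverse E - E)"
    using E0 by (simp add: right_diff_distrib power2_eq_square)
  ultimately have "2 * E / (1 - E\<^sup>2) = 2 * E / (2 * E * Complex (sinh a * cos b) (- cosh a * sin b))"
    by (simp only: mult_ac)
  also have "\<dots> = inverse (Complex (sinh a * cos b) (- cosh a * sin b))"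
    using E0 by (simp only: nonzero_mult_divide_mult_cancel_left inverse_eq_divide mult_eq_0_iff zero_neq_numeral simp_thms)
       (metis E0 mult.right_neutral mult_eq_0_iff nonzero_mult_divide_mult_cancel_left zero_neq_numeral)
  also have "\<dots> = Complex (sinh a * cos b / D) (cosh a * sin b / D)"
    using D' by (auto simp: complex_eq_iff Re_divide Im_divide simp flip: D')
  finally have S: "2 * E / (1 - E\<^sup>2) = Complex (sinh a * cos b / D) (cosh a * sin b / D)" .
  have "(\<lambda>k. 2 * E * (E\<^sup>2) ^ k) sums (2 * E * (1 / (1 - E\<^sup>2)))"
    using nE by (intro sums_mult geometric_sums) (simp add: norm_power power_less_one_iff)
  moreover have "2 * E * (E\<^sup>2) ^ k = of_real (2 * exp (- \<nu> * (real k + 1/2))) * cis (2 * pi * \<bar>t\<bar> * (real k + 1/2))" for k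
  proof -
    have "E * (E\<^sup>2) ^ k = E ^ (2 * k + 1)" by (simp add: power_mult)
    also have "\<dots> = of_real (exp (- a) ^ (2 * k + 1)) * cis b ^ (2 * k + 1)"
      by (simp only: E_def power_mult_distrib of_real_power)
    also have "exp (- a) ^ (2 * k + 1) = exp (- \<nu> * (real k + 1/2))"
      unfolding exp_of_nat_mult[symmetric] by (rule arg_cong[of _ _ exp]) (simp add: a_def field_simps)
    also have "cis b ^ (2 * k + 1) = cis (2 * pi * \<bar>t\<bar> * (real k + 1/2))"
      unfolding Complex.DeMoivre by (rule arg_cong[of _ _ cis]) (simp add: b_def field_simps)
    finally show ?thesis by simp
  qed
  ultimately have sums: "(\<lambda>k. of_real (2 * exp (- \<nu> * (real k + 1/2))) * cis (2 * pi * \<bar>t\<bar> * (real k + 1/2))) sums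
      Complex (sinh a * cos b / D) (cosh a * sin b / D)"
    using S by simp
  have cb: "cos (2 * pi * t * c) = cos (2 * pi * \<bar>t\<bar> * c)" for c
    by (cases "t \<ge> 0") simp_all
  have "(\<lambda>k. (1 - \<bar>t\<bar>) * (2 * exp (- \<nu> * (real k + 1/2)) * cos (2 * pi * \<bar>t\<bar> * (real k + 1/2))) +
       \<nu> / (2 * pi) * (2 * exp (- \<nu> * (real k + 1/2)) * sin (2 * pi * \<bar>t\<bar> * (real k + 1/2)))) sums
      ((1 - \<bar>t\<bar>) * (sinh a * cos b / D) + \<nu> / (2 * pi) * (cosh a * sin b / D))"
    using sums_Re[OF sums] sums_Im[OF sums] by (intro sums_add sums_mult) simp_all
  also have "(\<lambda>k. (1 - \<bar>t\<bar>) * (2 * exp (- \<nu> * (real k + 1/2)) * cos (2 * pi * \<bar>t\<bar> * (real k + 1/2))) +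
       \<nu> / (2 * pi) * (2 * exp (- \<nu> * (real k + 1/2)) * sin (2 * pi * \<bar>t\<bar> * (real k + 1/2)))) = L_coef \<nu> t"
    unfolding L_coef_def fun_eq_iff cb by (simp add: distrib_left mult_ac)
  finally have "L_series \<nu> t = (1 - \<bar>t\<bar>) * (sinh a * cos b / D) + \<nu> / (2 * pi) * (cosh a * sin b / D)"
    by (rule sums_unique2[OF L_coef_sums[OF assms(1,2)]])
  moreover have "cos b = cos (pi * t)" "(sin b)\<^sup>2 = (sin (pi * t))\<^sup>2"
    unfolding b_def by (cases "t \<ge> 0"; simp)+
  ultimately show ?thesis using D0
    by (simp add: D_def a_def b_def add_divide_distrib)
qed

lemma L_series_0: "\<nu> > 0 \<Longrightarrow> L_series \<nu> 0 = 1 / sinh (\<nu> / 2)"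
  by (subst L_series_closed) (auto simp: power2_eq_square)

text \<open>This inequality decides the sign of \<open>K - G\<close>: it makes the mean of the
  interpolant smaller than the mean of the kernel.\<close>

lemma sinh_gt_self:
  fixes x :: real
  assumes "x > 0" shows "x < sinh x"
proof -
  have "(\<lambda>x. sinh x - x) 0 < (\<lambda>x. sinh x - x) x"
  proof (rule DERIV_pos_imp_increasing_open[OF assms])
    fix y :: real assume "0 < y"
    moreover have "((\<lambda>x. sinh x - x) has_real_derivative cosh y - 1) (at y)"
      by (auto intro!: derivative_eq_intros)
    moreover have "cosh y > 1" using cosh_real_strict_mono[of 0 y] \<open>0 < y\<close> by simp
    ultimately show "\<exists>d. ((\<lambda>x. sinh x - x) has_real_derivative d) (at y) \<and> d > 0"
      by (intro exI[of _ "cosh y - 1"]) auto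
  qed (auto intro!: continuous_intros)
  then show ?thesis by simp
qed

lemma taylor2:
  fixes f f' f'' :: "real \<Rightarrow> real"
  assumes "\<And>x. (f has_real_derivative f' x) (at x)" "\<And>x. (f' has_real_derivative f'' x) (at x)"
  shows "\<exists>t. \<bar>t - a\<bar> \<le> \<bar>x - a\<bar> \<and> f x = f a + f' a * (x - a) + f'' t / 2 * (x - a)\<^sup>2"
proof (cases "x = a")
  case False
  define d where "d = (\<lambda>m::nat. if m = 0 then f else if m = 1 then f' else f'')"
  have "\<forall>m t. m < 2 \<and> min x a \<le> t \<and> t \<le> max x a \<longrightarrow> (d m has_real_derivative d (Suc m) t) (at t)"
    using assms by (auto simp: d_def less_2_cases_iff)
  from Taylor[of 2 d f "min x a" "max x a" a x, OF _ _ this] False obtain t where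
    t: "if x < a then x < t \<and> t < a else a < t \<and> t < x"
      "f x = (\<Sum>m<2. d m a / fact m * (x - a) ^ m) + d 2 t / fact 2 * (x - a) ^ 2"
    by (auto simp: d_def)
  show ?thesis
    using t by (intro exI[of _ t]) (auto simp: d_def numeral_2_eq_2 split: if_splits)
qed (auto intro!: exI[of _ a])

section \<open>Sign of the interpolation error at a fixed parameter\<close>

context
  fixes N :: nat and l :: real
  assumes l: "l > 0"
begin

lemma K_fun_pos: "K_fun l x > 0"
  using l by (simp add: K_fun_def)

lemma interpolation_at_nodes:
  assumes "x \<in> nodes N"
  shows "G_fun N l x = K_fun l x" "G_deriv N l x = K_deriv l x"
  using assms G_fun_node[OF l] G_deriv_node[OF l] by (auto simp: nodes_def)

text \<open>On frequency \<open>n\<close> the operator multiplies by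
  \<open>l^2 + (2 pi n)^2\<close>, which never vanishes, so that many zeros would make
  \<open>G_fun\<close> vanish identically. At a node it equals the positive
  \<open>K_fun\<close>.\<close>

lemma ode_zeros_False:
  assumes "finite S" "S \<subseteq> {0<..<1}" "card S \<ge> 2 * N + 1"
    and zero: "\<And>x. x \<in> S \<Longrightarrow> l\<^sup>2 * G_fun N l x - G_deriv2 N l x = 0"
  shows False
proof -
  obtain c where c: "trig_coeffs N c (G_fun N l)" using trig_coeffs_G_fun by blast
  have "trig_coeffs N (\<lambda>n. of_real (l\<^sup>2) * c n - 2 * of_real pi * \<i> * of_int n * (2 * of_real pi * \<i> * of_int n * c n))
       (\<lambda>x. l\<^sup>2 * G_fun N l x - G_deriv2 N l x)"
    by (intro trig_coeffs_diff trig_coeffs_cmult c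
          trig_coeffs_deriv[OF trig_coeffs_deriv[OF c G_fun_deriv] G_deriv_deriv])
  from trig_coeffs_zero[OF this assms]
  have "of_real (l\<^sup>2) * c n - 2 * of_real pi * \<i> * of_int n * (2 * of_real pi * \<i> * of_int n * c n) = 0"
    if "\<bar>n\<bar> \<le> int N" for n using that by blast
  moreover have "of_real (l\<^sup>2) * c n - 2 * of_real pi * \<i> * of_int n * (2 * of_real pi * \<i> * of_int n * c n)
     = of_real (l\<^sup>2 + (2 * pi * of_int n)\<^sup>2) * c n" for n
    by (simp add: power2_eq_square algebra_simps)
  moreover have "l\<^sup>2 + (2 * pi * of_int n)\<^sup>2 \<noteq> 0" for n :: int
    using l by (simp add: sum_power2_eq_zero_iff)
  ultimately have "c n = 0" if "\<bar>n\<bar> \<le> int N" for n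
    using that by (metis mult_eq_0_iff of_real_eq_0_iff)
  then have "complex_of_real (G_fun N l x) = 0" for x
    using c unfolding trig_coeffs_def by (metis (no_types, lifting) abs_le_iff atLeastAtMost_iff minus_le_iff mult_zero_left sum.neutral)
  then have "G_fun N l x = 0" for x by simp
  moreover obtain x where "x \<in> nodes N" using nodes(4) by blast
  ultimately show False using interpolation_at_nodes(1)[of x] K_fun_pos[of x] by simp
qed

text \<open>Rolle is used along \<open>D^2 - l^2 = (D + l) (D - l)\<close>. The zeros in
  \<open>S\<close> yield \<open>card S - 1\<close> zeros of \<open>F' - l F\<close>, the nodes
  contribute \<open>N + 1\<close> more since the contact there is double, and the second use loses
  one. Disjointness from the nodes is recorded so that a node can be counted as an additional
  zero.\<close>

lemma ode_zeros:
  assumes "finite S" "S \<subseteq> {0<..<1}" "nodes N \<subseteq> S" "\<And>x. x \<in> S \<Longrightarrow> G_fun N l x = K_fun l x"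
  obtains R where "finite R" "R \<subseteq> {0<..<1}" "card R + 2 = card S + Suc N" "R \<inter> nodes N = {}"
    "\<And>x. x \<in> R \<Longrightarrow> l\<^sup>2 * G_fun N l x - G_deriv2 N l x = 0"
proof -
  define F F' F'' where "F = (\<lambda>x. K_fun l x - G_fun N l x)" and "F' = (\<lambda>x. K_deriv l x - G_deriv N l x)"
    and "F'' = (\<lambda>x. l\<^sup>2 * K_fun l x - G_deriv2 N l x)"
  have d: "(F has_real_derivative F' x) (at x)" "(F' has_real_derivative F'' x) (at x)" for x
    unfolding F_def F'_def F''_def
    by (rule DERIV_diff[OF K_fun_deriv G_fun_deriv], rule DERIV_diff[OF K_deriv_deriv G_deriv_deriv])
  have S0: "S \<noteq> {}" using nodes(4) assms(3) by blast
  from rolle_zeros[OF assms(1) S0 assms(2) d(1), of l] obtain R1 where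
    R1: "finite R1" "Suc (card R1) = card S" "R1 \<inter> S = {}" "R1 \<subseteq> {0<..<1}" "\<forall>x\<in>R1. F' x = l * F x"
    using assms(4) by (auto simp: F_def)
  have dH: "((\<lambda>x. F' x - l * F x) has_real_derivative (F'' x - l * F' x)) (at x)" for x
    using d[of x] by (auto intro!: derivative_eq_intros)
  have z: "F' x - l * F x = 0" if "x \<in> nodes N \<union> R1" for x
    using that R1(5) interpolation_at_nodes[of x] by (auto simp: F_def F'_def)
  have fin: "finite (nodes N \<union> R1)" "nodes N \<union> R1 \<noteq> {}" "nodes N \<union> R1 \<subseteq> {0<..<1}"
    using R1 nodes[of N] by auto
  from rolle_zeros[OF fin dH z, of "- l"] obtain R2 where
    R2: "finite R2" "Suc (card R2) = card (nodes N \<union> R1)" "R2 \<inter> (nodes N \<union> R1) = {}" "R2 \<subseteq> {0<..<1}"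
     "\<forall>x\<in>R2. F'' x - l * F' x = - l * (F' x - l * F x)"
    by auto
  have "nodes N \<inter> R1 = {}" using R1(3) assms(3) by auto
  then have "card (nodes N \<union> R1) = Suc N + card R1"
    using R1(1) nodes[of N] by (simp add: card_Un_disjoint)
  then show ?thesis
  proof (intro that[of R2])
    fix x assume "x \<in> R2"
    \<comment> \<open>The mixed terms cancel and leave \<open>F'' = l^2 F\<close>, from which
      \<open>K\<close> drops out.\<close>
    then have "F'' x - l * F' x = - l * (F' x - l * F x)" using R2(5) by blast
    then have "F'' x - l\<^sup>2 * F x = 0" by (simp add: algebra_simps power2_eq_square)
    then show "l\<^sup>2 * G_fun N l x - G_deriv2 N l x = 0" by (simp add: F_def F''_def algebra_simps)
  qed (use R1 R2 in auto)
qed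

text \<open>With one point besides the nodes, \<open>ode_zeros\<close> returns
  \<open>2 N + 1\<close> zeros, the forbidden number.\<close>

lemma interpolation_only_at_nodes:
  assumes "x \<in> {0<..<1}" "G_fun N l x = K_fun l x"
  shows "x \<in> nodes N"
proof (rule ccontr)
  assume x: "x \<notin> nodes N"
  then have S: "card (insert x (nodes N)) = N + 2" using nodes[of N] by simp
  obtain R where "finite R" "R \<subseteq> {0<..<1}" "card R + 2 = card (insert x (nodes N)) + Suc N"
    "\<And>x. x \<in> R \<Longrightarrow> l\<^sup>2 * G_fun N l x - G_deriv2 N l x = 0"
    by (rule ode_zeros[of "insert x (nodes N)"]) (use assms nodes[of N] interpolation_at_nodes in auto)
  with S show False by (intro ode_zeros_False[of R]) auto
qed

text \<open>Contact of third order would supply the missing zero: the nodes alone give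
  \<open>2 N\<close> zeros off the nodes, and \<open>x\<close> itself becomes one more because
  \<open>G_fun\<close> and \<open>K_fun\<close> agree there.\<close>

lemma second_order_at_nodes:
  assumes "x \<in> nodes N"
  shows "l\<^sup>2 * K_fun l x - G_deriv2 N l x \<noteq> 0"
proof
  assume 0: "l\<^sup>2 * K_fun l x - G_deriv2 N l x = 0"
  obtain R where R: "finite R" "R \<subseteq> {0<..<1}" "card R + 2 = card (nodes N) + Suc N" "R \<inter> nodes N = {}"
    "\<And>x. x \<in> R \<Longrightarrow> l\<^sup>2 * G_fun N l x - G_deriv2 N l x = 0"
    by (rule ode_zeros[of "nodes N"]) (use assms nodes[of N] interpolation_at_nodes in auto)
  have "x \<notin> R" using R(4) assms by auto
  then have "card (insert x R) = 2 * N + 1" using R nodes[of N] by simp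
  then show False
    using R nodes[of N] assms 0 interpolation_at_nodes[OF assms] by (intro ode_zeros_False[of "insert x R"]) auto
qed

text \<open>Off the nodes the difference is nonzero and continuity fixes its sign. At a node value
  and slope vanish, and the nonzero second derivative decides through the Taylor remainder.\<close>

lemma local_sign:
  assumes "x \<in> {0<..<1}"
  shows "\<exists>e>0. (\<forall>y. \<bar>y - x\<bar> < e \<longrightarrow> G_fun N l y \<le> K_fun l y) \<or> (\<forall>y. \<bar>y - x\<bar> < e \<longrightarrow> K_fun l y \<le> G_fun N l y)"
proof -
  define F F' F'' where "F = (\<lambda>x. K_fun l x - G_fun N l x)" and "F' = (\<lambda>x. K_deriv l x - G_deriv N l x)"
    and "F'' = (\<lambda>x. l\<^sup>2 * K_fun l x - G_deriv2 N l x)"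
  have d: "(F has_real_derivative F' x) (at x)" "(F' has_real_derivative F'' x) (at x)" for x
    unfolding F_def F'_def F''_def
    by (rule DERIV_diff[OF K_fun_deriv G_fun_deriv], rule DERIV_diff[OF K_deriv_deriv G_deriv_deriv])
  have sgn: "\<exists>e>0. (\<forall>y. \<bar>y - x\<bar> < e \<longrightarrow> f y > 0) \<or> (\<forall>y. \<bar>y - x\<bar> < e \<longrightarrow> f y < 0)"
    if "isCont f x" "f x \<noteq> 0" for f :: "real \<Rightarrow> real"
  proof -
    have f: "f \<midarrow>x\<rightarrow> f x" using that by (simp add: isCont_def)
    show ?thesis
    proof (cases "f x > 0")
      case True
      from LIM_fun_gt_zero[OF f True] show ?thesis
        using True by (metis abs_minus_commute eq_iff_diff_eq_0)
    next
      case False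
      with that have "f x < 0" by simp
      from LIM_fun_less_zero[OF f this] show ?thesis
        using \<open>f x < 0\<close> by (metis abs_minus_commute eq_iff_diff_eq_0)
    qed
  qed
  have "\<exists>e>0. (\<forall>y. \<bar>y - x\<bar> < e \<longrightarrow> F y \<ge> 0) \<or> (\<forall>y. \<bar>y - x\<bar> < e \<longrightarrow> F y \<le> 0)"
  proof (cases "x \<in> nodes N")
    case False
    then have "F x \<noteq> 0" using interpolation_only_at_nodes[OF assms] by (auto simp: F_def)
    with sgn[of F] DERIV_isCont[OF d(1)] show ?thesis by (meson less_imp_le)
  next
    case True
    have "isCont F'' x" unfolding F''_def G_deriv2_def K_fun_def
      using l by (intro continuous_intros) auto
    with sgn[of F''] second_order_at_nodes[OF True] obtain e where
      e: "e > 0" "(\<forall>y. \<bar>y - x\<bar> < e \<longrightarrow> F'' y > 0) \<or> (\<forall>y. \<bar>y - x\<bar> < e \<longrightarrow> F'' y < 0)"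
      by (auto simp: F''_def)
    have "\<exists>t. \<bar>t - x\<bar> \<le> \<bar>y - x\<bar> \<and> F y = F'' t / 2 * (y - x)\<^sup>2" for y
      using taylor2[OF d, of x y] interpolation_at_nodes[OF True] by (simp add: F_def F'_def)
    then have "(\<forall>y. \<bar>y - x\<bar> < e \<longrightarrow> F y \<ge> 0) \<or> (\<forall>y. \<bar>y - x\<bar> < e \<longrightarrow> F y \<le> 0)"
      using e(2) 
      by (smt (verit) divide_nonneg_nonneg divide_nonpos_nonneg mult_nonneg_nonneg mult_nonpos_nonneg zero_le_power2)
    with e(1) show ?thesis by blast
  qed
  then show ?thesis by (simp add: F_def)
qed

lemma LINT_K_fun:
  "set_integrable lborel {0..<1} (K_fun l)" "(LINT x:{0..<1}|lborel. K_fun l x) = 2 / l"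
proof -
  let ?P = "\<lambda>x. sinh (l * (x - 1/2)) / (l * sinh (l / 2))"
  have "has_bochner_integral lborel (\<lambda>x. indicator {0..1} x *\<^sub>R K_fun l x) (?P 1 - ?P 0)"
  proof (rule has_bochner_integral_FTC_Icc)
    show "continuous_on {0..1} (K_fun l)"
      using K_fun_deriv by (intro continuous_at_imp_continuous_on) (blast intro: DERIV_isCont)
    have "((\<lambda>x. sinh (l * (x - 1/2))) has_real_derivative l * cosh (l * (x - 1/2))) (at x)" for x
      by (auto intro!: derivative_eq_intros)
    from DERIV_cdivide[OF this, of "l * sinh (l / 2)"]
    have "(?P has_real_derivative K_fun l x) (at x)" for x using l by (simp add: K_fun_def)
    then show "(?P has_vector_derivative K_fun l x) (at x within {0..1})" for x
      by (simp add: has_real_derivative_iff_has_vector_derivative has_vector_derivative_at_within)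
  qed simp
  also have "?P 1 - ?P 0 = 2 / l" using l by (simp add: field_simps)
  finally have "has_bochner_integral lborel (\<lambda>x. indicator {0..1} x *\<^sub>R K_fun l x) (2 / l)" .
  moreover have "AE x in lborel. indicator {0..1::real} x *\<^sub>R K_fun l x = indicator {0..<1} x *\<^sub>R K_fun l x"
    using AE_lborel_singleton[of 1] by eventually_elim (auto simp: indicator_def)
  ultimately have "has_bochner_integral lborel (\<lambda>x. indicator {0..<1} x *\<^sub>R K_fun l x) (2 / l)"
    by (subst has_bochner_integral_cong_AE[symmetric]) (auto simp: K_fun_def cosh_field_def)
  then show "set_integrable lborel {0..<1} (K_fun l)" "(LINT x:{0..<1}|lborel. K_fun l x) = 2 / l"
    unfolding set_integrable_def set_lebesgue_integral_def
    by (auto simp: has_bochner_integral_iff)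
qed

text \<open>The mean of \<open>K_fun\<close> is \<open>2 / l\<close>. That of \<open>G_fun\<close>
  is \<open>1 / ((N + 1) sinh (l / (2 (N + 1))))\<close>, which is strictly smaller because
  \<open>sinh x > x\<close>.\<close>

lemma not_K_le_G: "\<not> (\<forall>x\<in>{0<..<1}. K_fun l x \<le> G_fun N l x)"
proof
  assume le: "\<forall>x\<in>{0<..<1}. K_fun l x \<le> G_fun N l x"
  \<comment> \<open>The means are taken over an interval containing 0, where the inequality is
    recovered by a limit from the right.\<close>
  have le0: "K_fun l x \<le> G_fun N l x" if "x \<in> {0..<1}" for x
  proof (cases "x = 0")
    case True
    have "((\<lambda>x. K_fun l x) \<longlongrightarrow> K_fun l 0) (at_right 0)" "((\<lambda>x. G_fun N l x) \<longlongrightarrow> G_fun N l 0) (at_right 0)"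
      using DERIV_isCont[OF K_fun_deriv] DERIV_isCont[OF G_fun_deriv]
      by (auto simp: continuous_at intro: tendsto_mono[OF at_le])
    moreover have "\<forall>\<^sub>F x in at_right 0. K_fun l x \<le> G_fun N l x"
      using le eventually_at_right_less[of 0] eventually_at_right_real[of 0 1]
      by (auto elim: eventually_mono)
    ultimately have "K_fun l 0 \<le> G_fun N l 0" by (intro tendsto_le[of "at_right 0"]) auto
    then show ?thesis using True by simp
  qed (use that le in auto)
  have G: "set_integrable lborel {0..<1} (G_fun N l)"
    "(LINT x:{0..<1}|lborel. G_fun N l x) = L_series (l / real (Suc N)) 0 / real (Suc N)"
    using trig_coeffs_LINT[OF trig_coeffs_G_fun[of N l]] by (simp_all del: of_nat_Suc)
  have "2 / l \<le> L_series (l / real (Suc N)) 0 / real (Suc N)"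
    unfolding LINT_K_fun(2)[symmetric] G(2)[symmetric]
    by (intro set_integral_mono LINT_K_fun G le0)
  also have "\<dots> = 1 / (real (Suc N) * sinh (l / (2 * real (Suc N))))"
    using l by (subst L_series_0) (simp_all del: of_nat_Suc add: mult_ac)
  also have "\<dots> < 1 / (real (Suc N) * (l / (2 * real (Suc N))))"
    using l by (intro divide_strict_left_mono mult_strict_left_mono sinh_gt_self mult_pos_pos) auto
  also have "\<dots> = 2 / l" by (simp del: of_nat_Suc)
  finally show False by simp
qed

text \<open>\<open>P x\<close> states that the error is nonnegative near \<open>x\<close>. It is
  locally constant: nonnegative near one point and nonpositive near a neighbouring one would make
  the error vanish on an interval, against the finiteness of the nodes. Connectedness then gives one
  sign throughout, and the mean rules out the wrong one.\<close>

lemma G_le_K_open: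
  assumes "x \<in> {0<..<1}"
  shows "G_fun N l x \<le> K_fun l x"
proof -
  define P where "P x \<longleftrightarrow> (\<exists>e>0. \<forall>y. \<bar>y - x\<bar> < e \<longrightarrow> G_fun N l y \<le> K_fun l y)" for x
  have loc: "eventually (\<lambda>b. P a = P b) (at a within {0<..<1})" if a: "a \<in> {0<..<1}" for a
  proof (cases "P a")
    case True
    then obtain e where e: "e > 0" "\<forall>y. \<bar>y - a\<bar> < e \<longrightarrow> G_fun N l y \<le> K_fun l y" by (auto simp: P_def)
    have "P b" if "\<bar>b - a\<bar> < e / 2" for b
      unfolding P_def
    proof (intro exI[of _ "e / 2"] conjI allI impI)
      fix y assume "\<bar>y - b\<bar> < e / 2"
      with that have "\<bar>y - a\<bar> < e" by linarith
      with e(2) show "G_fun N l y \<le> K_fun l y" by blast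
    qed (use e in simp)
    then show ?thesis using True e(1) unfolding eventually_at dist_real_def
      by (intro exI[of _ "e / 2"]) auto
  next
    case False
    with local_sign[OF a] obtain e where e: "e > 0" "\<forall>y. \<bar>y - a\<bar> < e \<longrightarrow> K_fun l y \<le> G_fun N l y"
      by (auto simp: P_def)
    have "\<not> P b" if b: "\<bar>b - a\<bar> < e" "b \<in> {0<..<1}" for b
    proof
      assume "P b"
      then obtain d where d: "d > 0" "\<forall>y. \<bar>y - b\<bar> < d \<longrightarrow> G_fun N l y \<le> K_fun l y" by (auto simp: P_def)
      \<comment> \<open>Chosen so that the interval to the right of \<open>b\<close> lies in both
        neighbourhoods and to the left of 1, where every zero of the error is a node.\<close>
      define r where "r = min (min d (e - \<bar>b - a\<bar>)) (1 - b)"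
      have r: "r > 0" using d(1) b by (auto simp: r_def)
      have "{b<..<b + r} \<subseteq> nodes N"
      proof
        fix y assume y: "y \<in> {b<..<b + r}"
        then have "\<bar>y - b\<bar> < d" "\<bar>y - a\<bar> < e" "y \<in> {0<..<1}" using b by (auto simp: r_def)
        with d e have "G_fun N l y = K_fun l y" by (auto intro: antisym)
        with \<open>y \<in> {0<..<1}\<close> show "y \<in> nodes N" by (rule interpolation_only_at_nodes)
      qed
      moreover have "infinite {b<..<b + r}" using r by simp
      ultimately show False using nodes(1) finite_subset by blast
    qed
    then show ?thesis using False e(1) unfolding eventually_at dist_real_def
      by (intro exI[of _ e]) auto
  qed
  have const: "P a = P b" if "a \<in> {0<..<1}" "b \<in> {0<..<1}" for a b
    by (rule connected_local_const[of "{0<..<1::real}" a b P]) (use that loc in auto)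
  have "P x"
  proof (rule ccontr)
    assume "\<not> P x"
    then have nP: "\<not> P y" if "y \<in> {0<..<1}" for y using const[OF assms that] by simp
    have "K_fun l y \<le> G_fun N l y" if y: "y \<in> {0<..<1}" for y
      using local_sign[OF y] nP[OF y] unfolding P_def by (metis abs_zero cancel_comm_monoid_add_class.diff_cancel)
    then show False using not_K_le_G by blast
  qed
  then show ?thesis unfolding P_def by (metis abs_zero cancel_comm_monoid_add_class.diff_cancel)
qed

text \<open>The endpoint 0 is included for the comparison with \<open>q_mu\<close> at the
  integers.\<close>

lemma G_le_K:
  assumes "x \<in> {0..1}"
  shows "G_fun N l x \<le> K_fun l x"
proof -
  have "continuous_on (closure {0<..<1}) (\<lambda>x. K_fun l x - G_fun N l x)"
    using K_fun_deriv G_fun_deriv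
    by (intro continuous_on_diff continuous_at_imp_continuous_on) (blast intro: DERIV_isCont)+
  then have "0 \<le> K_fun l x - G_fun N l x"
    by (rule continuous_ge_on_closure) (use assms G_le_K_open in auto)
  then show ?thesis by simp
qed

end

section \<open>Fourier inversion\<close>

lemma unit_exp_measurable [measurable]: "unit_exp \<in> borel_measurable borel"
  unfolding unit_exp_def by measurable

lemma continuous_on_unit_exp [continuous_intros]:
  "continuous_on A f \<Longrightarrow> continuous_on A (\<lambda>x. unit_exp (f x))"
  unfolding unit_exp_def by (intro continuous_intros)

lemma std_normal_density_eq: "std_normal_density x = exp (- x\<^sup>2 / 2) / sqrt (2 * pi)"
  unfolding normal_density_def by simp

lemma integrable_gauss:
  assumes "\<epsilon> > 0" shows "integrable lborel (\<lambda>x::real. exp (- (\<epsilon> * x)\<^sup>2 / 2))"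
proof -
  have "integrable lborel (\<lambda>x. sqrt (2 * pi) * std_normal_density (0 + \<epsilon> * x))"
    using assms by (intro integrable_mult_right lborel_integrable_real_affine integrable_normal_density) auto
  then show ?thesis by (simp add: std_normal_density_eq)
qed

lemma gauss_fourier:
  assumes "\<epsilon> > 0"
  shows "(LINT x|lborel. unit_exp (s * x) * of_real (exp (- (\<epsilon> * x)\<^sup>2 / 2))) =
    of_real (2 * pi / \<epsilon> * std_normal_density (2 * pi * s / \<epsilon>))"
proof -
  define t where "t = 2 * pi * s / \<epsilon>"
  have "of_real (exp (- t\<^sup>2 / 2)) = (LINT x|lborel. std_normal_density x *\<^sub>R iexp (t * x))"
    using char_std_normal_distribution unfolding char_def fun_eq_iff
    by (subst (asm) integral_density) (auto simp: normal_density_nonneg)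
  also have "\<dots> = \<epsilon> *\<^sub>R (LINT x|lborel. std_normal_density (0 + \<epsilon> * x) *\<^sub>R iexp (t * (0 + \<epsilon> * x)))"
    using assms by (subst lborel_integral_real_affine[where c = \<epsilon> and t = 0]) auto
  also have "(LINT x|lborel. std_normal_density (0 + \<epsilon> * x) *\<^sub>R iexp (t * (0 + \<epsilon> * x))) =
     (LINT x|lborel. of_real (1 / sqrt (2 * pi)) * (unit_exp (s * x) * of_real (exp (- (\<epsilon> * x)\<^sup>2 / 2))))"
    using assms by (intro Bochner_Integration.integral_cong)
      (auto simp: std_normal_density_eq scaleR_conv_of_real unit_exp_def t_def mult_ac)
  also have "\<dots> = of_real (1 / sqrt (2 * pi)) * (LINT x|lborel. unit_exp (s * x) * of_real (exp (- (\<epsilon> * x)\<^sup>2 / 2)))"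
    by (rule integral_mult_right_zero)
  finally have *: "of_real (exp (- t\<^sup>2 / 2)) = of_real (\<epsilon> / sqrt (2 * pi)) * (LINT x|lborel. unit_exp (s * x) * of_real (exp (- (\<epsilon> * x)\<^sup>2 / 2)))"
    by (simp add: scaleR_conv_of_real)
  have "2 * pi / \<epsilon> * std_normal_density t = exp (- t\<^sup>2 / 2) * (sqrt (2 * pi) / \<epsilon>)"
  proof -
    define r where "r = sqrt (2 * pi)"
    have r: "2 * pi = r * r" "r \<noteq> 0" by (simp_all add: r_def)
    show ?thesis unfolding std_normal_density_eq r_def[symmetric] unfolding r(1) using r(2) by simp
  qed
  then have "of_real (2 * pi / \<epsilon> * std_normal_density t) = of_real (exp (- t\<^sup>2 / 2)) * (of_real (sqrt (2 * pi) / \<epsilon>) :: complex)"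
    unfolding of_real_mult[symmetric] by (rule arg_cong)
  also have "\<dots> = (LINT x|lborel. unit_exp (s * x) * of_real (exp (- (\<epsilon> * x)\<^sup>2 / 2)))"
    unfolding * using assms by (simp add: field_simps)
  finally show ?thesis by (simp only: t_def)
qed

text \<open>The Gaussian factor makes the double integral absolutely convergent, so Fubini applies.
  What remains is a normal average of \<Phi> around \<open>t\<close> at scale
  \<open>\<epsilon> / (2 pi)\<close>.\<close>

lemma gauss_summation:
  fixes \<Phi> :: "real \<Rightarrow> complex"
  assumes \<Phi>: "integrable lborel \<Phi>" and "\<epsilon> > 0"
  shows "(LINT x|lborel. (LINT u|lborel. \<Phi> u * unit_exp (u * x)) * unit_exp (- t * x) * of_real (exp (- (\<epsilon> * x)\<^sup>2 / 2))) =
     (LINT v|lborel. \<Phi> (t + \<epsilon> / (2 * pi) * v) * of_real (std_normal_density v))"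
proof -
  have [measurable]: "\<Phi> \<in> borel_measurable borel" using \<Phi> by simp
  define w where "w = (\<lambda>x::real. exp (- (\<epsilon> * x)\<^sup>2 / 2))"
  have w[measurable]: "w \<in> borel_measurable borel" "integrable lborel w" "\<And>x. w x > 0"
    unfolding w_def using integrable_gauss[OF assms(2)] by auto
  define f where "f = (\<lambda>x u. \<Phi> u * unit_exp ((u - t) * x) * of_real (w x))"
  have [measurable]: "case_prod f \<in> borel_measurable (lborel \<Otimes>\<^sub>M lborel)"
    unfolding f_def by measurable
  have "integrable (lborel \<Otimes>\<^sub>M lborel) (case_prod f)"
  proof (rule lborel_pair.Fubini_integrable)
    have "(\<lambda>x. LINT y|lborel. norm (case_prod f (x, y))) = (\<lambda>x. (LINT y|lborel. norm (\<Phi> y)) * w x)"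
      using w(3) by (simp add: f_def norm_mult abs_of_pos)
    then show "integrable lborel (\<lambda>x. LINT y|lborel. norm (case_prod f (x, y)))"
      using w by simp
    have "integrable lborel (\<lambda>y. f x y)" for x
      by (rule Bochner_Integration.integrable_bound[OF integrable_mult_right[OF integrable_norm[OF \<Phi>]], of _ "w x"])
         (auto simp: f_def norm_mult mult_ac)
    then show "AE x in lborel. integrable lborel (\<lambda>y. case_prod f (x, y))" by simp
  qed simp
  note swap = lborel_pair.Fubini_integral[OF this]
  have "(LINT x|lborel. (LINT u|lborel. \<Phi> u * unit_exp (u * x)) * unit_exp (- t * x) * of_real (w x)) =
     (LINT x|lborel. LINT u|lborel. f x u)"
  proof -
    have "unit_exp ((u - t) * x) = unit_exp (u * x) * unit_exp (- t * x)" for u x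
      by (simp add: algebra_simps flip: unit_exp_add)
    then show ?thesis
      unfolding f_def by (simp only: integral_mult_left_zero mult.assoc[symmetric])
  qed
  also have "\<dots> = (LINT u|lborel. LINT x|lborel. f x u)"
    using swap by simp
  also have "\<dots> = (LINT u|lborel. \<Phi> u * of_real (2 * pi / \<epsilon> * std_normal_density (2 * pi * (u - t) / \<epsilon>)))"
    unfolding f_def w_def mult.assoc integral_mult_right_zero gauss_fourier[OF assms(2)] by simp
  also have "\<dots> = \<bar>\<epsilon> / (2 * pi)\<bar> *\<^sub>R (LINT v|lborel. \<Phi> (t + \<epsilon> / (2 * pi) * v) *
      of_real (2 * pi / \<epsilon> * std_normal_density (2 * pi * ((t + \<epsilon> / (2 * pi) * v) - t) / \<epsilon>)))"
    using assms(2) by (subst lborel_integral_real_affine[where c = "\<epsilon> / (2 * pi)" and t = t]) auto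
  also have "\<dots> = (LINT v|lborel. \<bar>\<epsilon> / (2 * pi)\<bar> *\<^sub>R (\<Phi> (t + \<epsilon> / (2 * pi) * v) *
      of_real (2 * pi / \<epsilon> * std_normal_density (2 * pi * ((t + \<epsilon> / (2 * pi) * v) - t) / \<epsilon>))))"
    by simp
  also have "\<dots> = (LINT v|lborel. \<Phi> (t + \<epsilon> / (2 * pi) * v) * of_real (std_normal_density v))"
    using assms(2) by (intro Bochner_Integration.integral_cong) (auto simp: scaleR_conv_of_real field_simps)
  finally show ?thesis unfolding w_def .
qed

text \<open>Both sides of \<open>gauss_summation\<close> converge as \<epsilon> tends to 0, by
  dominated convergence. Continuity is required only at \<open>t\<close>, and the transform only
  almost everywhere; this suits a density cut off to [-1, 1] whose transform is computed outside two
  exceptional points.\<close>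

lemma fourier_inversion:
  fixes \<Phi> \<phi> :: "real \<Rightarrow> complex"
  assumes \<Phi>: "integrable lborel \<Phi>" and bound: "\<And>u. norm (\<Phi> u) \<le> B" and cont: "isCont \<Phi> t"
    and \<phi>: "integrable lborel \<phi>" and eq: "AE x in lborel. (LINT u|lborel. \<Phi> u * unit_exp (u * x)) = \<phi> x"
  shows "(LINT x|lborel. \<phi> x * unit_exp (- t * x)) = \<Phi> t"
proof -
  have [measurable]: "\<Phi> \<in> borel_measurable borel" "\<phi> \<in> borel_measurable borel" using \<Phi> \<phi> by simp_all
  define \<epsilon> where "\<epsilon> n = inverse (real (Suc n))" for n
  have \<epsilon>: "\<epsilon> n > 0" for n by (simp add: \<epsilon>_def)
  have \<epsilon>0: "\<epsilon> \<longlonglongrightarrow> 0" unfolding \<epsilon>_def by (rule LIMSEQ_inverse_real_of_nat)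
  define a where "a n = (LINT x|lborel. \<phi> x * unit_exp (- t * x) * of_real (exp (- (\<epsilon> n * x)\<^sup>2 / 2)))" for n
  have a_eq: "a n = (LINT v|lborel. \<Phi> (t + \<epsilon> n / (2 * pi) * v) * of_real (std_normal_density v))" for n
  proof -
    have "a n = (LINT x|lborel. (LINT u|lborel. \<Phi> u * unit_exp (u * x)) * unit_exp (- t * x) * of_real (exp (- (\<epsilon> n * x)\<^sup>2 / 2)))"
      unfolding a_def by (rule integral_cong_AE) (use eq in auto)
    with gauss_summation[OF \<Phi> \<epsilon>] show ?thesis by simp
  qed
  have "a \<longlonglongrightarrow> (LINT x|lborel. \<phi> x * unit_exp (- t * x))"
    unfolding a_def
  proof (rule integral_dominated_convergence)
    show "integrable lborel (\<lambda>x. norm (\<phi> x))" using \<phi> by simp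
    have "(\<lambda>n. \<phi> x * unit_exp (- t * x) * of_real (exp (- (\<epsilon> n * x)\<^sup>2 / 2))) \<longlonglongrightarrow>
          \<phi> x * unit_exp (- t * x) * of_real (exp (- (0 * x)\<^sup>2 / 2))" for x
      by (intro tendsto_intros \<epsilon>0) simp
    then show "AE x in lborel. (\<lambda>n. \<phi> x * unit_exp (- t * x) * of_real (exp (- (\<epsilon> n * x)\<^sup>2 / 2))) \<longlonglongrightarrow> \<phi> x * unit_exp (- t * x)"
      by simp
    have "norm (\<phi> x) * exp (- (\<epsilon> n * x)\<^sup>2 / 2) \<le> norm (\<phi> x)" for n x
      by (rule mult_left_le) auto
    then show "AE x in lborel. norm (\<phi> x * unit_exp (- t * x) * of_real (exp (- (\<epsilon> n * x)\<^sup>2 / 2))) \<le> norm (\<phi> x)" for n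
      by (simp add: norm_mult)
  qed auto
  moreover have "a \<longlonglongrightarrow> (LINT v|lborel. \<Phi> t * of_real (std_normal_density v))"
    unfolding a_eq
  proof (rule integral_dominated_convergence)
    show "integrable lborel (\<lambda>v. B * std_normal_density v)" by (intro integrable_mult_right integrable_normal_density) simp
    have "(\<lambda>n. \<Phi> (t + \<epsilon> n / (2 * pi) * v)) \<longlonglongrightarrow> \<Phi> t" for v
    proof (rule isCont_tendsto_compose[OF cont])
      have "(\<lambda>n. t + \<epsilon> n / (2 * pi) * v) \<longlonglongrightarrow> t + 0 / (2 * pi) * v"
        by (intro tendsto_intros \<epsilon>0) simp
      then show "(\<lambda>n. t + \<epsilon> n / (2 * pi) * v) \<longlonglongrightarrow> t" by simp
    qed
    then show "AE v in lborel. (\<lambda>n. \<Phi> (t + \<epsilon> n / (2 * pi) * v) * of_real (std_normal_density v)) \<longlonglongrightarrow> \<Phi> t * of_real (std_normal_density v)"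
      by (auto intro!: tendsto_intros)
    show "AE v in lborel. norm (\<Phi> (t + \<epsilon> n / (2 * pi) * v) * of_real (std_normal_density v)) \<le> B * std_normal_density v" for n
      using bound by (auto simp: norm_mult normal_density_nonneg intro!: mult_right_mono)
  qed auto
  moreover have "(LINT v|lborel. \<Phi> t * of_real (std_normal_density v)) = \<Phi> t"
    using integral_normal_density[of 1 0] by (simp add: integral_complex_of_real)
  ultimately show ?thesis using LIMSEQ_unique by metis
qed

section \<open>Bilateral sums over the half-integers\<close>

lemma range_int_Un_range_minus: "range int \<union> range (\<lambda>k. - int k - 1) = UNIV"
proof -
  have "n \<in> range int \<union> range (\<lambda>k. - int k - 1)" for n
  proof (cases "n \<ge> 0")
    case True
    then show ?thesis by (auto intro: range_eqI[of _ _ "nat n"])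
  next
    case False
    then show ?thesis by (auto intro: range_eqI[of _ _ "nat (- n - 1)"])
  qed
  then show ?thesis by blast
qed

text \<open>The involution \<open>k -> - k - 1\<close> sends \<open>k + 1/2\<close> to its negative,
  so a bilateral sum becomes a series over pairs symmetric about 0.\<close>

lemma infsum_int:
  fixes f :: "int \<Rightarrow> 'a :: banach"
  assumes "summable (\<lambda>k. norm (f (int k)))" "summable (\<lambda>k. norm (f (- int k - 1)))"
  shows "infsum f UNIV = (\<Sum>k. f (int k) + f (- int k - 1))"
proof -
  have 1: "(f has_sum (\<Sum>k. f (int k))) (range int)"
    by (subst has_sum_reindex)
       (use assms(1) in \<open>auto simp: inj_on_def o_def intro!: norm_summable_imp_has_sum summable_sums summable_norm_cancel\<close>)
  have 2: "(f has_sum (\<Sum>k. f (- int k - 1))) (range (\<lambda>k. - int k - 1))"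
    by (subst has_sum_reindex)
       (use assms(2) in \<open>auto simp: inj_on_def o_def intro!: norm_summable_imp_has_sum summable_sums summable_norm_cancel\<close>)
  have "(f has_sum ((\<Sum>k. f (int k)) + (\<Sum>k. f (- int k - 1)))) (range int \<union> range (\<lambda>k. - int k - 1))"
    by (intro has_sum_Un_disjoint 1 2) auto
  then have "infsum f UNIV = (\<Sum>k. f (int k)) + (\<Sum>k. f (- int k - 1))"
    unfolding range_int_Un_range_minus by (rule infsumI)
  also have "\<dots> = (\<Sum>k. f (int k) + f (- int k - 1))"
    by (rule suminf_add[OF assms[THEN summable_norm_cancel]])
  finally show ?thesis .
qed

section \<open>The Fourier transform of the interpolating entire function\<close>

lemma unit_exp_vector_derivative:
  "((\<lambda>u. unit_exp (u * y)) has_vector_derivative (2 * of_real pi * \<i> * of_real y) * unit_exp (u * y)) (at u within A)"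
  unfolding unit_exp_def
  by (auto intro!: derivative_eq_intros has_vector_derivative_real_field simp: field_simps)

lemma has_bochner_integral_split_0:
  fixes f :: "real \<Rightarrow> complex"
  assumes "has_bochner_integral lborel (\<lambda>u. indicator {-1..0} u *\<^sub>R g u) a"
    and "has_bochner_integral lborel (\<lambda>u. indicator {0..1} u *\<^sub>R h u) b"
    and "\<And>u. u < 0 \<Longrightarrow> f u = g u" "\<And>u. u > 0 \<Longrightarrow> f u = h u" and [measurable]: "f \<in> borel_measurable borel"
  shows "has_bochner_integral lborel (\<lambda>u. indicator {-1..1} u *\<^sub>R f u) (a + b)"
proof -
  have "has_bochner_integral lborel (\<lambda>u. indicator {-1..0} u *\<^sub>R g u + indicator {0..1} u *\<^sub>R h u) (a + b)"
    by (intro has_bochner_integral_add assms)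
  moreover have "AE u in lborel. indicator {-1..0} u *\<^sub>R g u + indicator {0..1} u *\<^sub>R h u = indicator {-1..1} u *\<^sub>R f u"
    using AE_lborel_singleton[of 0]
  proof eventually_elim
    case (elim u)
    then show ?case using assms(3,4)[of u] by (cases "u < 0") (auto simp: indicator_def)
  qed
  ultimately show ?thesis
    by (subst has_bochner_integral_cong_AE[symmetric]) (auto simp: has_bochner_integral_iff)
qed

text \<open>The boundary terms of both transforms below combine into this second difference; it is
  the source of the squared sine.\<close>

lemma unit_exp_plus_minus:
  "unit_exp y + unit_exp (- y) - 2 = of_real (- 4 * (sin (pi * y))\<^sup>2)"
proof -
  have "2 * cos (2 * (pi * y)) - 2 = - 4 * (sin (pi * y))\<^sup>2"
    by (simp add: cos_double_sin)
  then show ?thesis by (simp add: unit_exp_conv complex_eq_iff mult.assoc)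
qed

text \<open>The Fejer kernel: on each side of 0 a primitive is found by parts, and the contributions
  of 0 to first order cancel.\<close>

lemma fourier_triangle:
  assumes "y \<noteq> 0"
  shows "has_bochner_integral lborel (\<lambda>u. indicator {-1..1} u *\<^sub>R (of_real (1 - \<bar>u\<bar>) * unit_exp (u * y)))
    (of_real ((sin (pi * y) / (pi * y))\<^sup>2))"
proof -
  define w where "w = 2 * of_real pi * \<i> * complex_of_real y"
  have w0: "w \<noteq> 0" using assms by (simp add: w_def)
  have d: "((\<lambda>u. unit_exp (u * y)) has_vector_derivative w * unit_exp (u * y)) (at u within A)" for u A
    unfolding w_def by (rule unit_exp_vector_derivative)
  have d1: "((\<lambda>u. complex_of_real u) has_vector_derivative 1) (at u within A)" for u A
    using has_vector_derivative_of_real[OF DERIV_ident] by (simp add: has_vector_derivative_of_real)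
  let ?F = "\<lambda>u. (1 - of_real u) * unit_exp (u * y) / w + unit_exp (u * y) / w\<^sup>2"
  let ?G = "\<lambda>u. (1 + of_real u) * unit_exp (u * y) / w - unit_exp (u * y) / w\<^sup>2"
  have F: "has_bochner_integral lborel (\<lambda>u. indicator {0..1} u *\<^sub>R ((1 - of_real u) * unit_exp (u * y))) (?F 1 - ?F 0)"
  proof (rule has_bochner_integral_FTC_Icc)
    show "(?F has_vector_derivative (1 - of_real u) * unit_exp (u * y)) (at u within {0..1})" for u
      using w0 by (auto intro!: derivative_eq_intros d d1 simp: field_simps power2_eq_square)
    show "continuous_on {0..1} (\<lambda>u. (1 - complex_of_real u) * unit_exp (u * y))"
      by (intro continuous_intros)
  qed simp
  have G: "has_bochner_integral lborel (\<lambda>u. indicator {-1..0} u *\<^sub>R ((1 + of_real u) * unit_exp (u * y))) (?G 0 - ?G (-1))"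
  proof (rule has_bochner_integral_FTC_Icc)
    show "(?G has_vector_derivative (1 + of_real u) * unit_exp (u * y)) (at u within {-1..0})" for u
      using w0 by (auto intro!: derivative_eq_intros d d1 simp: field_simps power2_eq_square)
    show "continuous_on {-1..0} (\<lambda>u. (1 + complex_of_real u) * unit_exp (u * y))"
      by (intro continuous_intros)
  qed simp
  have "has_bochner_integral lborel (\<lambda>u. indicator {-1..1} u *\<^sub>R (of_real (1 - \<bar>u\<bar>) * unit_exp (u * y)))
     ((?G 0 - ?G (-1)) + (?F 1 - ?F 0))"
    by (rule has_bochner_integral_split_0[OF G F]) (auto simp: abs_if)
  also have "(?G 0 - ?G (-1)) + (?F 1 - ?F 0) = (unit_exp y + unit_exp (- y) - 2) / w\<^sup>2"
    using w0 by (simp add: field_simps)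
  also have "\<dots> = of_real ((sin (pi * y) / (pi * y))\<^sup>2)"
    unfolding unit_exp_plus_minus w_def by (simp add: power_mult_distrib power_divide field_simps)
  finally show ?thesis .
qed

lemma fourier_sgn:
  assumes "y \<noteq> 0"
  shows "has_bochner_integral lborel (\<lambda>u. indicator {-1..1} u *\<^sub>R (of_real (sgn u) * unit_exp (u * y)))
    (2 * \<i> * of_real ((sin (pi * y))\<^sup>2 / (pi * y)))"
proof -
  define w where "w = 2 * of_real pi * \<i> * complex_of_real y"
  have w0: "w \<noteq> 0" using assms by (simp add: w_def)
  have d: "((\<lambda>u. unit_exp (u * y)) has_vector_derivative w * unit_exp (u * y)) (at u within A)" for u A
    unfolding w_def by (rule unit_exp_vector_derivative)
  let ?F = "\<lambda>u. unit_exp (u * y) / w"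
  have dF: "(?F has_vector_derivative unit_exp (u * y)) (at u within A)" for u A
    using has_vector_derivative_divide[OF d, of w] w0 by simp
  have F: "has_bochner_integral lborel (\<lambda>u. indicator {0..1} u *\<^sub>R unit_exp (u * y)) (?F 1 - ?F 0)"
    by (rule has_bochner_integral_FTC_Icc[OF _ dF]) (auto intro!: continuous_intros)
  have "has_bochner_integral lborel (\<lambda>u. indicator {-1..0} u *\<^sub>R unit_exp (u * y)) (?F 0 - ?F (-1))"
    by (rule has_bochner_integral_FTC_Icc[OF _ dF]) (auto intro!: continuous_intros)
  from has_bochner_integral_minus[OF this]
  have G: "has_bochner_integral lborel (\<lambda>u. indicator {-1..0} u *\<^sub>R (- unit_exp (u * y))) (- (?F 0 - ?F (-1)))"
    by simp
  have "has_bochner_integral lborel (\<lambda>u. indicator {-1..1} u *\<^sub>R (of_real (sgn u) * unit_exp (u * y)))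
     (- (?F 0 - ?F (-1)) + (?F 1 - ?F 0))"
    by (rule has_bochner_integral_split_0[OF G F]) auto
  also have "- (?F 0 - ?F (-1)) + (?F 1 - ?F 0) = (unit_exp y + unit_exp (- y) - 2) / w"
    using w0 by (simp add: field_simps)
  also have "\<dots> = 2 * \<i> * of_real ((sin (pi * y))\<^sup>2 / (pi * y))"
    unfolding unit_exp_plus_minus w_def using assms by (simp add: field_simps)
  finally show ?thesis .
qed

text \<open>The terms of index \<open>k\<close> and \<open>- k - 1\<close> in \<open>L_raw\<close>,
  taken together. Pairing them makes the simple poles decay fast enough to be integrable.\<close>

definition L_term :: "real \<Rightarrow> nat \<Rightarrow> real \<Rightarrow> real" where
  "L_term \<nu> k x = exp (- \<nu> * (real k + 1/2)) * (cos (pi * x) / pi)\<^sup>2 *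
     (1 / (x - (real k + 1/2))\<^sup>2 + 1 / (x + (real k + 1/2))\<^sup>2
       - \<nu> * (1 / (x - (real k + 1/2)) - 1 / (x + (real k + 1/2))))"

lemma L_term_measurable [measurable]: "L_term \<nu> k \<in> borel_measurable borel"
  unfolding L_term_def by measurable

lemma L_coef_measurable [measurable]: "(\<lambda>t. L_coef \<nu> t k) \<in> borel_measurable borel"
  unfolding L_coef_def by measurable

text \<open>Recentres the common factor at each pole, so that a double pole turns into a shifted
  Fejer kernel.\<close>

lemma sin_half_shift_squared:
  "(sin (pi * (x + (real k + 1/2))))\<^sup>2 = (cos (pi * x))\<^sup>2"
  "(sin (pi * (x - (real k + 1/2))))\<^sup>2 = (cos (pi * x))\<^sup>2"
proof -
  have "cos (pi * (real k + 1/2)) = 0" "(sin (pi * (real k + 1/2)))\<^sup>2 = 1"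
  proof -
    have "pi * (real k + 1/2) = real k * pi + pi / 2" by (simp add: algebra_simps)
    then show "cos (pi * (real k + 1/2)) = 0" by (simp add: cos_add)
    then show "(sin (pi * (real k + 1/2)))\<^sup>2 = 1" using sin_cos_squared_add[of "pi * (real k + 1/2)"] by simp
  qed
  then show "(sin (pi * (x + (real k + 1/2))))\<^sup>2 = (cos (pi * x))\<^sup>2"
    "(sin (pi * (x - (real k + 1/2))))\<^sup>2 = (cos (pi * x))\<^sup>2"
    unfolding distrib_left[of pi] right_diff_distrib[of pi] sin_add sin_diff by (simp_all add: power_mult_distrib)
qed

lemma L_coef_exp:
  "of_real (L_coef \<nu> u k) * unit_exp (u * x) =
    of_real (exp (- \<nu> * (real k + 1/2))) *
     (of_real (1 - \<bar>u\<bar>) * unit_exp (u * (x + (real k + 1/2))) + of_real (1 - \<bar>u\<bar>) * unit_exp (u * (x - (real k + 1/2)))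
      - \<i> * of_real (\<nu> / (2 * pi)) * (of_real (sgn u) * unit_exp (u * (x + (real k + 1/2))) - of_real (sgn u) * unit_exp (u * (x - (real k + 1/2)))))"
proof -
  define c where "c = 2 * pi * u * (real k + 1/2)"
  have e: "unit_exp (u * (x + (real k + 1/2))) = unit_exp (u * x) * cis c"
    "unit_exp (u * (x - (real k + 1/2))) = unit_exp (u * x) * cis (- c)"
    by (simp_all add: unit_exp_conv c_def cis_mult algebra_simps)
  have s: "sin (2 * pi * \<bar>u\<bar> * (real k + 1/2)) = sgn u * sin c"
    by (cases u "0::real" rule: linorder_cases) (auto simp: c_def)
  define \<kappa> where "\<kappa> = \<nu> / (2 * pi)"
  have k: "\<nu> / pi = 2 * \<kappa>" by (simp add: \<kappa>_def)
  show ?thesis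
    unfolding e L_coef_def s c_def[symmetric] \<kappa>_def[symmetric] k
    by (simp add: complex_eq_iff algebra_simps)
qed

lemma fourier_L_coef:
  assumes "x \<noteq> real k + 1/2" "x \<noteq> - (real k + 1/2)"
  shows "has_bochner_integral lborel (\<lambda>u. of_real (indicator {-1..1} u * L_coef \<nu> u k) * unit_exp (u * x)) (of_real (L_term \<nu> k x))"
proof -
  let ?c = "real k + 1/2"
  let ?t = "\<lambda>y u. indicator {-1..1} u *\<^sub>R (of_real (1 - \<bar>u\<bar>) * unit_exp (u * y))"
  let ?s = "\<lambda>y u. indicator {-1..1} u *\<^sub>R (of_real (sgn u) * unit_exp (u * y))"
  have ne: "x + ?c \<noteq> 0" "x - ?c \<noteq> 0" using assms by auto
  have "has_bochner_integral lborel (\<lambda>u. of_real (exp (- \<nu> * ?c)) * (?t (x + ?c) u + ?t (x - ?c) u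
       - \<i> * of_real (\<nu> / (2 * pi)) * (?s (x + ?c) u - ?s (x - ?c) u)))
    (of_real (exp (- \<nu> * ?c)) * (of_real ((sin (pi * (x + ?c)) / (pi * (x + ?c)))\<^sup>2) + of_real ((sin (pi * (x - ?c)) / (pi * (x - ?c)))\<^sup>2)
       - \<i> * of_real (\<nu> / (2 * pi)) * (2 * \<i> * of_real ((sin (pi * (x + ?c)))\<^sup>2 / (pi * (x + ?c))) - 2 * \<i> * of_real ((sin (pi * (x - ?c)))\<^sup>2 / (pi * (x - ?c))))))"
    by (intro has_bochner_integral_mult_right has_bochner_integral_add has_bochner_integral_diff
          fourier_triangle fourier_sgn ne)
  also have "(\<lambda>u. of_real (exp (- \<nu> * ?c)) * (?t (x + ?c) u + ?t (x - ?c) u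
       - \<i> * of_real (\<nu> / (2 * pi)) * (?s (x + ?c) u - ?s (x - ?c) u))) = 
       (\<lambda>u. of_real (indicator {-1..1} u * L_coef \<nu> u k) * unit_exp (u * x))"
    unfolding of_real_mult mult.assoc L_coef_exp by (auto simp: fun_eq_iff indicator_def)
  also have "of_real (exp (- \<nu> * ?c)) * (of_real ((sin (pi * (x + ?c)) / (pi * (x + ?c)))\<^sup>2) + of_real ((sin (pi * (x - ?c)) / (pi * (x - ?c)))\<^sup>2)
       - \<i> * of_real (\<nu> / (2 * pi)) * (2 * \<i> * of_real ((sin (pi * (x + ?c)))\<^sup>2 / (pi * (x + ?c))) - 2 * \<i> * of_real ((sin (pi * (x - ?c)))\<^sup>2 / (pi * (x - ?c)))))
     = complex_of_real (exp (- \<nu> * ?c) * ((sin (pi * (x + ?c)))\<^sup>2 / (pi\<^sup>2 * (x + ?c)\<^sup>2) + (sin (pi * (x - ?c)))\<^sup>2 / (pi\<^sup>2 * (x - ?c)\<^sup>2)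
       + \<nu> / pi * ((sin (pi * (x + ?c)))\<^sup>2 / (pi * (x + ?c)) - (sin (pi * (x - ?c)))\<^sup>2 / (pi * (x - ?c)))))"
  proof -
    define \<kappa> where "\<kappa> = \<nu> / (2 * pi)"
    have k: "\<nu> / pi = 2 * \<kappa>" by (simp add: \<kappa>_def)
    have *: "of_real e * (of_real A + of_real B - \<i> * of_real \<kappa> * (2 * \<i> * of_real D - 2 * \<i> * of_real E)) =
        complex_of_real (e * (A + B + 2 * \<kappa> * (D - E)))" for e A B D E
      by (simp add: complex_eq_iff algebra_simps)
    show ?thesis unfolding \<kappa>_def[symmetric] k * by (simp only: power_divide power_mult_distrib)
  qed
  also have "exp (- \<nu> * ?c) * ((sin (pi * (x + ?c)))\<^sup>2 / (pi\<^sup>2 * (x + ?c)\<^sup>2) + (sin (pi * (x - ?c)))\<^sup>2 / (pi\<^sup>2 * (x - ?c)\<^sup>2)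
       + \<nu> / pi * ((sin (pi * (x + ?c)))\<^sup>2 / (pi * (x + ?c)) - (sin (pi * (x - ?c)))\<^sup>2 / (pi * (x - ?c)))) = L_term \<nu> k x"
    unfolding sin_half_shift_squared L_term_def by (simp add: power_divide power2_eq_square[of pi] algebra_simps)
  finally show ?thesis .
qed

text \<open>Here \<open>s\<close> stands for a sine of \<open>pi y\<close> up to sign. The majorant
  is a multiple of the Cauchy density, so its integral does not change when it is recentred at a
  pole.\<close>

lemma sinc_bound:
  fixes y s :: real
  assumes "\<bar>s\<bar> \<le> 1" "\<bar>s\<bar> \<le> pi * \<bar>y\<bar>"
  shows "(s / (pi * y))\<^sup>2 \<le> 2 * inverse (1 + y\<^sup>2)"
proof (cases "y = 0")
  case False
  have s2: "s\<^sup>2 \<le> 1" "s\<^sup>2 \<le> pi\<^sup>2 * y\<^sup>2"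
    using power_mono[OF assms(1), of 2] power_mono[OF assms(2), of 2] by (simp_all add: power_mult_distrib)
  have "1 \<le> pi\<^sup>2" using pi_gt3 by (simp add: one_le_power)
  then have "y\<^sup>2 \<le> pi\<^sup>2 * y\<^sup>2" using mult_right_mono[of 1 "pi\<^sup>2" "y\<^sup>2"] by simp
  have "s\<^sup>2 * y\<^sup>2 \<le> 1 * y\<^sup>2" using s2 by (intro mult_right_mono) auto
  then have "s\<^sup>2 * (1 + y\<^sup>2) \<le> 2 * (pi\<^sup>2 * y\<^sup>2)"
    using s2 \<open>y\<^sup>2 \<le> pi\<^sup>2 * y\<^sup>2\<close> by (simp add: distrib_left)
  then show ?thesis using False
    by (simp add: power_divide power_mult_distrib divide_simps add_pos_nonneg)
qed simp

text \<open>A simple pole alone decays only like \<open>1 / x\<close>. The difference of the two is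
  \<open>2 c\<close> times the product of the reciprocals, and
  \<open>2 \<bar>p m\<bar> \<le> p^2 + m^2\<close> then reduces everything to the double poles, at
  the cost of the factor \<open>1 + \<nu> c\<close>.\<close>

lemma L_term_bound:
  assumes "\<nu> > 0"
  shows "\<bar>L_term \<nu> k x\<bar> \<le> exp (- \<nu> * (real k + 1/2)) * (1 + \<nu> * (real k + 1/2)) *
      (2 * inverse (1 + (x + (real k + 1/2))\<^sup>2) + 2 * inverse (1 + (x - (real k + 1/2))\<^sup>2))"
proof -
  define c where "c = real k + 1/2"
  define p m where "p = cos (pi * x) / (pi * (x + c))" and "m = cos (pi * x) / (pi * (x - c))"
  have c: "c > 0" by (simp add: c_def)
  have "(cos (pi * x) / pi)\<^sup>2 * (1 / (x - c)\<^sup>2 + 1 / (x + c)\<^sup>2 - \<nu> * (1 / (x - c) - 1 / (x + c))) =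
      p\<^sup>2 + m\<^sup>2 - \<nu> * (2 * c) * (p * m)"
  \<comment> \<open>At the poles both sides are 0: the cosine vanishes and division by 0 yields
    0.\<close>
  proof (cases "x = c \<or> x = - c")
    case True
    then have "cos (pi * x) = 0"
    proof
      assume "x = c"
      then have "(sin (pi * (x - c)))\<^sup>2 = 0" by simp
      then show ?thesis by (simp only: c_def sin_half_shift_squared) simp
    next
      assume "x = - c"
      then have "(sin (pi * (x + c)))\<^sup>2 = 0" by simp
      then show ?thesis by (simp only: c_def sin_half_shift_squared) simp
    qed
    then show ?thesis by (simp add: p_def m_def)
  next
    case False
    then have "x + c \<noteq> 0" "x - c \<noteq> 0" by auto
    moreover define C P Q where "C = cos (pi * x) / pi" and "P = 1 / (x + c)" and "Q = 1 / (x - c)"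
    ultimately have "P * (x + c) = 1" "Q * (x - c) = 1" by simp_all
    then have PQ: "Q - P = 2 * c * (P * Q)" by algebra
    have pm: "p = C * P" "m = C * Q" by (simp_all add: p_def m_def C_def P_def Q_def)
    have sq: "1 / (x - c)\<^sup>2 = Q\<^sup>2" "1 / (x + c)\<^sup>2 = P\<^sup>2" by (simp_all add: P_def Q_def power_divide)
    show ?thesis
      unfolding sq P_def[symmetric] Q_def[symmetric] C_def[symmetric] PQ pm
      by (simp add: power2_eq_square algebra_simps)
  qed
  then have L: "L_term \<nu> k x = exp (- \<nu> * c) * (p\<^sup>2 + m\<^sup>2 - \<nu> * (2 * c) * (p * m))"
    unfolding L_term_def c_def by (simp only: mult.assoc)
  have pm: "\<bar>2 * (p * m)\<bar> \<le> p\<^sup>2 + m\<^sup>2"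
    using sum_squares_bound[of p m] sum_squares_bound[of p "- m"] by (simp add: abs_le_iff mult.assoc)
  have "\<bar>p\<^sup>2 + m\<^sup>2 - \<nu> * (2 * c) * (p * m)\<bar> \<le> \<bar>p\<^sup>2 + m\<^sup>2\<bar> + \<bar>\<nu> * (2 * c) * (p * m)\<bar>"
    by (rule abs_triangle_ineq4)
  also have "\<bar>\<nu> * (2 * c) * (p * m)\<bar> = \<nu> * c * \<bar>2 * (p * m)\<bar>"
    using assms c by (simp add: abs_mult)
  also have "\<bar>p\<^sup>2 + m\<^sup>2\<bar> + \<nu> * c * \<bar>2 * (p * m)\<bar> \<le> (p\<^sup>2 + m\<^sup>2) + \<nu> * c * (p\<^sup>2 + m\<^sup>2)"
    using assms c pm by (intro add_mono mult_left_mono) auto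
  also have "\<dots> = (1 + \<nu> * c) * (p\<^sup>2 + m\<^sup>2)" by (simp add: algebra_simps)
  also have "\<dots> \<le> (1 + \<nu> * c) * (2 * inverse (1 + (x + c)\<^sup>2) + 2 * inverse (1 + (x - c)\<^sup>2))"
  proof (intro mult_left_mono add_mono)
    have "\<bar>cos (pi * x)\<bar> = \<bar>sin (pi * (x + c))\<bar>" "\<bar>cos (pi * x)\<bar> = \<bar>sin (pi * (x - c))\<bar>"
      unfolding c_def by (simp_all only: real_sqrt_abs[symmetric] sin_half_shift_squared)
    then have "\<bar>cos (pi * x)\<bar> \<le> pi * \<bar>x + c\<bar>" "\<bar>cos (pi * x)\<bar> \<le> pi * \<bar>x - c\<bar>"
      using abs_sin_x_le_abs_x[of "pi * (x + c)"] abs_sin_x_le_abs_x[of "pi * (x - c)"] by (simp_all add: abs_mult)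
    then show "p\<^sup>2 \<le> 2 * inverse (1 + (x + c)\<^sup>2)" "m\<^sup>2 \<le> 2 * inverse (1 + (x - c)\<^sup>2)"
      unfolding p_def m_def by (intro sinc_bound; simp)+
  qed (use assms c in auto)
  finally have "\<bar>p\<^sup>2 + m\<^sup>2 - \<nu> * (2 * c) * (p * m)\<bar> \<le> (1 + \<nu> * c) * (2 * inverse (1 + (x + c)\<^sup>2) + 2 * inverse (1 + (x - c)\<^sup>2))" .
  then show ?thesis unfolding c_def[symmetric] L abs_mult by simp
qed

lemma integrable_cauchy: "integrable lborel (\<lambda>x::real. inverse (1 + (x + c)\<^sup>2))"
  and LINT_cauchy: "(LINT x|lborel. inverse (1 + (x + c)\<^sup>2)) = (LINT x|lborel. inverse (1 + x\<^sup>2))"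
proof -
  have "integrable lborel (\<lambda>x::real. inverse (1 + x\<^sup>2))"
    using integrable_inverse_1_plus_square by (simp add: set_integrable_def einterval_def)
  from lborel_integrable_real_affine[OF this, of 1 c]
  show "integrable lborel (\<lambda>x::real. inverse (1 + (x + c)\<^sup>2))" by (simp add: add.commute)
  show "(LINT x|lborel. inverse (1 + (x + c)\<^sup>2)) = (LINT x|lborel. inverse (1 + x\<^sup>2))"
    using lborel_integral_real_affine[of 1 "\<lambda>x. inverse (1 + x\<^sup>2)" c] by (simp add: add.commute)
qed

lemma L_term_integrable:
  assumes "\<nu> > 0"
  shows "integrable lborel (L_term \<nu> k)"
    and "(LINT x|lborel. \<bar>L_term \<nu> k x\<bar>) \<le> exp (- \<nu> * (real k + 1/2)) * (1 + \<nu> * (real k + 1/2)) * (4 * (LINT x|lborel. inverse (1 + x\<^sup>2)))"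
proof -
  let ?c = "real k + 1/2"
  let ?B = "\<lambda>x. exp (- \<nu> * ?c) * (1 + \<nu> * ?c) * (2 * inverse (1 + (x + ?c)\<^sup>2) + 2 * inverse (1 + (x - ?c)\<^sup>2))"
  have i: "integrable lborel (\<lambda>x. inverse (1 + (x - ?c)\<^sup>2))" "integrable lborel (\<lambda>x. inverse (1 + (x + ?c)\<^sup>2))"
    "(LINT x|lborel. inverse (1 + (x - ?c)\<^sup>2)) = (LINT x|lborel. inverse (1 + x\<^sup>2))"
    "(LINT x|lborel. inverse (1 + (x + ?c)\<^sup>2)) = (LINT x|lborel. inverse (1 + x\<^sup>2))"
    using integrable_cauchy[of "- ?c", unfolded add_uminus_conv_diff] LINT_cauchy[of "- ?c", unfolded add_uminus_conv_diff]
      integrable_cauchy[of ?c] LINT_cauchy[of ?c] by (simp_all only:)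
  have B: "integrable lborel ?B"
    by (intro integrable_mult_right Bochner_Integration.integrable_add i)
  show 1: "integrable lborel (L_term \<nu> k)"
    by (rule Bochner_Integration.integrable_bound[OF B]) (use L_term_bound[OF assms, of k] in \<open>auto simp: abs_le_iff intro: order_trans[OF _ abs_ge_self]\<close>)
  have "(LINT x|lborel. \<bar>L_term \<nu> k x\<bar>) \<le> (LINT x|lborel. ?B x)"
    using 1 L_term_bound[OF assms] by (intro integral_mono B) auto
  also have "\<dots> = exp (- \<nu> * ?c) * (1 + \<nu> * ?c) * (4 * (LINT x|lborel. inverse (1 + x\<^sup>2)))"
    using i by (simp only: integral_mult_right_zero Bochner_Integration.integral_add integrable_mult_right) simp
  finally show "(LINT x|lborel. \<bar>L_term \<nu> k x\<bar>) \<le> exp (- \<nu> * ?c) * (1 + \<nu> * ?c) * (4 * (LINT x|lborel. inverse (1 + x\<^sup>2)))" .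
qed

lemma fourier_L_term:
  assumes "\<nu> > 0" "\<bar>t\<bar> < 1"
  shows "(LINT x|lborel. of_real (L_term \<nu> k x) * unit_exp (- t * x)) = of_real (L_coef \<nu> t k)"
proof -
  let ?\<Phi> = "\<lambda>u. complex_of_real (indicator {-1..1} u * L_coef \<nu> u k)"
  let ?B = "(2 + \<nu>) * exp (- \<nu> * (real k + 1/2))"
  have bound: "norm (?\<Phi> u) \<le> ?B" for u
    using abs_L_coef_le[OF assms(1), of u k] assms(1) by (auto simp: indicator_def)
  have "(LINT x|lborel. of_real (L_term \<nu> k x) * unit_exp (- t * x)) = ?\<Phi> t"
  proof (rule fourier_inversion[OF _ bound])
    have "integrable lborel (\<lambda>u. indicator {-1..1::real} u *\<^sub>R ?B)"
      by (intro integrable_scaleR_left integrable_real_indicator) auto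
    then show "integrable lborel ?\<Phi>"
      by (rule Bochner_Integration.integrable_bound)
         (use abs_L_coef_le[OF assms(1), of _ k] assms(1) in \<open>auto simp: indicator_def abs_mult\<close>)
    have "isCont (\<lambda>u. complex_of_real (L_coef \<nu> u k)) t"
      unfolding L_coef_def by (intro continuous_intros)
    moreover have "eventually (\<lambda>u. ?\<Phi> u = complex_of_real (L_coef \<nu> u k)) (nhds t)"
      using assms(2) by (intro eventually_nhds_in_open[of "{-1<..<1}", THEN eventually_mono]) (auto simp: indicator_def)
    ultimately show "isCont ?\<Phi> t" by (simp only: isCont_cong)
    show "integrable lborel (\<lambda>x. complex_of_real (L_term \<nu> k x))"
      using L_term_integrable(1)[OF assms(1)] by simp
    show "AE x in lborel. (LINT u|lborel. ?\<Phi> u * unit_exp (u * x)) = complex_of_real (L_term \<nu> k x)"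
      using AE_lborel_singleton[of "real k + 1/2"] AE_lborel_singleton[of "- (real k + 1/2)"]
      by eventually_elim (rule has_bochner_integral_integral_eq[OF fourier_L_coef])
  qed
  moreover have "indicator {-1..1} t = (1::real)" using assms(2) by (simp add: indicator_def abs_less_iff)
  ultimately show ?thesis by simp
qed

text \<open>Half of the exponent absorbs the linear factor.\<close>

lemma summable_linear_exp_half:
  assumes "\<nu> > 0"
  shows "summable (\<lambda>k. exp (- \<nu> * (real k + 1/2)) * (1 + \<nu> * (real k + 1/2)))"
proof -
  have "summable (\<lambda>k. 2 * exp (- (\<nu> / 2) * (real k + 1/2)))"
    by (intro summable_mult summable_exp_half) (use assms in simp)
  moreover have "norm (exp (- \<nu> * (real k + 1/2)) * (1 + \<nu> * (real k + 1/2))) \<le> 2 * exp (- (\<nu> / 2) * (real k + 1/2))" for k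
  proof -
    define y where "y = \<nu> / 2 * (real k + 1/2)"
    have y: "y > 0" using assms by (simp add: y_def)
    have "1 + 2 * y \<le> 2 * exp y" using exp_ge_add_one_self[of y] by linarith
    then have "exp (- 2 * y) * (1 + 2 * y) \<le> exp (- 2 * y) * (2 * exp y)" by (intro mult_left_mono) auto
    also have "\<dots> = 2 * exp (- y)" by (simp flip: exp_add)
    finally have "norm (exp (- 2 * y) * (1 + 2 * y)) \<le> 2 * exp (- y)" using y by (simp add: abs_mult)
    then show ?thesis by (simp add: y_def)
  qed
  ultimately show ?thesis by (rule summable_comparison_test')
qed

section \<open>The entire function on the real line\<close>

definition half_ints :: "real set" where "half_ints = range (\<lambda>k::int. of_int k + 1/2)"

lemma summable_on_exp_half_int:
  fixes \<nu> :: real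
  assumes "\<nu> > 0" shows "(\<lambda>k::int. exp (- \<nu> * \<bar>of_int k + 1/2\<bar>)) summable_on UNIV"
proof -
  let ?f = "\<lambda>k::int. exp (- \<nu> * \<bar>of_int k + 1/2\<bar>)"
  have "?f \<circ> int = (\<lambda>k. exp (- \<nu> * (real k + 1/2)))" "?f \<circ> (\<lambda>k. - int k - 1) = (\<lambda>k. exp (- \<nu> * (real k + 1/2)))"
    by (auto simp: fun_eq_iff)
  moreover have "(\<lambda>k. exp (- \<nu> * (real k + 1/2))) summable_on UNIV"
    using summable_exp_half[OF assms] by (intro norm_summable_imp_summable_on) simp
  ultimately have "?f summable_on range int" "?f summable_on range (\<lambda>k. - int k - 1)"
    by (simp_all add: summable_on_reindex inj_on_def)
  then show ?thesis
    unfolding range_int_Un_range_minus[symmetric] by (rule summable_on_union)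
qed

text \<open>\<open>remove_sings\<close> takes a limit, so continuity is what identifies
  \<open>L_fun\<close> with \<open>L_raw\<close> at real points off the half-integers. The
  neighbourhood is complex because the limit is.\<close>

lemma L_raw_isCont:
  assumes \<nu>: "\<nu> > 0" and x: "x \<notin> half_ints"
  shows "isCont (L_raw \<nu>) (of_real x)"
proof -
  \<comment> \<open>The distance from \<open>x\<close> to the half-integers. On the ball of radius
    \<open>d / 2\<close> every pole stays at distance at least \<open>d / 2\<close>, which gives the
    uniform majorants for both series.\<close>
  define d where "d = min (frac (x - 1/2)) (1 - frac (x - 1/2))"
  have "x - 1/2 \<notin> \<int>"
  proof
    assume "x - 1/2 \<in> \<int>"
    then obtain k :: int where "x - 1/2 = of_int k" by (elim Ints_cases)
    then have "x = of_int k + 1/2" by simp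
    with x show False by (auto simp: half_ints_def)
  qed
  then have d: "d > 0" using frac_lt_1[of "x - 1/2"] by (simp add: d_def)
  have dist: "\<bar>x - of_int k - 1/2\<bar> \<ge> d" for k :: int
  proof -
    have "frac (x - 1/2) = x - 1/2 - of_int \<lfloor>x - 1/2\<rfloor>" by (simp add: frac_def)
    moreover have "k \<le> \<lfloor>x - 1/2\<rfloor> \<or> k \<ge> \<lfloor>x - 1/2\<rfloor> + 1" by linarith
    then have "real_of_int k \<le> of_int \<lfloor>x - 1/2\<rfloor> \<or> real_of_int k \<ge> of_int \<lfloor>x - 1/2\<rfloor> + 1" by linarith
    ultimately show ?thesis unfolding d_def by (auto simp: min_def abs_if)
  qed
  define B where "B = ball (complex_of_real x) (d / 2)"
  have dz: "norm (z - of_int k - 1/2) \<ge> d / 2" if "z \<in> B" for z :: complex and k :: int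
  proof -
    have "norm (complex_of_real (x - of_int k - 1/2)) \<ge> d" using dist[of k] by (simp only: norm_of_real)
    moreover have "norm (complex_of_real (x - of_int k - 1/2)) \<le> norm (complex_of_real x - z) + norm (z - of_int k - 1/2)"
    proof -
      have "complex_of_real (x - of_int k - 1/2) = (complex_of_real x - z) + (z - of_int k - 1/2)" by simp
      then show ?thesis by (simp only: norm_triangle_ineq)
    qed
    moreover have "norm (complex_of_real x - z) < d / 2" using that by (simp add: B_def dist_norm)
    ultimately show ?thesis by linarith
  qed
  let ?e = "\<lambda>k::int. exp (- \<nu> * \<bar>of_int k + 1/2\<bar>)"
  let ?f = "\<lambda>(k::int) z. of_real (?e k) / (z - of_int k - 1/2)\<^sup>2 :: complex"
  let ?g = "\<lambda>(k::int) z. of_real (sgn (of_int k + 1/2) * ?e k) / (z - of_int k - 1/2) :: complex"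
  have nz: "z - of_int k - 1/2 \<noteq> 0" if "z \<in> B" for z :: complex and k :: int
  proof
    assume "z - of_int k - 1/2 = 0"
    with dz[OF that, of k] d show False by (simp only: norm_zero)
  qed
  have "continuous_on B (\<lambda>z. \<Sum>\<^sub>\<infinity>k. ?f k z)"
  proof (rule uniform_limit_theorem[where F = "finite_subsets_at_top UNIV" and f = "\<lambda>X z. \<Sum>k\<in>X. ?f k z"])
    show "\<forall>\<^sub>F X in finite_subsets_at_top UNIV. continuous_on B (\<lambda>z. \<Sum>k\<in>X. ?f k z)"
      by (intro always_eventually allI continuous_intros) (use nz in auto)
    show "uniform_limit B (\<lambda>X z. \<Sum>k\<in>X. ?f k z) (\<lambda>z. \<Sum>\<^sub>\<infinity>k. ?f k z) (finite_subsets_at_top UNIV)"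
    proof (rule Weierstrass_m_test_general)
      show "(\<lambda>k. ?e k * (1 / (d / 2)\<^sup>2)) summable_on UNIV"
        by (intro summable_on_cmult_left summable_on_exp_half_int \<nu>)
      show "norm (?f k z) \<le> ?e k * (1 / (d / 2)\<^sup>2)" if "z \<in> B" for k z
      proof -
        have "1 / (norm (z - of_int k - 1/2))\<^sup>2 \<le> 1 / (d / 2)\<^sup>2"
          using dz[OF that, of k] d nz[OF that, of k] by (intro divide_left_mono power_mono mult_pos_pos zero_less_power) auto
        from mult_left_mono[OF this, of "?e k"]
        show ?thesis by (simp add: norm_divide norm_power)
      qed
    qed
  qed (rule finite_subsets_at_top_neq_bot)
  moreover have "continuous_on B (\<lambda>z. \<Sum>\<^sub>\<infinity>k. ?g k z)"
  proof (rule uniform_limit_theorem[where F = "finite_subsets_at_top UNIV" and f = "\<lambda>X z. \<Sum>k\<in>X. ?g k z"])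
    show "\<forall>\<^sub>F X in finite_subsets_at_top UNIV. continuous_on B (\<lambda>z. \<Sum>k\<in>X. ?g k z)"
      by (intro always_eventually allI continuous_intros) (use nz in auto)
    show "uniform_limit B (\<lambda>X z. \<Sum>k\<in>X. ?g k z) (\<lambda>z. \<Sum>\<^sub>\<infinity>k. ?g k z) (finite_subsets_at_top UNIV)"
    proof (rule Weierstrass_m_test_general)
      show "(\<lambda>k. ?e k * (1 / (d / 2))) summable_on UNIV"
        by (intro summable_on_cmult_left summable_on_exp_half_int \<nu>)
      show "norm (?g k z) \<le> ?e k * (1 / (d / 2))" if "z \<in> B" for k z
      proof -
        have "1 / norm (z - of_int k - 1/2) \<le> 1 / (d / 2)"
          using dz[OF that, of k] d nz[OF that, of k] by (intro divide_left_mono mult_pos_pos) auto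
        moreover have "\<bar>sgn (of_int k + 1/2) * ?e k\<bar> \<le> ?e k" by (simp add: abs_mult sgn_if)
        ultimately have "\<bar>sgn (of_int k + 1/2) * ?e k\<bar> * (1 / norm (z - of_int k - 1/2)) \<le> ?e k * (1 / (d / 2))"
          by (intro mult_mono) auto
        then show ?thesis by (simp only: norm_divide norm_of_real times_divide_eq_right mult_1_right)
      qed
    qed
  qed (rule finite_subsets_at_top_neq_bot)
  ultimately have "continuous_on B (L_raw \<nu>)"
    unfolding L_raw_def by (intro continuous_intros) auto
  moreover have "of_real x \<in> B" "open B" using d by (auto simp: B_def)
  ultimately show ?thesis by (simp add: continuous_on_eq_continuous_at)
qed

lemma L_raw_real:
  assumes \<nu>: "\<nu> > 0" and x: "x \<notin> half_ints"
  shows "L_raw \<nu> (of_real x) = of_real (\<Sum>k. L_term \<nu> k x)" "summable (\<lambda>k. \<bar>L_term \<nu> k x\<bar>)"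
proof -
  define C where "C = (cos (pi * x) / pi)\<^sup>2"
  let ?e = "\<lambda>k. exp (- \<nu> * (real k + 1/2))"
  let ?f = "\<lambda>k::int. of_real (exp (- \<nu> * \<bar>of_int k + 1/2\<bar>)) / (complex_of_real x - of_int k - 1/2)\<^sup>2"
  let ?g = "\<lambda>k::int. of_real (sgn (of_int k + 1/2) * exp (- \<nu> * \<bar>of_int k + 1/2\<bar>)) / (complex_of_real x - of_int k - 1/2)"
  have abs: "\<bar>real_of_int (int k) + 1/2\<bar> = real k + 1/2" "\<bar>real_of_int (- int k - 1) + 1/2\<bar> = real k + 1/2" for k
    by auto
  have sg: "sgn (real_of_int (int k) + 1/2) = 1" "sgn (real_of_int (- int k - 1) + 1/2) = -1" for k
    by (auto simp: sgn_if)
  have f: "?f (int k) = of_real (?e k * (1 / (x - (real k + 1/2))\<^sup>2))" 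
    "?f (- int k - 1) = of_real (?e k * (1 / (x + (real k + 1/2))\<^sup>2))" for k
    unfolding abs by (simp_all add: algebra_simps)
  have g: "?g (int k) = of_real (?e k * (1 / (x - (real k + 1/2))))" 
    "?g (- int k - 1) = of_real (- (?e k * (1 / (x + (real k + 1/2)))))" for k
    unfolding abs sg by (simp_all add: algebra_simps)
  \<comment> \<open>Only finitely many poles can be close to \<open>x\<close>; beyond them all
    reciprocals are at most 1 and the exponential alone dominates.\<close>
  have far: "\<bar>x - (real k + 1/2)\<bar> \<ge> 1" "\<bar>x + (real k + 1/2)\<bar> \<ge> 1" if "k \<ge> nat \<lceil>\<bar>x\<bar> + 1\<rceil>" for k
    using that by linarith+
  have inv: "1 / \<bar>x - (real k + 1/2)\<bar> \<le> 1" "1 / \<bar>x + (real k + 1/2)\<bar> \<le> 1" if "k \<ge> nat \<lceil>\<bar>x\<bar> + 1\<rceil>" for k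
    using far[OF that] by (simp_all add: divide_simps)
  have sq: "1 / (x - (real k + 1/2))\<^sup>2 \<le> 1" "1 / (x + (real k + 1/2))\<^sup>2 \<le> 1" if "k \<ge> nat \<lceil>\<bar>x\<bar> + 1\<rceil>" for k
    using power_mono[OF far(1)[OF that], of 2] power_mono[OF far(2)[OF that], of 2] by (simp_all add: divide_simps)
  have S: "summable (\<lambda>k. ?e k * a k)" if "\<And>k. k \<ge> nat \<lceil>\<bar>x\<bar> + 1\<rceil> \<Longrightarrow> \<bar>a k\<bar> \<le> 1" for a :: "nat \<Rightarrow> real"
    by (rule summable_comparison_test'[OF summable_exp_half[OF \<nu>], of "nat \<lceil>\<bar>x\<bar> + 1\<rceil>"])
       (use that in \<open>simp add: abs_mult\<close>)
  have sums_f: "(\<Sum>\<^sub>\<infinity>k. ?f k) = (\<Sum>k. of_real (?e k * (1 / (x - (real k + 1/2))\<^sup>2) + ?e k * (1 / (x + (real k + 1/2))\<^sup>2)))"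
    unfolding of_real_add f[symmetric]
  proof (rule infsum_int)
    show "summable (\<lambda>k. norm (?f (int k)))" "summable (\<lambda>k. norm (?f (- int k - 1)))"
      unfolding f norm_of_real abs_mult abs_exp_cancel using sq by (intro S; simp)+
  qed
  have sums_g: "(\<Sum>\<^sub>\<infinity>k. ?g k) = (\<Sum>k. of_real (?e k * (1 / (x - (real k + 1/2))) + - (?e k * (1 / (x + (real k + 1/2))))))"
    unfolding of_real_add g[symmetric]
  proof (rule infsum_int)
    show "summable (\<lambda>k. norm (?g (int k)))" "summable (\<lambda>k. norm (?g (- int k - 1)))"
      unfolding g norm_of_real abs_mult abs_exp_cancel abs_minus_cancel using inv by (intro S; simp)+
  qed
  have s1: "summable (\<lambda>k. ?e k * (1 / (x - (real k + 1/2))\<^sup>2) + ?e k * (1 / (x + (real k + 1/2))\<^sup>2))"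
    using sq by (intro summable_add S) auto
  have s2: "summable (\<lambda>k. ?e k * (1 / (x - (real k + 1/2))) + - (?e k * (1 / (x + (real k + 1/2)))))"
    using inv by (intro summable_add summable_minus S) auto
  have L: "L_term \<nu> k x = C * ((?e k * (1 / (x - (real k + 1/2))\<^sup>2) + ?e k * (1 / (x + (real k + 1/2))\<^sup>2))
      - \<nu> * (?e k * (1 / (x - (real k + 1/2))) + - (?e k * (1 / (x + (real k + 1/2))))))" for k
    unfolding L_term_def C_def[symmetric] by (simp add: algebra_simps)
  have Lsum: "(\<Sum>k. L_term \<nu> k x) = C * ((\<Sum>k. ?e k * (1 / (x - (real k + 1/2))\<^sup>2) + ?e k * (1 / (x + (real k + 1/2))\<^sup>2))
      - \<nu> * (\<Sum>k. ?e k * (1 / (x - (real k + 1/2))) + - (?e k * (1 / (x + (real k + 1/2))))))"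
    unfolding L suminf_mult[OF summable_diff[OF s1 summable_mult[OF s2]]]
      suminf_diff[OF s1 summable_mult[OF s2], symmetric] suminf_mult[OF s2] ..
  show "L_raw \<nu> (of_real x) = of_real (\<Sum>k. L_term \<nu> k x)"
    unfolding Lsum L_raw_def sums_f sums_g suminf_of_real[OF s1, symmetric] suminf_of_real[OF s2, symmetric]
    by (simp add: C_def cos_of_real[symmetric])
  show "summable (\<lambda>k. \<bar>L_term \<nu> k x\<bar>)"
  proof (rule summable_comparison_test'[OF summable_mult[OF summable_exp_half[OF \<nu>], of "C * (2 + 2 * \<nu>)"], of "nat \<lceil>\<bar>x\<bar> + 1\<rceil>"])
    fix k assume k: "k \<ge> nat \<lceil>\<bar>x\<bar> + 1\<rceil>"
    define a b p q where "a = 1 / (x - (real k + 1/2))\<^sup>2" and "b = 1 / (x + (real k + 1/2))\<^sup>2"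
      and "p = 1 / (x - (real k + 1/2))" and "q = 1 / (x + (real k + 1/2))"
    have "\<bar>a\<bar> \<le> 1" "\<bar>b\<bar> \<le> 1" "\<bar>p\<bar> \<le> 1" "\<bar>q\<bar> \<le> 1"
      using inv[OF k] sq[OF k] by (simp_all add: a_def b_def p_def q_def)
    moreover from this have "\<bar>\<nu> * (p - q)\<bar> \<le> \<nu> * 2"
      unfolding abs_mult using \<nu> by (intro mult_mono) auto
    ultimately have "\<bar>a + b - \<nu> * (p - q)\<bar> \<le> 2 + 2 * \<nu>" by linarith
    then have "?e k * C * \<bar>a + b - \<nu> * (p - q)\<bar> \<le> ?e k * C * (2 + 2 * \<nu>)"
      by (intro mult_left_mono) (auto simp: C_def)
    then show "norm \<bar>L_term \<nu> k x\<bar> \<le> C * (2 + 2 * \<nu>) * ?e k"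
      unfolding L_term_def C_def[symmetric] a_def[symmetric] b_def[symmetric] p_def[symmetric] q_def[symmetric]
      by (simp add: abs_mult C_def mult_ac)
  qed
qed

text \<open>Termwise integration is justified by summability of the L1 norms, which are of size
  \<open>exp (- \<nu> c) (1 + \<nu> c)\<close> with \<open>c = k + 1/2\<close>. The half-integers
  are countable and hence invisible to the integral.\<close>

lemma L_hat_eq:
  assumes "\<nu> > 0" "\<bar>t\<bar> < 1"
  shows "L_hat \<nu> t = of_real (L_series \<nu> t)"
proof -
  have half: "AE x in lborel. x \<notin> half_ints"
    by (intro AE_not_in countable_imp_null_set_lborel) (simp add: half_ints_def)
  have 1: "L_fun \<nu> (of_real x) = of_real (\<Sum>k. L_term \<nu> k x)" if "x \<notin> half_ints" for x
    unfolding L_fun_def L_raw_real(1)[OF assms(1) that, symmetric]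
    using L_raw_isCont[OF assms(1) that] by (intro remove_sings_eqI) (simp add: isCont_def)
  let ?f = "\<lambda>k x. complex_of_real (L_term \<nu> k x) * unit_exp (- t * x)"
  have "(LINT x|lborel. (\<Sum>k. ?f k x)) = (\<Sum>k. LINT x|lborel. ?f k x)"
  proof (rule integral_suminf)
    show "integrable lborel (?f k)" for k
      by (rule Bochner_Integration.integrable_bound[OF L_term_integrable(1)[OF assms(1)]]) (auto simp: norm_mult)
    show "AE x in lborel. summable (\<lambda>k. norm (?f k x))"
      using half by eventually_elim (use L_raw_real(2)[OF assms(1)] in \<open>simp add: norm_mult\<close>)
    show "summable (\<lambda>k. LINT x|lborel. norm (?f k x))"
      by (rule summable_comparison_test'[OF summable_mult2[OF summable_linear_exp_half[OF assms(1)]], of 0 _ "4 * (LINT x|lborel. inverse (1 + x\<^sup>2))"])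
         (use L_term_integrable(2)[OF assms(1)] in \<open>simp add: norm_mult integral_nonneg_AE\<close>)
  qed
  also have "(\<Sum>k. LINT x|lborel. ?f k x) = (\<Sum>k. of_real (L_coef \<nu> t k))"
    using fourier_L_term[OF assms] by simp
  also have "\<dots> = of_real (L_series \<nu> t)"
  proof -
    have "L_coef \<nu> t sums L_series \<nu> t" using assms by (intro L_coef_sums) auto
    then show ?thesis by (simp only: sums_unique[OF sums_of_real, symmetric])
  qed
  also have "(LINT x|lborel. (\<Sum>k. ?f k x)) = L_hat \<nu> t"
    unfolding L_hat_def
  proof (rule integral_discrete_difference[of half_ints])
    fix x assume "x \<notin> half_ints"
    note summ = L_raw_real(2)[OF assms(1) this, THEN summable_rabs_cancel]
    show "(\<Sum>k. ?f k x) = L_fun \<nu> (of_real x) * unit_exp (- t * x)"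
      unfolding 1[OF \<open>x \<notin> half_ints\<close>] suminf_of_real[OF summ]
      by (rule suminf_mult2[symmetric]) (use summ in \<open>simp add: summable_of_real\<close>)
  qed (auto simp: half_ints_def)
  finally show ?thesis .
qed

section \<open>Bounds in the spectral parameter\<close>

lemma nonneg_by_deriv:
  fixes f f' :: "real \<Rightarrow> real"
  assumes "\<And>x. (f has_real_derivative f' x) (at x)" "\<And>x. x \<ge> 0 \<Longrightarrow> f' x \<ge> 0" "f 0 \<ge> 0" "a \<ge> 0"
  shows "f a \<ge> 0"
proof -
  have "f 0 \<le> f a"
    by (rule DERIV_nonneg_imp_nondecreasing[OF assms(4)]) (use assms in blast)
  with assms(3) show ?thesis by linarith
qed

lemma sinh_ge_self: "a \<ge> 0 \<Longrightarrow> a \<le> sinh (a::real)"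
  using sinh_gt_self[of a] by (cases "a = 0") auto

lemma sinh_le_cosh_mult: "a \<ge> 0 \<Longrightarrow> sinh a \<le> a * cosh (a::real)"
proof -
  assume a: "a \<ge> 0"
  have "((\<lambda>x. x * cosh x - sinh x) has_real_derivative x * sinh x) (at x)" for x :: real
    by (auto intro!: derivative_eq_intros)
  from nonneg_by_deriv[OF this _ _ a] show ?thesis by simp
qed

lemma cosh_le_sinh_mult: "a \<ge> 0 \<Longrightarrow> cosh a - 1 \<le> a * sinh (a::real)"
proof -
  assume a: "a \<ge> 0"
  have "((\<lambda>x. x * sinh x - cosh x + 1) has_real_derivative x * cosh x) (at x)" for x :: real
    by (auto intro!: derivative_eq_intros)
  from nonneg_by_deriv[OF this _ _ a] show ?thesis by simp
qed

lemma cosh_ge_quadratic: "a \<ge> 0 \<Longrightarrow> 1 + a\<^sup>2 / 2 \<le> cosh (a::real)"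
proof -
  assume a: "a \<ge> 0"
  have "((\<lambda>x. cosh x - 1 - x\<^sup>2 / 2) has_real_derivative sinh x - x) (at x)" for x :: real
    by (auto intro!: derivative_eq_intros)
  from nonneg_by_deriv[OF this _ _ a] sinh_ge_self show ?thesis by simp
qed

text \<open>Comparable with \<open>min l (1 / l)\<close>, so a bound O(l) near 0 together with
  O(1/l) at infinity yields integrability for the given measure.\<close>

definition param_weight :: "real \<Rightarrow> real" where "param_weight l = l / (l\<^sup>2 + 1)"

text \<open>The bounds arise naturally in \<open>a = \<kappa> * l\<close>, with \<kappa> equal to
  1/2 for the kernel and to \<open>1 / (2 (N + 1))\<close> for the minorant. The change of scale
  costs a factor \<open>1 / \<kappa>\<close>.\<close>

lemma param_weight_scale:
  assumes "0 < \<kappa>" "\<kappa> \<le> 1" "l > 0"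
  shows "\<kappa> * l / (1 + (\<kappa> * l)\<^sup>2) \<le> param_weight l / \<kappa>"
proof -
  have "\<kappa>\<^sup>2 \<le> 1" using assms by (simp add: power_le_one)
  then have "\<kappa>\<^sup>2 * (l\<^sup>2 + 1) \<le> 1 + (\<kappa> * l)\<^sup>2" by (simp add: distrib_left power_mult_distrib)
  then have "\<kappa> * l / (1 + (\<kappa> * l)\<^sup>2) \<le> \<kappa> * l / (\<kappa>\<^sup>2 * (l\<^sup>2 + 1))"
    using assms by (intro divide_left_mono mult_pos_pos add_pos_nonneg) (auto simp: add_pos_nonneg add_nonneg_pos)
  also have "\<dots> = param_weight l / \<kappa>" using assms by (simp add: param_weight_def power2_eq_square)
  finally show ?thesis .
qed

lemma min_bound:
  assumes "(a::real) > 0" "y \<le> C * a" "y \<le> C / a" "C \<ge> 0"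
  shows "y \<le> 2 * C * (a / (1 + a\<^sup>2))"
proof -
  have "y * (1 + a\<^sup>2) = y + a * (y * a)" by (simp add: power2_eq_square algebra_simps)
  also have "\<dots> \<le> C * a + a * C"
    using assms by (intro add_mono mult_left_mono) (auto simp: field_simps)
  finally have "y * (1 + a\<^sup>2) \<le> 2 * C * a" by simp
  then show ?thesis by (simp add: pos_le_divide_eq add_pos_nonneg)
qed

lemma min_bound_param_weight:
  assumes "0 < \<kappa>" "\<kappa> \<le> 1" "l > 0" "a = \<kappa> * l" "y \<le> C * a" "y \<le> C / a" "C \<ge> 0"
  shows "y \<le> 2 * C / \<kappa> * param_weight l"
proof -
  have "y \<le> 2 * C * (\<kappa> * l / (1 + (\<kappa> * l)\<^sup>2))" using assms by (intro min_bound) auto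
  also have "\<dots> \<le> 2 * C * (param_weight l / \<kappa>)" using assms by (intro mult_left_mono param_weight_scale) auto
  finally show ?thesis by simp
qed

text \<open>For \<open>t\<close> strictly between 0 and 1 the sine keeps the denominator above
  \<open>s^2 cosh^2 a\<close>, where \<open>s = sin (pi t)\<close>, while the numerator is at most
  \<open>2 a cosh a\<close>. The quotient is thus of size \<open>a / cosh a\<close>, with no
  singularity at \<open>a = 0\<close>.\<close>

lemma L_series_bound:
  assumes "0 < t" "t < 1" "0 < \<kappa>" "\<kappa> \<le> 1"
  shows "\<exists>C\<ge>0. \<forall>l>0. \<bar>L_series (2 * \<kappa> * l) t\<bar> \<le> C * param_weight l"
proof (intro exI[of _ "4 / (sin (pi * t))\<^sup>2 / \<kappa>"] conjI allI impI)
  let ?s = "sin (pi * t)"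
  have s: "?s > 0" using assms by (intro sin_gt_zero) auto
  then show "0 \<le> 4 / ?s\<^sup>2 / \<kappa>" using assms by simp
  fix l :: real assume l: "l > 0"
  define a where "a = \<kappa> * l"
  have a: "a > 0" using assms l by (simp add: a_def)
  define D where "D = (sinh a)\<^sup>2 + ?s\<^sup>2"
  have s1: "?s\<^sup>2 \<le> 1" by (simp add: power_le_one_iff abs_square_le_1)
  have D: "?s\<^sup>2 * (cosh a)\<^sup>2 \<le> D"
    using mult_right_mono[OF s1, of "(sinh a)\<^sup>2"] by (simp add: D_def cosh_square_eq distrib_left)
  have Dpos: "D > 0" using s by (simp add: D_def add_nonneg_pos)
  let ?n = "(1 - \<bar>t\<bar>) * sinh a * cos (pi * t) + a / pi * cosh a * sin (pi * \<bar>t\<bar>)"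
  have L: "L_series (2 * \<kappa> * l) t = ?n / D"
    using assms l by (subst L_series_closed) (auto simp: a_def D_def)
  have "\<bar>(1 - \<bar>t\<bar>) * sinh a * cos (pi * t)\<bar> \<le> 1 * (a * cosh a) * 1"
    unfolding abs_mult using assms a sinh_le_cosh_mult[of a] by (intro mult_mono) auto
  moreover have "\<bar>a / pi * cosh a * sin (pi * \<bar>t\<bar>)\<bar> \<le> a * cosh a * 1"
  proof -
    have "a / pi \<le> a / 1" using a pi_gt3 by (intro divide_left_mono) auto
    then show ?thesis unfolding abs_mult using a by (intro mult_mono) auto
  qed
  ultimately have n: "\<bar>?n\<bar> \<le> 2 * a * cosh a"
    using abs_triangle_ineq[of "(1 - \<bar>t\<bar>) * sinh a * cos (pi * t)" "a / pi * cosh a * sin (pi * \<bar>t\<bar>)"] by linarith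
  have "\<bar>L_series (2 * \<kappa> * l) t\<bar> = \<bar>?n\<bar> / D" using Dpos by (simp add: L abs_divide)
  also have "\<dots> \<le> 2 * a * cosh a / (?s\<^sup>2 * (cosh a)\<^sup>2)"
    using n D s a by (intro frac_le) auto
  also have "\<dots> = 2 / ?s\<^sup>2 * (a / cosh a)" by (simp add: power2_eq_square)
  also have "\<dots> \<le> 4 / ?s\<^sup>2 / \<kappa> * param_weight l"
  proof -
    have "a / cosh a \<le> a / (1 / 2 * (1 + a\<^sup>2))"
      using a cosh_ge_quadratic[of a] by (intro divide_left_mono mult_pos_pos) (auto simp: add_pos_nonneg)
    also have "\<dots> = 2 * (\<kappa> * l / (1 + (\<kappa> * l)\<^sup>2))" by (simp add: a_def)
    also have "\<dots> \<le> 2 * (param_weight l / \<kappa>)" using assms l by (intro mult_left_mono param_weight_scale) auto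
    finally have "2 / ?s\<^sup>2 * (a / cosh a) \<le> 2 / ?s\<^sup>2 * (2 * (param_weight l / \<kappa>))" by (intro mult_left_mono) auto
    then show ?thesis by simp
  qed
  finally show "\<bar>L_series (2 * \<kappa> * l) t\<bar> \<le> 4 / ?s\<^sup>2 / \<kappa> * param_weight l" .
qed

text \<open>Serves frequency 0, where the series is a hyperbolic cosecant and becomes small at 0
  only after its pole is subtracted.\<close>

lemma csch_bound:
  assumes "(a::real) > 0"
  shows "1 / a - 1 / sinh a \<le> a" "1 / a - 1 / sinh a \<le> 1 / a" "0 \<le> 1 / a - 1 / sinh a"
proof -
  have s: "sinh a > 0" using assms by simp
  have "1 / a - 1 / sinh a = (sinh a - a) / (a * sinh a)" using assms s by (simp add: field_simps)
  also have "\<dots> \<le> (a * cosh a - a) / (a * sinh a)"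
    using sinh_le_cosh_mult[of a] assms s by (intro divide_right_mono) auto
  also have "\<dots> = (cosh a - 1) / sinh a" using assms s by (simp add: field_simps)
  also have "\<dots> \<le> a * sinh a / sinh a"
    using cosh_le_sinh_mult[of a] assms s by (intro divide_right_mono) auto
  finally show "1 / a - 1 / sinh a \<le> a" using s by simp
  show "1 / a - 1 / sinh a \<le> 1 / a" using s by simp
  show "0 \<le> 1 / a - 1 / sinh a" using sinh_ge_self[of a] assms by (simp add: frac_le)
qed

text \<open>The subtraction at frequency 0 cancels the pole of the hyperbolic cosecant at
  \<open>l = 0\<close>, so that every coefficient is bounded by a multiple of
  \<open>param_weight\<close>.\<close>

definition G_coef :: "nat \<Rightarrow> nat \<Rightarrow> real \<Rightarrow> real" where
  "G_coef N n l = L_series (l / real (Suc N)) (real n / real (Suc N)) / real (Suc N) - (if n = 0 then 2 / l else 0)"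

lemma G_fun_conv_coef:
  "G_fun N l x - 2 / l = G_coef N 0 l + 2 * (\<Sum>n=1..N. G_coef N n l * cos (2 * pi * real n * x))"
  unfolding G_fun_def G_coef_def by (simp add: add_divide_distrib del: of_nat_Suc flip: sum_divide_distrib)

lemma G_coef_0:
  assumes "l > 0"
  shows "G_coef N 0 l = 1 / real (Suc N) * (1 / sinh (l / (2 * real (Suc N)))) - 2 / l"
  using assms by (simp add: G_coef_def L_series_0 mult.commute del: of_nat_Suc)

lemma G_coef_bound:
  assumes "n \<le> N"
  shows "\<exists>C\<ge>0. \<forall>l>0. \<bar>G_coef N n l\<bar> \<le> C * param_weight l"
proof (cases "n = 0")
  case False
  let ?\<kappa> = "1 / (2 * real (Suc N))"
  obtain C where C: "C \<ge> 0" "\<forall>l>0. \<bar>L_series (2 * ?\<kappa> * l) (real n / real (Suc N))\<bar> \<le> C * param_weight l"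
    using L_series_bound[of "real n / real (Suc N)" ?\<kappa>] False assms by auto
  show ?thesis
  proof (intro exI[of _ C] conjI allI impI C)
    fix l :: real assume l: "l > 0"
    have "\<bar>G_coef N n l\<bar> = \<bar>L_series (2 * ?\<kappa> * l) (real n / real (Suc N))\<bar> / real (Suc N)"
      using False by (simp add: G_coef_def abs_divide del: of_nat_Suc)
    also have "\<dots> \<le> \<bar>L_series (2 * ?\<kappa> * l) (real n / real (Suc N))\<bar> / 1"
      by (intro divide_left_mono) auto
    also have "\<dots> \<le> C * param_weight l" using C(2) l by simp
    finally show "\<bar>G_coef N n l\<bar> \<le> C * param_weight l" .
  qed
next
  case True
  let ?\<kappa> = "1 / (2 * real (Suc N))"
  show ?thesis
  proof (intro exI[of _ "2 * 1 / ?\<kappa>"] conjI allI impI)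
    fix l :: real assume l: "l > 0"
    define a where "a = ?\<kappa> * l"
    have a: "a > 0" using l by (simp add: a_def)
    have "2 / l = 1 / real (Suc N) * (1 / a)" "l / (2 * real (Suc N)) = a" using l by (simp_all add: a_def del: of_nat_Suc)
    then have "\<bar>G_coef N n l\<bar> = \<bar>1 / real (Suc N) * (1 / sinh a - 1 / a)\<bar>"
      unfolding True G_coef_0[OF l] by (simp only: right_diff_distrib)
    also have "\<dots> = 1 / real (Suc N) * (1 / a - 1 / sinh a)"
      using csch_bound(3)[OF a] by (simp add: abs_mult del: of_nat_Suc)
    also have "\<dots> \<le> 1 * (1 / a - 1 / sinh a)"
      using csch_bound(3)[OF a] by (intro mult_right_mono) auto
    also have "\<dots> \<le> 2 * 1 / ?\<kappa> * param_weight l"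
      by (rule min_bound_param_weight[OF _ _ l a_def]) (use csch_bound[OF a] in auto)
    finally show "\<bar>G_coef N n l\<bar> \<le> 2 * 1 / ?\<kappa> * param_weight l" .
  qed simp
qed

lemma cosh_div_sinh_bound:
  fixes \<theta> a :: real
  assumes "0 \<le> \<theta>" "\<theta> < 1" "a \<ge> 1"
  shows "cosh (\<theta> * a) / sinh a \<le> 4 * exp (- ((1 - \<theta>) * a))"
proof -
  have a: "a > 0" using assms by simp
  have e: "exp a * exp a \<ge> 2" "exp a > 0"
  proof -
    have "exp a \<ge> 2" using exp_ge_add_one_self[of a] assms by linarith
    then show "exp a * exp a \<ge> 2" using mult_mono[of 1 "exp a" 2 "exp a"] a by simp
  qed simp
  have "cosh (\<theta> * a) \<le> exp (\<theta> * a)"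
    using assms a by (simp add: cosh_field_def)
  moreover have "sinh a \<ge> exp a / 4"
  proof -
    have "exp (- a) \<le> exp a / 2" using e by (simp add: exp_minus field_simps)
    then show ?thesis by (simp add: sinh_field_def)
  qed
  ultimately have "cosh (\<theta> * a) / sinh a \<le> exp (\<theta> * a) / (exp a / 4)"
    by (intro frac_le) auto
  also have "\<dots> = 4 * (exp (\<theta> * a) * exp (- a))" by (simp add: exp_minus field_simps)
  also have "exp (\<theta> * a) * exp (- a) = exp (- ((1 - \<theta>) * a))" by (simp add: algebra_simps flip: exp_add)
  finally show ?thesis .
qed

lemma K_fun_abs:
  assumes "\<bar>x - 1/2\<bar> \<le> \<theta> / 2" "l > 0"
  shows "K_fun l x \<le> cosh (\<theta> * (l / 2)) / sinh (l / 2)"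
proof -
  have "\<bar>l * (x - 1/2)\<bar> \<le> \<bar>\<theta> * (l / 2)\<bar>"
    using mult_left_mono[OF assms(1), of l] assms by (simp add: abs_mult)
  then have "cosh \<bar>l * (x - 1/2)\<bar> \<le> cosh \<bar>\<theta> * (l / 2)\<bar>"
    by (subst cosh_real_nonneg_le_iff) auto
  moreover have "\<theta> \<ge> 0" using assms(1) by linarith
  moreover have "cosh \<bar>y\<bar> = cosh y" for y :: real by (auto simp: abs_if)
  ultimately have "cosh (l * (x - 1/2)) \<le> cosh (\<theta> * (l / 2))" by (simp only:)
  then show ?thesis unfolding K_fun_def using assms(2) by (intro divide_right_mono) auto
qed

text \<open>Only an upper bound is stated; the lower one will come from \<open>G_fun\<close>. Small
  \<open>l\<close> is handled by comparison with \<open>coth\<close>, large \<open>l\<close> by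
  exponential decay, whose constant degenerates as \<open>x\<close> approaches an integer.\<close>

lemma K_fun_upper:
  assumes "x \<in> {0<..<1}"
  shows "\<exists>C\<ge>0. \<forall>l>0. K_fun l x - 2 / l \<le> C * param_weight l"
proof -
  define \<theta> where "\<theta> = \<bar>2 * x - 1\<bar>"
  have \<theta>: "0 \<le> \<theta>" "\<theta> < 1" using assms by (auto simp: \<theta>_def)
  \<comment> \<open>The 4 is that of \<open>cosh_div_sinh_bound\<close>; the denominator comes from
    \<open>exp (- y) \<le> 1 / y\<close> at \<open>y = (1 - \<theta>) a\<close>.\<close>
  define C where "C = 4 / (1 - \<theta>)"
  have C: "C \<ge> 1" using \<theta> by (simp add: C_def field_simps)
  show ?thesis
  proof (intro exI[of _ "2 * C / (1/2)"] conjI allI impI)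
    fix l :: real assume l: "l > 0"
    define a where "a = 1/2 * l"
    have a: "a > 0" "l / 2 = a" "2 / l = 1 / a" using l by (simp_all add: a_def)
    have s: "sinh a > 0" using a by simp
    have K: "K_fun l x \<le> cosh (\<theta> * a) / sinh a"
    proof -
      have "\<bar>x - 1/2\<bar> \<le> \<theta> / 2" unfolding \<theta>_def by (simp add: abs_if)
      from K_fun_abs[OF this l] show ?thesis unfolding a(2) .
    qed
    have "cosh (\<theta> * a) \<le> cosh a" using \<theta> a by (subst cosh_real_nonneg_le_iff) (auto intro: mult_left_le_one_le)
    then have "cosh (\<theta> * a) / sinh a - 1 / a \<le> cosh a / sinh a - 1 / a" using s by (simp add: divide_right_mono)
    also have "\<dots> = (a * cosh a - sinh a) / (a * sinh a)" using a s by (simp add: field_simps)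
    also have "\<dots> \<le> (a * cosh a - a) / (a * sinh a)"
      using sinh_ge_self[of a] a s by (intro divide_right_mono) auto
    also have "\<dots> = (cosh a - 1) / sinh a" using a s by (simp add: field_simps)
    also have "\<dots> \<le> a * sinh a / sinh a"
      using cosh_le_sinh_mult[of a] a s by (intro divide_right_mono) auto
    finally have 1: "K_fun l x - 2 / l \<le> a" using K s a(3) by simp
    have 2: "K_fun l x - 2 / l \<le> C / a"
    proof (cases "a \<ge> 1")
      case True
      have "(1 - \<theta>) * a \<le> exp ((1 - \<theta>) * a)" using exp_ge_add_one_self[of "(1 - \<theta>) * a"] by linarith
      moreover have "exp (- z) \<le> 1 / z" if "z > 0" "z \<le> exp z" for z :: real
        using that by (simp add: exp_minus field_simps)
      ultimately have "exp (- ((1 - \<theta>) * a)) \<le> 1 / ((1 - \<theta>) * a)"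
        using \<theta> a by simp
      then have "4 * exp (- ((1 - \<theta>) * a)) \<le> C / a" using \<theta> a by (simp add: C_def field_simps)
      with cosh_div_sinh_bound[OF \<theta> True] K a(1,3) show ?thesis
        by (smt (verit) divide_pos_pos)
    next
      case False
      then have "a \<le> 1 / a" using a(1) mult_mono[of a 1 a 1] by (simp add: field_simps)
      also have "\<dots> \<le> C / a" using C a by (intro divide_right_mono) auto
      finally show ?thesis using 1 by linarith
    qed
    have "a \<le> C * a" using C a by simp
    with 1 have 3: "K_fun l x - 2 / l \<le> C * a" by linarith
    show "K_fun l x - 2 / l \<le> 2 * C / (1/2) * param_weight l"
      by (rule min_bound_param_weight[OF _ _ l a_def]) (use C 2 3 in auto)
  qed (use C in simp)
qed

text \<open>The bound is uniform in \<open>x\<close> on a compact part of the open interval, because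
  it will be used at the unknown intermediate point of Taylor's formula, which varies with
  \<open>l\<close>.\<close>

lemma K_deriv2_bound:
  assumes "0 \<le> \<theta>" "\<theta> < 1"
  shows "\<exists>C\<ge>0. \<forall>l>0. \<forall>x. \<bar>x - 1/2\<bar> \<le> \<theta> / 2 \<longrightarrow> \<bar>l\<^sup>2 * K_fun l x\<bar> \<le> C * param_weight l"
proof -
  \<comment> \<open>432 is 4 * 4 * 27: \<open>l^2 = 4 a^2\<close>, the factor 4 of
    \<open>cosh_div_sinh_bound\<close>, and \<open>exp (- y) \<le> 27 / y^3\<close>. The cube is
    what leaves \<open>1 / a\<close> after multiplication by \<open>a^2\<close>.\<close>
  define C where "C = 432 / (1 - \<theta>) ^ 3"
  have C: "C \<ge> 432" using assms by (simp add: C_def field_simps power_le_one)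
  show ?thesis
  proof (intro exI[of _ "2 * C / (1/2)"] conjI allI impI)
    fix l x :: real assume l: "l > 0" and x: "\<bar>x - 1/2\<bar> \<le> \<theta> / 2"
    define a where "a = 1/2 * l"
    have a: "a > 0" "l / 2 = a" "l = 2 * a" using l by (simp_all add: a_def)
    have s: "sinh a > 0" using a by simp
    have K: "K_fun l x \<le> cosh (\<theta> * a) / sinh a"
      using K_fun_abs[OF x l] unfolding a(2) .
    have Kpos: "K_fun l x \<ge> 0" using K_fun_pos[OF l, of x] by simp
    have "cosh (\<theta> * a) \<le> cosh a" using assms a by (subst cosh_real_nonneg_le_iff) (auto intro: mult_left_le_one_le)
    have y: "l\<^sup>2 * K_fun l x \<le> C * min a (1 / a)"
    proof (cases "a \<ge> 1")
      case True
      let ?y = "(1 - \<theta>) * a"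
      have yp: "?y > 0" using assms a by simp
      have "?y / 3 \<le> exp (?y / 3)" using exp_ge_add_one_self[of "?y / 3"] by linarith
      then have "(?y / 3) ^ 3 \<le> exp (?y / 3) ^ 3" using yp by (intro power_mono) auto
      also have "\<dots> = exp ?y" by (simp flip: exp_of_nat_mult)
      finally have y3: "?y ^ 3 / 27 \<le> exp ?y" by (simp add: power_divide)
      have "exp (- z) \<le> 27 / z ^ 3" if "z > 0" "z ^ 3 / 27 \<le> exp z" for z :: real
        using that by (simp add: exp_minus field_simps)
      from this[OF yp y3] have "exp (- ?y) \<le> 27 / ?y ^ 3" .
      with cosh_div_sinh_bound[OF assms True] K have "K_fun l x \<le> 108 / ?y ^ 3" by linarith
      then have "l\<^sup>2 * K_fun l x \<le> l\<^sup>2 * (108 / ?y ^ 3)" by (intro mult_left_mono) auto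
      also have "\<dots> = C / a" using a assms by (simp add: a(3) C_def power_mult_distrib power2_eq_square power3_eq_cube)
      also have "\<dots> = C * min a (1 / a)" using True a(1) mult_mono[of 1 a 1 a] by (simp add: min_def field_simps)
      finally show ?thesis .
    next
      case False
      have "cosh a \<le> 2"
      proof -
        have "cosh a \<le> cosh 1" using False a by (subst cosh_real_nonneg_le_iff) auto
        also have "cosh (1::real) \<le> 2"
        proof -
          have "(exp 1 + exp (- 1)) / 2 \<le> (3 + 1) / (2::real)"
            by (intro divide_right_mono add_mono exp_le) auto
          then show ?thesis unfolding cosh_field_def by simp
        qed
        finally show ?thesis .
      qed
      with K \<open>cosh (\<theta> * a) \<le> cosh a\<close> have "K_fun l x \<le> 2 / sinh a"
        using s by (smt (verit) divide_right_mono)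
      also have "\<dots> \<le> 2 / a" using sinh_ge_self[of a] a by (intro divide_left_mono) auto
      finally have "l\<^sup>2 * K_fun l x \<le> l\<^sup>2 * (2 / a)" by (intro mult_left_mono) auto
      also have "\<dots> = 8 * a" using a by (simp add: a(3) power2_eq_square)
      also have "\<dots> \<le> C * a" using C a by (intro mult_right_mono) auto
      also have "a = min a (1 / a)" using False a(1) mult_mono[of a 1 a 1] by (simp add: min_def field_simps)
      finally show ?thesis by simp
    qed
    have m: "min a (1 / a) \<le> a" "min a (1 / a) \<le> 1 / a" by simp_all
    have 1: "\<bar>l\<^sup>2 * K_fun l x\<bar> \<le> C * a" and 2: "\<bar>l\<^sup>2 * K_fun l x\<bar> \<le> C / a"
    proof -
      have "\<bar>l\<^sup>2 * K_fun l x\<bar> = l\<^sup>2 * K_fun l x" using Kpos by (intro abs_of_nonneg) auto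
      moreover have "C * min a (1 / a) \<le> C * a" "C * min a (1 / a) \<le> C * (1 / a)"
        using C by (intro mult_left_mono m; simp)+
      ultimately show "\<bar>l\<^sup>2 * K_fun l x\<bar> \<le> C * a" "\<bar>l\<^sup>2 * K_fun l x\<bar> \<le> C / a"
        using y by simp_all
    qed
    show "\<bar>l\<^sup>2 * K_fun l x\<bar> \<le> 2 * C / (1/2) * param_weight l"
      by (rule min_bound_param_weight[OF _ _ l a_def]) (use C 1 2 in auto)
  qed (use C in simp)
qed

section \<open>Integration over the spectral parameter\<close>

lemma L_series_minus: "L_series \<nu> (- t) = L_series \<nu> t"
  unfolding L_series_def L_coef_def by simp

text \<open>Continuity is read off from the closed form; it supplies measurability on the
  half-line.\<close>

lemma G_coef_continuous: "n \<le> N \<Longrightarrow> continuous_on {0<..} (G_coef N n)"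
proof -
  assume n: "n \<le> N"
  let ?M = "real (Suc N)" let ?t = "real n / real (Suc N)"
  have t: "\<bar>?t\<bar> \<le> 1" using n by simp
  let ?g = "\<lambda>l. ((1 - \<bar>?t\<bar>) * sinh (l / ?M / 2) * cos (pi * ?t) + (l / ?M / 2) / pi * cosh (l / ?M / 2) * sin (pi * \<bar>?t\<bar>)) /
     ((sinh (l / ?M / 2))\<^sup>2 + (sin (pi * ?t))\<^sup>2) / ?M - (if n = 0 then 2 / l else 0)"
  have "(sinh (l / ?M / 2))\<^sup>2 + (sin (pi * ?t))\<^sup>2 \<noteq> 0" if "l > 0" for l
  proof -
    have "sinh (l / ?M / 2) > 0" using that by (simp del: of_nat_Suc)
    then have "(sinh (l / ?M / 2))\<^sup>2 > 0" by (rule zero_less_power)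
    then show ?thesis using zero_le_power2[of "sin (pi * ?t)"] by linarith
  qed
  then have "continuous_on {0<..} ?g"
    by (cases "n = 0") (auto intro!: continuous_intros simp del: of_nat_Suc)
  moreover have "?g l = G_coef N n l" if "l \<in> {0<..}" for l
    unfolding G_coef_def using that by (subst L_series_closed[OF _ t]) (auto simp del: of_nat_Suc)
  ultimately show ?thesis by (rule continuous_on_eq)
qed

text \<open>The indices \<open>m \<ge> 0\<close> and \<open>m \<le> - 1\<close> give two geometric
  series of ratio \<open>exp (- l)\<close>.\<close>

lemma p_fun_K_fun:
  assumes l: "l > 0" and x: "0 \<le> x" "x < 1"
  shows "p_fun l x = K_fun l x - 2 / l"
proof -
  let ?f = "\<lambda>m::int. exp (- l * \<bar>x + of_int m\<bar>)"
  have f1: "?f (int k) = exp (- l * x) * exp (- l) ^ k" for k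
    using x by (simp add: exp_of_nat_mult[symmetric] exp_add[symmetric] algebra_simps)
  have f2: "?f (- int k - 1) = exp (- l * (1 - x)) * exp (- l) ^ k" for k
  proof -
    have "\<bar>x + of_int (- int k - 1)\<bar> = real k + (1 - x)" using x by simp
    then show ?thesis by (simp add: exp_of_nat_mult[symmetric] exp_add[symmetric] algebra_simps)
  qed
  have g: "(\<lambda>k. c * exp (- l) ^ k) sums (c * (1 / (1 - exp (- l))))" for c
    using l by (intro sums_mult geometric_sums) simp
  have "(\<Sum>\<^sub>\<infinity>m. ?f m) = (\<Sum>k. ?f (int k) + ?f (- int k - 1))"
  proof (rule infsum_int)
    show "summable (\<lambda>k. norm (?f (int k)))" "summable (\<lambda>k. norm (?f (- int k - 1)))"
      unfolding real_norm_def abs_exp_cancel unfolding f1 f2 by (rule sums_summable[OF g])+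
  qed
  also have "\<dots> = exp (- l * x) * (1 / (1 - exp (- l))) + exp (- l * (1 - x)) * (1 / (1 - exp (- l)))"
    unfolding f1 f2 by (rule sums_unique[symmetric]) (intro sums_add g)
  also have "\<dots> = K_fun l x" unfolding K_exp(1)[OF l] by (simp add: add_divide_distrib)
  finally show ?thesis by (simp add: p_fun_def)
qed

lemma p_fun_frac: "p_fun l (frac x) = p_fun l x"
proof -
  have "(\<Sum>\<^sub>\<infinity>m::int. exp (- l * \<bar>x + of_int m\<bar>)) = (\<Sum>\<^sub>\<infinity>m::int. exp (- l * \<bar>x + of_int (m - \<lfloor>x\<rfloor>)\<bar>))"
    by (rule infsum_reindex_bij_betw[symmetric, of "\<lambda>m. m - \<lfloor>x\<rfloor>" UNIV UNIV "\<lambda>m. exp (- l * \<bar>x + of_int m\<bar>)"])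
       (rule bij_betw_byWitness[of _ "\<lambda>m. m + \<lfloor>x\<rfloor>"]; auto)
  then show ?thesis by (simp add: p_fun_def frac_def algebra_simps)
qed

lemma q_mu_frac: "q_mu \<mu> (frac x) = q_mu \<mu> x"
proof -
  have "frac x \<in> \<int> \<longleftrightarrow> x \<in> \<int>"
    by (metis Ints_cases Ints_diff Ints_of_int frac_def frac_eq_0_iff frac_of_int frac_frac)
  then show ?thesis by (simp add: q_mu_def p_fun_frac)
qed

lemma unit_exp_frac: "unit_exp (of_int n * frac x) = unit_exp (of_int n * x)"
proof -
  have "unit_exp (of_int n * x) = unit_exp (of_int n * frac x + of_int (n * \<lfloor>x\<rfloor>))"
    by (simp add: frac_def algebra_simps)
  then show ?thesis by (simp only: unit_exp_add unit_exp_of_int mult_1_right)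
qed

lemma g_mu_frac: "g_mu \<mu> N (frac x) = g_mu \<mu> N x"
  by (simp only: g_mu_def unit_exp_frac)

section \<open>Integration against a fixed measure: minorant property and extremality\<close>

context
  fixes \<mu> :: "real measure" and N :: nat
  assumes sets_\<mu>: "sets \<mu> = sets (restrict_space borel {0<..})"
    and fin: "(\<integral>\<^sup>+ l. ennreal (l / (l\<^sup>2 + 1)) \<partial>\<mu>) < \<infinity>"
begin

lemma space_\<mu>: "space \<mu> = {0<..}"
  using sets_eq_imp_space_eq[OF sets_\<mu>] by (simp add: space_restrict_space)

lemma measurable_\<mu>: "continuous_on {0<..} f \<Longrightarrow> f \<in> borel_measurable \<mu>" for f :: "real \<Rightarrow> real"
  by (subst measurable_cong_sets[OF sets_\<mu> refl]) (rule borel_measurable_continuous_on_restrict)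

lemma integrable_param_weight: "integrable \<mu> param_weight"
proof (rule integrableI_nonneg)
  have "l\<^sup>2 + 1 \<noteq> 0" for l :: real by (metis add_nonneg_pos less_irrefl zero_le_power2 zero_less_one)
  then show "param_weight \<in> borel_measurable \<mu>"
    unfolding param_weight_def by (intro measurable_\<mu> continuous_intros) auto
  show "AE l in \<mu>. 0 \<le> param_weight l" by (rule AE_I2) (auto simp: space_\<mu> param_weight_def)
  show "(\<integral>\<^sup>+ l. ennreal (param_weight l) \<partial>\<mu>) < \<infinity>" using fin by (simp add: param_weight_def)
qed

lemma integrable_param_weight_bound:
  fixes f :: "real \<Rightarrow> real"
  assumes "continuous_on {0<..} f" "\<And>l. l > 0 \<Longrightarrow> \<bar>f l\<bar> \<le> C * param_weight l"
  shows "integrable \<mu> f"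
proof (rule Bochner_Integration.integrable_bound[OF integrable_mult_right[OF integrable_param_weight]])
  show "f \<in> borel_measurable \<mu>" by (rule measurable_\<mu>[OF assms(1)])
  show "AE l in \<mu>. norm (f l) \<le> norm (C * param_weight l)"
    by (rule AE_I2) (use assms(2) in \<open>force simp: space_\<mu>\<close>)
qed

lemma integrable_G_coef:
  assumes "n \<le> N" shows "integrable \<mu> (G_coef N n)"
proof -
  obtain C where "\<forall>l>0. \<bar>G_coef N n l\<bar> \<le> C * param_weight l" using G_coef_bound[OF assms] by blast
  then show ?thesis by (intro integrable_param_weight_bound[OF G_coef_continuous[OF assms]]) blast
qed

text \<open>\<open>g_mu\<close> as a superposition of the one-parameter minorants, in which form the
  pointwise inequality can be integrated; \<open>g_mu_eq\<close> identifies the two.\<close>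

definition g_real :: "real \<Rightarrow> real" where
  "g_real x = (LINT l|\<mu>. G_fun N l x - 2 / l)"

lemma integrable_G: "integrable \<mu> (\<lambda>l. G_fun N l x - 2 / l)"
  unfolding G_fun_conv_coef by (intro Bochner_Integration.integrable_add integrable_mult_right Bochner_Integration.integrable_sum integrable_mult_left integrable_G_coef) auto

lemma g_real_eq: "g_real x = (LINT l|\<mu>. G_coef N 0 l) + 2 * (\<Sum>n=1..N. (LINT l|\<mu>. G_coef N n l) * cos (2 * pi * real n * x))"
proof -
  have i: "integrable \<mu> (\<lambda>l. G_coef N n l * cos (2 * pi * real n * x))" if "n \<in> {1..N}" for n
    using that by (intro integrable_mult_left integrable_G_coef) auto
  show ?thesis
    unfolding g_real_def G_fun_conv_coef using i
    by (subst Bochner_Integration.integral_add)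
       (auto intro!: integrable_G_coef Bochner_Integration.integrable_sum simp: Bochner_Integration.integral_sum)
qed

lemma g_hat_eq:
  assumes "\<bar>n\<bar> \<le> int N"
  shows "g_hat \<mu> N n = of_real (LINT l|\<mu>. G_coef N (nat \<bar>n\<bar>) l)"
proof (cases "n = 0")
  case True
  have "(LINT l|\<mu>. G_coef N 0 l) = (LINT l|\<mu>. - (2 / l - 1 / (real N + 1) * csch (l / (2 * real N + 2))))"
    by (rule Bochner_Integration.integral_cong) (auto simp: space_\<mu> G_coef_0 csch_def algebra_simps)
  also have "\<dots> = - (LINT l|\<mu>. 2 / l - 1 / (real N + 1) * csch (l / (2 * real N + 2)))"
    by (rule Bochner_Integration.integral_minus)
  finally show ?thesis using True by (simp only: g_hat_def abs_zero nat_0 refl if_True)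
next
  case False
  let ?M = "real (Suc N)"
  have "L_hat (l / (real N + 1)) (of_int n / (real N + 1)) = of_real (?M * G_coef N (nat \<bar>n\<bar>) l)" if "l \<in> space \<mu>" for l
  proof -
    have l: "l > 0" using that by (simp add: space_\<mu>)
    \<comment> \<open>The frequencies are strictly inside the band on which \<open>L_hat_eq\<close>
      holds.\<close>
    have n1: "\<bar>of_int n / ?M\<bar> < 1" using assms by (simp add: abs_divide)
    have "L_series \<nu> (of_int n / ?M) = L_series \<nu> (real (nat \<bar>n\<bar>) / ?M)" for \<nu>
      using L_series_minus[of \<nu> "of_int n / ?M"] by (cases "n \<ge> 0") auto
    moreover have "L_hat (l / ?M) (of_int n / ?M) = of_real (L_series (l / ?M) (of_int n / ?M))"
      using l n1 by (intro L_hat_eq) auto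
    ultimately show ?thesis using False by (simp add: G_coef_def add.commute)
  qed
  then have "(LINT l|\<mu>. L_hat (l / (real N + 1)) (of_int n / (real N + 1))) = (LINT l|\<mu>. of_real (?M * G_coef N (nat \<bar>n\<bar>) l))"
    by (intro Bochner_Integration.integral_cong) auto
  also have "\<dots> = of_real (?M * (LINT l|\<mu>. G_coef N (nat \<bar>n\<bar>) l))"
    unfolding integral_complex_of_real by simp
  finally have "(LINT l|\<mu>. L_hat (l / (real N + 1)) (of_int n / (real N + 1))) =
      of_real (?M * (LINT l|\<mu>. G_coef N (nat \<bar>n\<bar>) l))" .
  moreover have "1 + complex_of_nat N \<noteq> 0"
    using of_nat_neq_0[of N] by (simp only: of_nat_Suc)
  ultimately show ?thesis using False by (simp add: g_hat_def add.commute)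
qed

lemma g_mu_eq: "g_mu \<mu> N x = of_real (g_real x)"
proof -
  have "g_mu \<mu> N x = (\<Sum>n = - int N..int N. complex_of_real (LINT l|\<mu>. G_coef N (nat \<bar>n\<bar>) l) * unit_exp (of_int n * x))"
    unfolding g_mu_def by (intro sum.cong) (auto simp: g_hat_eq)
  then show ?thesis
    by (simp only: sum_cos_conv_unit_exp[where a = "\<lambda>n. LINT l|\<mu>. G_coef N n l"] g_real_eq)
qed

lemma trig_coeffs_g_real: "trig_coeffs N (g_hat \<mu> N) g_real"
  unfolding trig_coeffs_def g_mu_eq[symmetric] g_mu_def by (simp only: simp_thms)

lemma K_fun_continuous: "continuous_on {0<..} (\<lambda>l. K_fun l x - 2 / l)"
  unfolding K_fun_def by (intro continuous_intros) auto

text \<open>The integrand is squeezed between the integrable \<open>G_fun N l x - 2 / l\<close> and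
  a multiple of \<open>param_weight\<close>.\<close>

lemma integrable_K:
  assumes "x \<in> {0<..<1}"
  shows "integrable \<mu> (\<lambda>l. K_fun l x - 2 / l)"
proof -
  obtain C where C: "C \<ge> 0" "\<forall>l>0. K_fun l x - 2 / l \<le> C * param_weight l"
    using K_fun_upper[OF assms] by blast
  have "integrable \<mu> (\<lambda>l. \<bar>G_fun N l x - 2 / l\<bar> + C * param_weight l)"
    by (intro Bochner_Integration.integrable_add integrable_abs integrable_G integrable_mult_right integrable_param_weight)
  then show ?thesis
  proof (rule Bochner_Integration.integrable_bound)
    show "(\<lambda>l. K_fun l x - 2 / l) \<in> borel_measurable \<mu>"
      by (rule measurable_\<mu>[OF K_fun_continuous])
    have "\<bar>K_fun l x - 2 / l\<bar> \<le> \<bar>\<bar>G_fun N l x - 2 / l\<bar> + C * param_weight l\<bar>" if "l > 0" for l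
    proof -
      have "G_fun N l x \<le> K_fun l x" using G_le_K[OF that] assms by auto
      moreover have "K_fun l x - 2 / l \<le> C * param_weight l" using C that by blast
      moreover have "C * param_weight l \<ge> 0" using C that by (simp add: param_weight_def)
      ultimately show ?thesis by linarith
    qed
    then show "AE l in \<mu>. norm (K_fun l x - 2 / l) \<le> norm (\<bar>G_fun N l x - 2 / l\<bar> + C * param_weight l)"
      by (intro AE_I2) (simp add: space_\<mu>)
  qed
qed

lemma q_mu_open:
  assumes "x \<in> {0<..<1}"
  shows "q_mu \<mu> x = ereal (LINT l|\<mu>. K_fun l x - 2 / l)"
proof -
  have "x \<notin> \<int>"
  proof
    assume "x \<in> \<int>"
    then have "frac x = 0" by simp
    with assms show False by (simp add: frac_eq)
  qed
  moreover have "(LINT l|\<mu>. p_fun l x) = (LINT l|\<mu>. K_fun l x - 2 / l)"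
    using assms by (intro Bochner_Integration.integral_cong) (auto simp: space_\<mu> p_fun_K_fun)
  ultimately show ?thesis by (simp add: q_mu_def)
qed

lemma g_real_le_q_mu: "ereal (g_real x) \<le> q_mu \<mu> x"
proof -
  have "ereal (g_real y) \<le> q_mu \<mu> y" if y: "y = frac x" for y
  proof (cases "y = 0")
    case False
    with y have y01: "y \<in> {0<..<1}" using frac_ge_0[of x] frac_lt_1[of x] by (auto simp: less_le)
    show ?thesis
      unfolding q_mu_open[OF y01] g_real_def ereal_less_eq
      using G_le_K y01 by (intro integral_mono integrable_G integrable_K) (auto simp: space_\<mu>)
  next
    case True
    let ?h = "\<lambda>l. coth (l / 2) - 2 / l"
    have K0: "K_fun l 0 = coth (l / 2)" for l by (simp add: K_fun_def coth_def)
    have le: "G_fun N l 0 - 2 / l \<le> ?h l" if "l > 0" for l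
      using G_le_K[OF that, of 0 N] by (simp add: K0)
    show ?thesis
    proof (cases "(\<integral>\<^sup>+ l. ennreal (?h l) \<partial>\<mu>) = \<infinity>")
      case True
      then show ?thesis using \<open>y = 0\<close> by (simp add: q_mu_def)
    next
      case False
      have h: "(\<lambda>l. max 0 (?h l)) \<in> borel_measurable \<mu>"
        using measurable_\<mu>[OF K_fun_continuous[of 0]] by (simp add: K0)
      \<comment> \<open>\<open>ennreal\<close> clips negative values, so the integral defining
        \<open>q_mu\<close> is that of the positive part, with which the minorant can be compared
        directly. If it is infinite, the inequality is trivial.\<close>
      have e: "ennreal (max 0 (?h l)) = ennreal (?h l)" for l by (simp add: max_def ennreal_neg)
      have int: "integrable \<mu> (\<lambda>l. max 0 (?h l))"
        using h False by (intro integrableI_nonneg) (auto simp: e less_top)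
      have "G_fun N l 0 - 2 / l \<le> max 0 (?h l)" if "l > 0" for l
        using le[OF that] by linarith
      then have "g_real 0 \<le> (LINT l|\<mu>. max 0 (?h l))"
        unfolding g_real_def by (intro integral_mono integrable_G int) (simp_all add: space_\<mu>)
      moreover have "(\<integral>\<^sup>+ l. ennreal (?h l) \<partial>\<mu>) = ennreal (LINT l|\<mu>. max 0 (?h l))"
        using nn_integral_eq_integral[OF int] by (simp add: e)
      moreover have "(LINT l|\<mu>. max 0 (?h l)) \<ge> 0" by (intro integral_nonneg_AE) auto
      ultimately show ?thesis using \<open>y = 0\<close> by (simp add: q_mu_def enn2ereal_ennreal)
    qed
  qed
  from this[OF refl] have "ereal (g_real (frac x)) \<le> q_mu \<mu> x" by (simp only: q_mu_frac)
  moreover have "g_real (frac x) = g_real x"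
    using g_mu_frac[of \<mu> N x] by (simp only: g_mu_eq of_real_eq_iff)
  ultimately show ?thesis by simp
qed

lemma g_real_node:
  assumes "x \<in> nodes N"
  shows "q_mu \<mu> x = ereal (g_real x)"
proof -
  have "x \<in> {0<..<1}" using assms nodes(3) by blast
  moreover have "(LINT l|\<mu>. K_fun l x - 2 / l) = (LINT l|\<mu>. G_fun N l x - 2 / l)"
    using interpolation_at_nodes(1)[OF _ assms] by (intro Bochner_Integration.integral_cong) (auto simp: space_\<mu>)
  ultimately show ?thesis by (simp add: q_mu_open g_real_def)
qed

text \<open>Takes the place of tangency between \<open>q_mu\<close> and its minorant. For each
  \<open>l\<close> the error at a node has vanishing value and slope; its second derivative is
  bounded by a multiple of \<open>param_weight l\<close> uniformly near the node, so the Taylor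
  estimate can be integrated.\<close>

lemma quadratic_contact:
  assumes \<xi>: "\<xi> \<in> nodes N"
  shows "\<exists>C d. d > 0 \<and> (\<forall>y. \<bar>y - \<xi>\<bar> < d \<longrightarrow> q_mu \<mu> y \<le> ereal (g_real y + C * (y - \<xi>)\<^sup>2))"
proof -
  \<comment> \<open>Half the distance to the integers: points within \<open>d\<close> of the node
    stay between \<open>d\<close> and \<open>1 - d\<close>, which is the range \<bar>x - 1/2\<bar>
    \<le> \<theta> / 2 for \<open>\<theta> = 1 - 2 d\<close>.\<close>
  define d where "d = min \<xi> (1 - \<xi>) / 2"
  have \<xi>01: "\<xi> \<in> {0<..<1}" using \<xi> nodes(3) by blast
  then have d: "d > 0" "d \<le> \<xi> / 2" "d \<le> (1 - \<xi>) / 2" by (auto simp: d_def)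
  define \<theta> where "\<theta> = 1 - 2 * d"
  have \<theta>: "0 \<le> \<theta>" "\<theta> < 1" using d \<xi>01 by (auto simp: \<theta>_def)
  obtain C1 where C1: "C1 \<ge> 0" "\<forall>l>0. \<forall>x. \<bar>x - 1/2\<bar> \<le> \<theta> / 2 \<longrightarrow> \<bar>l\<^sup>2 * K_fun l x\<bar> \<le> C1 * param_weight l"
    using K_deriv2_bound[OF \<theta>] by blast
  have "\<forall>n\<in>{1..N}. \<exists>C\<ge>0. \<forall>l>0. \<bar>G_coef N n l\<bar> \<le> C * param_weight l" using G_coef_bound by auto
  then obtain B where B: "\<And>n l. n \<in> {1..N} \<Longrightarrow> l > 0 \<Longrightarrow> \<bar>G_coef N n l\<bar> \<le> B n * param_weight l"
    by (metis (no_types, lifting))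
  define C2 where "C2 = 2 * (\<Sum>n=1..N. B n * (2 * pi * real n)\<^sup>2)"
  have G2: "\<bar>G_deriv2 N l x\<bar> \<le> C2 * param_weight l" if l: "l > 0" for l x
  proof -
    \<comment> \<open>Only frequencies \<open>n \<ge> 1\<close> survive differentiation, and for
      these \<open>G_coef\<close> carries no subtraction.\<close>
    have eq: "G_deriv2 N l x = 2 * (\<Sum>n=1..N. G_coef N n l * (- (2 * pi * real n)\<^sup>2 * cos (2 * pi * real n * x)))"
      unfolding G_deriv2_def times_divide_eq_right[symmetric] sum_divide_distrib
      by (intro arg_cong[where f = "(*) 2"] sum.cong) (auto simp: G_coef_def)
    have "\<bar>G_deriv2 N l x\<bar> = 2 * \<bar>\<Sum>n=1..N. G_coef N n l * (- (2 * pi * real n)\<^sup>2 * cos (2 * pi * real n * x))\<bar>"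
      unfolding eq abs_mult[of 2] by (simp only: abs_numeral)
    also have "\<dots> \<le> 2 * (\<Sum>n=1..N. \<bar>G_coef N n l * (- (2 * pi * real n)\<^sup>2 * cos (2 * pi * real n * x))\<bar>)"
      by (rule mult_left_mono[OF sum_abs]) simp
    also have "\<dots> \<le> 2 * (\<Sum>n=1..N. B n * (2 * pi * real n)\<^sup>2 * param_weight l)"
    proof (rule mult_left_mono[OF sum_mono])
      fix n assume n: "n \<in> {1..N}"
      have "\<bar>G_coef N n l * (- (2 * pi * real n)\<^sup>2 * cos (2 * pi * real n * x))\<bar> =
          \<bar>G_coef N n l\<bar> * ((2 * pi * real n)\<^sup>2 * \<bar>cos (2 * pi * real n * x)\<bar>)"
      proof -
        have "\<bar>a * (- b\<^sup>2 * c)\<bar> = \<bar>a\<bar> * (b\<^sup>2 * \<bar>c\<bar>)" for a b c :: real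
          unfolding abs_mult abs_minus_cancel abs_power2 ..
        then show ?thesis .
      qed
      also have "\<dots> \<le> (B n * param_weight l) * ((2 * pi * real n)\<^sup>2 * 1)"
        by (rule mult_mono[OF B[OF n l] mult_left_mono[OF abs_cos_le_one zero_le_power2]
              order_trans[OF abs_ge_zero B[OF n l]] mult_nonneg_nonneg[OF zero_le_power2 abs_ge_zero]])
      finally show "\<bar>G_coef N n l * (- (2 * pi * real n)\<^sup>2 * cos (2 * pi * real n * x))\<bar> \<le> B n * (2 * pi * real n)\<^sup>2 * param_weight l"
        by (simp add: mult_ac)
    qed simp
    also have "\<dots> = C2 * param_weight l" by (simp only: C2_def sum_distrib_right mult.assoc)
    finally show ?thesis .
  qed
  define C where "C = (C1 + C2) / 2 * (LINT l|\<mu>. param_weight l)"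
  have "q_mu \<mu> y \<le> ereal (g_real y + C * (y - \<xi>)\<^sup>2)" if y: "\<bar>y - \<xi>\<bar> < d" for y
  proof -
    have y01: "y \<in> {0<..<1}" using y d \<xi>01 by auto
    have pt: "K_fun l y - 2 / l \<le> (G_fun N l y - 2 / l) + param_weight l * ((C1 + C2) / 2 * (y - \<xi>)\<^sup>2)" if l: "l > 0" for l
    proof -
      have d1: "((\<lambda>x. K_fun l x - G_fun N l x) has_real_derivative K_deriv l x - G_deriv N l x) (at x)"
        and d2: "((\<lambda>x. K_deriv l x - G_deriv N l x) has_real_derivative l\<^sup>2 * K_fun l x - G_deriv2 N l x) (at x)" for x
        by (rule DERIV_diff[OF K_fun_deriv G_fun_deriv], rule DERIV_diff[OF K_deriv_deriv G_deriv_deriv])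
      from taylor2[OF d1 d2, of \<xi> y] interpolation_at_nodes[OF l \<xi>] obtain t where
        t: "\<bar>t - \<xi>\<bar> \<le> \<bar>y - \<xi>\<bar>" "K_fun l y - G_fun N l y = (l\<^sup>2 * K_fun l t - G_deriv2 N l t) / 2 * (y - \<xi>)\<^sup>2"
        by auto
      have "\<bar>t - \<xi>\<bar> < d" using t(1) y by linarith
      then have "d < t" "t < 1 - d" using d by (simp_all add: abs_less_iff)
      then have "\<bar>t - 1/2\<bar> \<le> \<theta> / 2" unfolding \<theta>_def by (intro abs_leI) (simp_all add: field_simps)
      then have "\<bar>l\<^sup>2 * K_fun l t\<bar> \<le> C1 * param_weight l" using C1 l by blast
      with G2[OF l, of t] have "l\<^sup>2 * K_fun l t - G_deriv2 N l t \<le> (C1 + C2) * param_weight l"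
        by (simp add: distrib_right abs_le_iff)
      then have "K_fun l y - G_fun N l y \<le> ((C1 + C2) * param_weight l) / 2 * (y - \<xi>)\<^sup>2"
        unfolding t(2) by (intro mult_right_mono divide_right_mono) auto
      then show ?thesis by (simp add: mult_ac)
    qed
    have "(LINT l|\<mu>. K_fun l y - 2 / l) \<le> (LINT l|\<mu>. (G_fun N l y - 2 / l) + param_weight l * ((C1 + C2) / 2 * (y - \<xi>)\<^sup>2))"
      using pt by (intro integral_mono integrable_K y01 Bochner_Integration.integrable_add integrable_G integrable_mult_left integrable_param_weight)
        (auto simp: space_\<mu>)
    also have "\<dots> = g_real y + C * (y - \<xi>)\<^sup>2"
      unfolding g_real_def C_def
      by (subst Bochner_Integration.integral_add[OF integrable_G integrable_mult_left[OF integrable_param_weight]]) (simp add: mult_ac)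
    finally show ?thesis by (simp add: q_mu_open[OF y01])
  qed
  with d(1) show ?thesis by blast
qed

text \<open>At the nodes the competitor lies below \<open>q_mu\<close>, which equals
  \<open>g_real\<close> there, and the quadrature rule turns this into an inequality of means.
  Equality of the means forces equality at every node, and then also equality of slopes.\<close>

lemma extremal:
  assumes c: "trig_coeffs N c f" and le: "\<And>x. ereal (f x) \<le> q_mu \<mu> x"
  shows "(LINT x:{0..<1}|lborel. f x) \<le> (LINT x:{0..<1}|lborel. g_real x)"
    and "(LINT x:{0..<1}|lborel. f x) = (LINT x:{0..<1}|lborel. g_real x) \<Longrightarrow> f x = g_real x"
proof -
  have node: "f x \<le> g_real x" if "x \<in> nodes N" for x
    using le[of x] g_real_node[OF that] by simp
  have sums: "real (Suc N) * (LINT x:{0..<1}|lborel. f x) = (\<Sum>x\<in>nodes N. f x)"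
    "real (Suc N) * (LINT x:{0..<1}|lborel. g_real x) = (\<Sum>x\<in>nodes N. g_real x)"
    using trig_coeffs_sum_nodes[OF c] trig_coeffs_LINT(2)[OF c]
      trig_coeffs_sum_nodes[OF trig_coeffs_g_real] trig_coeffs_LINT(2)[OF trig_coeffs_g_real] by simp_all
  have "(\<Sum>x\<in>nodes N. f x) \<le> (\<Sum>x\<in>nodes N. g_real x)" by (intro sum_mono node)
  then show "(LINT x:{0..<1}|lborel. f x) \<le> (LINT x:{0..<1}|lborel. g_real x)"
    unfolding sums[symmetric] by (simp del: of_nat_Suc)
  assume "(LINT x:{0..<1}|lborel. f x) = (LINT x:{0..<1}|lborel. g_real x)"
  then have "(\<Sum>x\<in>nodes N. f x) = (\<Sum>x\<in>nodes N. g_real x)" by (simp only: sums[symmetric])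
  then have eq: "f x = g_real x" if "x \<in> nodes N" for x
    by (rule sum_mono_inv[OF _ node that nodes(1)])
  obtain f' g' where f': "\<And>x. (f has_real_derivative f' x) (at x)" and g': "\<And>x. (g_real has_real_derivative g' x) (at x)"
    using real_trig_poly_deriv[of f] real_trig_poly_deriv[of g_real] c trig_coeffs_g_real unfolding trig_coeffs_def by metis
  have h': "((\<lambda>x. f x - g_real x) has_real_derivative f' x - g' x) (at x)" for x
    by (intro DERIV_diff f' g')
  have h'0: "f' x - g' x = 0" if x: "x \<in> nodes N" for x
  proof -
    obtain C d where d: "d > 0" "\<forall>y. \<bar>y - x\<bar> < d \<longrightarrow> q_mu \<mu> y \<le> ereal (g_real y + C * (y - x)\<^sup>2)"
      using quadratic_contact[OF x] by blast
    \<comment> \<open>By the quadratic contact \<open>x\<close> is a local maximum of this function,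
      and a parabola with vertex at \<open>x\<close> leaves the derivative there unchanged.\<close>
    have "((\<lambda>y. f y - g_real y - C * (y - x)\<^sup>2) has_real_derivative f' x - g' x) (at x)"
    proof -
      have "((\<lambda>y. C * (y - x)\<^sup>2) has_real_derivative 0) (at x)"
        by (auto intro!: derivative_eq_intros)
      from DERIV_diff[OF h' this] show ?thesis by (simp only: diff_zero)
    qed
    moreover have "\<forall>y. \<bar>x - y\<bar> < d \<longrightarrow> f y - g_real y - C * (y - x)\<^sup>2 \<le> f x - g_real x - C * (x - x)\<^sup>2"
    proof (intro allI impI)
      fix y assume "\<bar>x - y\<bar> < d"
      then have "q_mu \<mu> y \<le> ereal (g_real y + C * (y - x)\<^sup>2)" using d(2) by (simp add: abs_minus_commute)
      with le[of y] have "ereal (f y) \<le> ereal (g_real y + C * (y - x)\<^sup>2)" by (rule order_trans)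
      then show "f y - g_real y - C * (y - x)\<^sup>2 \<le> f x - g_real x - C * (x - x)\<^sup>2"
        using eq[OF x] by simp
    qed
    ultimately show ?thesis by (rule DERIV_local_max[OF _ d(1)])
  qed
  \<comment> \<open>Ordinary Rolle, with \<open>c = 0\<close>: \<open>N\<close> zeros of the
    derivative between the nodes, in addition to the \<open>N + 1\<close> at the nodes, make
    \<open>2 N + 1\<close>.\<close>
  obtain R where R: "finite R" "Suc (card R) = card (nodes N)" "R \<inter> nodes N = {}" "R \<subseteq> {0<..<1}"
    "\<forall>x\<in>R. f' x - g' x = 0 * (f x - g_real x)"
    using rolle_zeros[OF nodes(1)[of N] nodes(4) nodes(3) h', where c = 0] eq by auto
  let ?e = "\<lambda>n. c n - g_hat \<mu> N n"
  have e: "trig_coeffs N ?e (\<lambda>x. f x - g_real x)"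
    by (intro trig_coeffs_diff c trig_coeffs_g_real)
  have "2 * of_real pi * \<i> * of_int n * ?e n = 0" if "\<bar>n\<bar> \<le> int N" for n
  proof (rule trig_coeffs_zero[OF trig_coeffs_deriv[OF e h']])
    show "finite (nodes N \<union> R)" "nodes N \<union> R \<subseteq> {0<..<1}" using R nodes[of N] by auto
    have "card (nodes N \<union> R) = card (nodes N) + card R"
      using R nodes(1) by (intro card_Un_disjoint) auto
    then show "2 * N + 1 \<le> card (nodes N \<union> R)" using R(2) nodes(2)[of N] by simp
  qed (use R(5) h'0 that in auto)
  then have e0: "?e n = 0" if "\<bar>n\<bar> \<le> int N" "n \<noteq> 0" for n
    using that by (metis complex_i_not_zero mult_eq_0_iff of_int_eq_0_iff of_real_eq_0_iff pi_neq_zero zero_neq_numeral)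
  have const: "complex_of_real (f x - g_real x) = ?e 0" for x
  proof -
    have "complex_of_real (f x - g_real x) = (\<Sum>n = - int N..int N. ?e n * unit_exp (of_int n * x))"
      using e unfolding trig_coeffs_def by blast
    also have "\<dots> = (\<Sum>n\<in>{0}. ?e n * unit_exp (of_int n * x))"
      by (rule sum.mono_neutral_right) (use e0 in auto)
    finally show ?thesis by simp
  qed
  \<comment> \<open>The derivative carries no information about frequency 0; the value at one node
    settles it.\<close>
  obtain \<xi> where "\<xi> \<in> nodes N" using nodes(4) by blast
  then have "?e 0 = 0" using const[of \<xi>] eq[of \<xi>] by simp
  with const[of x] show "f x = g_real x" by simp
qed

end

theorem theorem6p3:
  fixes \<mu> :: "real measure" and N :: nat
  assumes "sets \<mu> = sets (restrict_space borel {0<..})"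
    and "0 < (\<integral>\<^sup>+ l. ennreal (l / (l\<^sup>2 + 1)) \<partial>\<mu>)"
    and "(\<integral>\<^sup>+ l. ennreal (l / (l\<^sup>2 + 1)) \<partial>\<mu>) < \<infinity>"
  shows "(\<forall>x :: real. g_mu \<mu> N x \<in> \<real> \<and> ereal (Re (g_mu \<mu> N x)) \<le> q_mu \<mu> x) \<and>
    (\<forall>gt :: real \<Rightarrow> real.
       real_trig_poly N gt \<and> (\<forall>x. ereal (gt x) \<le> q_mu \<mu> x) \<longrightarrow>
         (LINT x:{0..<1}|lborel. gt x) \<le> (LINT x:{0..<1}|lborel. Re (g_mu \<mu> N x)) \<and>
         ((LINT x:{0..<1}|lborel. gt x) = (LINT x:{0..<1}|lborel. Re (g_mu \<mu> N x))
            \<longleftrightarrow> (\<forall>x. complex_of_real (gt x) = g_mu \<mu> N x)))"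
proof -
  note eq = g_mu_eq[OF assms(1,3)]
  have re: "Re (g_mu \<mu> N x) = g_real \<mu> N x" for x by (simp add: eq)
  show ?thesis
    unfolding re
  proof (intro conjI allI impI)
    fix x
    show "g_mu \<mu> N x \<in> \<real>" by (simp add: eq)
    show "ereal (g_real \<mu> N x) \<le> q_mu \<mu> x" by (rule g_real_le_q_mu[OF assms(1,3)])
  next
    fix gt assume gt: "real_trig_poly N gt \<and> (\<forall>x. ereal (gt x) \<le> q_mu \<mu> x)"
    then obtain c where c: "trig_coeffs N c gt" by (auto simp: real_trig_poly_iff)
    note ext = extremal[OF assms(1,3) c]
    show "(LINT x:{0..<1}|lborel. gt x) \<le> (LINT x:{0..<1}|lborel. g_real \<mu> N x)"
      using ext(1) gt by blast
    show "(LINT x:{0..<1}|lborel. gt x) = (LINT x:{0..<1}|lborel. g_real \<mu> N x) \<longleftrightarrow>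
        (\<forall>x. complex_of_real (gt x) = g_mu \<mu> N x)"
    proof
      assume "(LINT x:{0..<1}|lborel. gt x) = (LINT x:{0..<1}|lborel. g_real \<mu> N x)"
      from ext(2)[OF _ this] gt have "gt x = g_real \<mu> N x" for x by blast
      then show "\<forall>x. complex_of_real (gt x) = g_mu \<mu> N x" by (simp only: eq simp_thms)
    next
      assume "\<forall>x. complex_of_real (gt x) = g_mu \<mu> N x"
      then have "gt = g_real \<mu> N" by (auto simp only: eq of_real_eq_iff fun_eq_iff)
      then show "(LINT x:{0..<1}|lborel. gt x) = (LINT x:{0..<1}|lborel. g_real \<mu> N x)" by simp
    qed
  qed
qed

end
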